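(* Let $\mathcal{D}$ be the arrangement of $8$ planes in $\mathbb{C}^3$ (the "deleted $\mathrm{B}_3$ arrangement") with defining linear forms, in this order, $x-z,\ y-z,\ x,\ y,\ x-y+z,\ z,\ x-y-z,\ x-y$. Then the characteristic variety $V_1(\mathcal{D})\subset(\mathbb{C}^* )^8$ has an irreducible component equal to $$C=\{(t,-t^{-1},-t^{-1},t,t^2,-1,t^{-2},-1)\mid t\in\mathbb{C}^*\},$$ a $1$-dimensional subtorus of $(\mathbb{C}^* )^8$ translated by a character of order $2$, which does not pass through $\mathbf{1}=(1,\dots,1)$.
   Context: Let $\mathcal{A}=\{H_1,\dots,H_n\}$ be an arrangement of hyperplanes in $\mathbb{C}^{\ell}$, $\ell\ge 2$, with complement $X=X(\mathcal{A})=\mathbb{C}^{\ell}\setminus\bigcup_{i=1}^n H_i$ and $G=\pi_1(X)$. Then $H_1(X,\mathbb{Z})\cong\mathbb{Z}^n$, with basis the classes of the (complex-oriented) meridians of $H_1,\dots,H_n$. A point $\mathbf{t}=(t_1,\dots,t_n)\in(\mathbb{C}^* )^n$ defines a character $G\to H_1(X,\mathbb{Z})\cong\mathbb{Z}^n\to\mathbb{C}^*$ sending the $i$-th meridian to $t_i$; let $\mathbb{C}_{\mathbf{t}}$ be the corresponding rank $1$ local system ($G$-module structure on $\mathbb{C}$). For $d\ge 0$, the $d$-th characteristic variety is the algebraic subvariety $$V_d(\mathcal{A})=\{\mathbf{t}\in(\mathbb{C}^* )^n \mid \dim_{\mathbb{C}}H^1(X,\mathbb{C}_{\mathbf{t}})\ge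 d\}.$$ *)

theory Defs
  imports
    "HOL-Homology.Homology"
    "HOL-Complex_Analysis.Complex_Analysis"
    "HOL-Library.Extended_Nat"
    "HOL-Library.Numeral_Type"
begin

section \<open>Cohomology with coefficients in a rank one local system\<close>

text \<open>
  A rank one complex local system on \<open>S\<close> is a functor from the fundamental groupoid of \<open>S\<close> to
  one-dimensional complex vector spaces. Identifying every fibre with the complex numbers, it is a
  function on paths: \<open>L \<gamma>\<close> is the scalar by which \<open>\<gamma>\<close> carries the fibre over \<open>pathfinish \<gamma>\<close> to the
  fibre over \<open>pathstart \<gamma>\<close>. Restricted to the loops at a base point it is the character of the
  fundamental group that makes the complex numbers a module over that group.
\<close>

definition rank_one_local_system ::
    "'a::topological_space set \<Rightarrow> ((real \<Rightarrow> 'a) \<Rightarrow> complex) \<Rightarrow> bool" where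
  "rank_one_local_system S L \<longleftrightarrow>
     (\<forall>\<gamma>. path \<gamma> \<and> path_image \<gamma> \<subseteq> S \<longrightarrow> L \<gamma> \<noteq> 0) \<and>
     (\<forall>\<gamma> \<delta>. homotopic_paths S \<gamma> \<delta> \<longrightarrow> L \<gamma> = L \<delta>) \<and>
     (\<forall>\<gamma> \<delta>. path \<gamma> \<and> path_image \<gamma> \<subseteq> S \<and> path \<delta> \<and> path_image \<delta> \<subseteq> S \<and>
            pathfinish \<gamma> = pathstart \<delta> \<longrightarrow> L (\<gamma> +++ \<delta>) = L \<gamma> * L \<delta>)"

text \<open>The edge of a singular simplex from its vertex 0 to its vertex 1.\<close>

definition first_edge :: "((nat \<Rightarrow> real) \<Rightarrow> 'a) \<Rightarrow> real \<Rightarrow> 'a" where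
  "first_edge \<sigma> = (\<lambda>u. \<sigma> (\<lambda>i. if i = 0 then 1 - u else if i = 1 then u else 0))"

text \<open>
  A cochain takes a singular simplex to an element of the fibre over vertex 0 of the simplex.
  Cochains vanish outside the singular simplices, so that they are determined by their values there.
\<close>

definition twisted_cochains ::
    "nat \<Rightarrow> 'a::topological_space set \<Rightarrow> (((nat \<Rightarrow> real) \<Rightarrow> 'a) \<Rightarrow> complex) set" where
  "twisted_cochains p S = {f. \<forall>\<sigma>. \<not> singular_simplex p (top_of_set S) \<sigma> \<longrightarrow> f \<sigma> = 0}"

text \<open>
  Face 0 of \<open>\<sigma>\<close> is the only face that omits vertex 0 of \<open>\<sigma>\<close>; the value on it lies in the
  fibre over vertex 1 and is transported back along \<open>first_edge \<sigma>\<close>.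
\<close>

definition twisted_coboundary ::
    "nat \<Rightarrow> 'a::topological_space set \<Rightarrow> ((real \<Rightarrow> 'a) \<Rightarrow> complex) \<Rightarrow>
     (((nat \<Rightarrow> real) \<Rightarrow> 'a) \<Rightarrow> complex) \<Rightarrow> (((nat \<Rightarrow> real) \<Rightarrow> 'a) \<Rightarrow> complex)" where
  "twisted_coboundary p S L f =
     (\<lambda>\<sigma>. if singular_simplex (Suc p) (top_of_set S) \<sigma>
          then L (first_edge \<sigma>) * f (singular_face (Suc p) 0 \<sigma>)
               + (\<Sum>k = 1..Suc p. (-1) ^ k * f (singular_face (Suc p) k \<sigma>))
          else 0)"

definition twisted_cocycles ::
    "nat \<Rightarrow> 'a::topological_space set \<Rightarrow> ((real \<Rightarrow> 'a) \<Rightarrow> complex) \<Rightarrow>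
     (((nat \<Rightarrow> real) \<Rightarrow> 'a) \<Rightarrow> complex) set" where
  "twisted_cocycles p S L =
     {f \<in> twisted_cochains p S. twisted_coboundary p S L f = (\<lambda>\<sigma>. 0)}"

definition twisted_coboundaries ::
    "nat \<Rightarrow> 'a::topological_space set \<Rightarrow> ((real \<Rightarrow> 'a) \<Rightarrow> complex) \<Rightarrow>
     (((nat \<Rightarrow> real) \<Rightarrow> 'a) \<Rightarrow> complex) set" where
  "twisted_coboundaries p S L =
     (case p of 0 \<Rightarrow> {\<lambda>\<sigma>. 0} | Suc q \<Rightarrow> twisted_coboundary q S L ` twisted_cochains q S)"

text \<open>
  The complex dimension of \<open>Z / B\<close>, for subspaces \<open>B\<close> and \<open>Z\<close> of a space of complex functions with
  \<open>B\<close> contained in \<open>Z\<close>: the supremum of the lengths of families in \<open>Z\<close> whose classes modulo \<open>B\<close>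
  are linearly independent.
\<close>

definition quotient_dim :: "('s \<Rightarrow> complex) set \<Rightarrow> ('s \<Rightarrow> complex) set \<Rightarrow> enat" where
  "quotient_dim Z B =
     Sup {enat d | d. \<exists>f :: nat \<Rightarrow> 's \<Rightarrow> complex. (\<forall>i<d. f i \<in> Z) \<and>
            (\<forall>c :: nat \<Rightarrow> complex. (\<lambda>s. \<Sum>i<d. c i * f i s) \<in> B \<longrightarrow> (\<forall>i<d. c i = 0))}"

definition twisted_cohomology_dim ::
    "nat \<Rightarrow> 'a::topological_space set \<Rightarrow> ((real \<Rightarrow> 'a) \<Rightarrow> complex) \<Rightarrow> enat" where
  "twisted_cohomology_dim p S L = quotient_dim (twisted_cocycles p S L) (twisted_coboundaries p S L)"


section \<open>The complex torus and its Zariski topology\<close>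

definition torus :: "(complex^'n) set" where
  "torus = {t. \<forall>i. t $ i \<noteq> 0}"

definition torus_group :: "(complex^'n) monoid" where
  "torus_group = \<lparr>carrier = torus, monoid.mult = (*), one = 1\<rparr>"

lemma comm_group_torus_group: "comm_group (torus_group :: (complex^'n) monoid)"
proof (rule comm_groupI)
  fix x :: "complex^'n"
  assume "x \<in> carrier torus_group"
  then have "(\<chi> i. inverse (x $ i)) \<in> carrier torus_group
      \<and> (\<chi> i. inverse (x $ i)) \<otimes>\<^bsub>torus_group\<^esub> x = \<one>\<^bsub>torus_group\<^esub>"
    by (simp add: torus_group_def torus_def vec_eq_iff)
  then show "\<exists>y\<in>carrier torus_group. y \<otimes>\<^bsub>torus_group\<^esub> x = \<one>\<^bsub>torus_group\<^esub>"
    by blast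
qed (auto simp: torus_group_def torus_def vec_eq_iff)

text \<open>Laurent polynomials, as functions; they are the regular functions on the torus.\<close>

inductive laurent_polynomial :: "(complex^'n \<Rightarrow> complex) \<Rightarrow> bool" where
  const: "laurent_polynomial (\<lambda>t. c)"
| coord: "laurent_polynomial (\<lambda>t. t $ i)"
| coord_inverse: "laurent_polynomial (\<lambda>t. inverse (t $ i))"
| add: "laurent_polynomial f \<Longrightarrow> laurent_polynomial g \<Longrightarrow> laurent_polynomial (\<lambda>t. f t + g t)"
| mult: "laurent_polynomial f \<Longrightarrow> laurent_polynomial g \<Longrightarrow> laurent_polynomial (\<lambda>t. f t * g t)"

definition zariski_torus :: "(complex^'n) topology" where
  "zariski_torus = topology_generated_by {{t \<in> torus. f t \<noteq> 0} | f. laurent_polynomial f}"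

lemma topspace_zariski_torus: "topspace (zariski_torus :: (complex^'n) topology) = torus"
proof -
  have "torus \<in> {{t \<in> torus. f t \<noteq> 0} | f :: complex^'n \<Rightarrow> complex. laurent_polynomial f}"
    by (rule CollectI, rule exI[of _ "\<lambda>t. 1"]) (auto intro: laurent_polynomial.const)
  then show ?thesis
    unfolding zariski_torus_def topology_generated_by_topspace by blast
qed

definition irreducible_in :: "'a topology \<Rightarrow> 'a set \<Rightarrow> bool" where
  "irreducible_in X C \<longleftrightarrow> C \<noteq> {} \<and> C \<subseteq> topspace X \<and>
     (\<forall>A B. closedin X A \<and> closedin X B \<and> C \<subseteq> A \<union> B \<longrightarrow> C \<subseteq> A \<or> C \<subseteq> B)"

definition irreducible_component_of :: "'a topology \<Rightarrow> 'a set \<Rightarrow> 'a set \<Rightarrow> bool" where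
  "irreducible_component_of X V C \<longleftrightarrow> C \<subseteq> V \<and> irreducible_in X C \<and>
     (\<forall>D. irreducible_in X D \<and> C \<subseteq> D \<and> D \<subseteq> V \<longrightarrow> D = C)"

text \<open>
  A subtorus of dimension \<open>CARD('k)\<close>: a closed subgroup isomorphic, as an algebraic group, to the
  torus on \<open>'k\<close>. Here \<open>\<phi>\<close> is the isomorphism and \<open>\<psi>\<close> restricts to its inverse.
\<close>

definition subtorus :: "'k::finite itself \<Rightarrow> (complex^'n) set \<Rightarrow> bool" where
  "subtorus _ T \<longleftrightarrow> subgroup T torus_group \<and> closedin zariski_torus T \<and>
     (\<exists>(\<phi> :: complex^'k \<Rightarrow> complex^'n) (\<psi> :: complex^'n \<Rightarrow> complex^'k).
        (\<forall>i. laurent_polynomial (\<lambda>s. \<phi> s $ i)) \<and> (\<forall>j. laurent_polynomial (\<lambda>t. \<psi> t $ j)) \<and>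
        \<phi> \<in> hom torus_group torus_group \<and> \<phi> ` torus = T \<and> (\<forall>s\<in>torus. \<psi> (\<phi> s) = s))"


section \<open>Characteristic varieties of hyperplane arrangements\<close>

definition arrangement_complement :: "('n::finite \<Rightarrow> (complex^'l) set) \<Rightarrow> (complex^'l) set" where
  "arrangement_complement H = UNIV - (\<Union>i. H i)"

text \<open>
  The complex-oriented meridians of \<open>H i\<close>: boundaries of small discs in complex lines that meet the
  arrangement only in their centre \<open>p\<close>, a point of \<open>H i\<close> on no other hyperplane. The vector \<open>v\<close>
  is then automatically transverse to \<open>H i\<close>.
\<close>

definition meridians ::
    "('n::finite \<Rightarrow> (complex^'l) set) \<Rightarrow> 'n \<Rightarrow> (real \<Rightarrow> complex^'l) set" where
  "meridians H i =
     {(\<lambda>s. p + circlepath 0 1 s *s v) | p v.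
        p \<in> H i \<and> (\<forall>j. j \<noteq> i \<longrightarrow> p \<notin> H j) \<and>
        (\<forall>z. z \<noteq> 0 \<and> norm z \<le> 1 \<longrightarrow> p + z *s v \<in> arrangement_complement H)}"

text \<open>
  The rank one local system of \<open>t\<close>. The classes of the meridians form a basis of the first homology
  group of the complement, and \<open>L\<close> factors through homology on loops, so up to isomorphism there
  is exactly one such \<open>L\<close>.
\<close>

definition local_system_of_character ::
    "('n::finite \<Rightarrow> (complex^'l) set) \<Rightarrow> complex^'n \<Rightarrow> ((real \<Rightarrow> complex^'l) \<Rightarrow> complex) \<Rightarrow> bool" where
  "local_system_of_character H t L \<longleftrightarrow>
     rank_one_local_system (arrangement_complement H) L \<and> (\<forall>i. \<forall>\<mu>\<in>meridians H i. L \<mu> = t $ i)"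

definition characteristic_variety ::
    "nat \<Rightarrow> ('n::finite \<Rightarrow> (complex^'l) set) \<Rightarrow> (complex^'n) set" where
  "characteristic_variety d H =
     {t \<in> torus. \<exists>L. local_system_of_character H t L \<and>
                    twisted_cohomology_dim 1 (arrangement_complement H) L \<ge> enat d}"


section \<open>The deleted B3 arrangement\<close>

text \<open>The eighth entry of a vector over the index type \<open>8\<close> has index \<open>8 = 0\<close>.\<close>

lemma vector_8 [simp]:
  fixes a b c d e f g h :: "'a::zero"
  shows "(vector [a, b, c, d, e, f, g, h] :: 'a^8) $ 1 = a"
    "(vector [a, b, c, d, e, f, g, h] :: 'a^8) $ 2 = b"
    "(vector [a, b, c, d, e, f, g, h] :: 'a^8) $ 3 = c"
    "(vector [a, b, c, d, e, f, g, h] :: 'a^8) $ 4 = d"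
    "(vector [a, b, c, d, e, f, g, h] :: 'a^8) $ 5 = e"
    "(vector [a, b, c, d, e, f, g, h] :: 'a^8) $ 6 = f"
    "(vector [a, b, c, d, e, f, g, h] :: 'a^8) $ 7 = g"
    "(vector [a, b, c, d, e, f, g, h] :: 'a^8) $ 8 = h"
  by (simp_all add: vector_def)

definition deleted_B3_forms :: "complex^3 \<Rightarrow> complex^8" where
  "deleted_B3_forms w =
     (let x = w $ 1; y = w $ 2; z = w $ 3
      in vector [x - z, y - z, x, y, x - y + z, z, x - y - z, x - y])"

definition deleted_B3 :: "8 \<Rightarrow> (complex^3) set" where
  "deleted_B3 i = {w. deleted_B3_forms w $ i = 0}"

end

theory Submission
  imports Defs
begin

text \<open>
  In the coordinates \<open>a = (x + y - z) / 2\<close>, \<open>m = (x - y + z) / 2\<close>, \<open>e = (x - y - z) / 2\<close> the planes are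
  \<open>a = \<plusminus> m\<close>, \<open>a = \<plusminus> e\<close>, \<open>m = \<plusminus> e\<close>, \<open>m = 0\<close>, \<open>e = 0\<close>. A class in \<open>H\<^sup>1\<close> is given by a function \<open>c\<close> on paths
  with \<open>c (g +++ h) = c g + L g * c h\<close>, and vanishes if and only if the corresponding affine action of paths has
  a flat section.

  Upper bound. If all \<open>t i \<noteq> 1\<close>, a loop with non-trivial monodromy has a unique fixed point, commuting loops share it,
  and loops that move in a family give a flat section. Unless the product of the \<open>t i\<close> over each of certain multiple
  points is \<open>1\<close>, these sections glue to a flat section over one fibre of \<open>(a, m, e) \<mapsto> (m, e)\<close> and propagate to the whole
  complement. The equations for the products, for all symmetric choices of the fibre, imply \<open>t\<^sub>6\<^sup>4 = 1\<close>, and leave the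
  translated torus where \<open>t\<^sub>6 = -1\<close>.

  Lower bound. The map \<open>F = m\<^sup>2 (a\<^sup>2 - e\<^sup>2) / (e\<^sup>2 (a\<^sup>2 - m\<^sup>2))\<close> omits \<open>0\<close> and \<open>\<infinity>\<close> on the complement, and
  \<open>1 - F = a\<^sup>2 (e\<^sup>2 - m\<^sup>2) / (e\<^sup>2 (a\<^sup>2 - m\<^sup>2))\<close> has a double zero along \<open>a = 0\<close>. The local systems of the translated torus
  are pulled back from the orbifold with cone point \<open>1\<close> of order 2. Counting the crossings of a path with the wall \<open>F < 0\<close>,
  weighted by the local system, gives a cocycle that is not a coboundary.
\<close>

section \<open>Affine transport along paths\<close>

text \<open>No presentation of the fundamental group enters. The monodromy of the few loops that
  matter is derived from the meridians alone, by restricting to complex lines that meet the planes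
  in real points and by splitting loops along tori. This is why all calculations happen near real
  points such as \<open>(m, e) = (3, 1)\<close>. That the curve is a whole component does not
  require the other components: it suffices that the variety lies in the union of the curve and one
  closed hypersurface that does not contain the curve. The hypersurface collects all degenerate
  cases, namely some \<open>t i = 1\<close>, where a meridian has no unique fixed point, and
  \<open>t\<^sub>6\<^sup>2 = -1\<close>, the half of \<open>t\<^sub>6\<^sup>4 = 1\<close> that does
  not lead to the curve. The obstacle in the lower bound is that a continuous path may meet the wall
  infinitely often, on many sheets of its preimage. The crossings of each sheet are therefore
  counted by a winding number, of a phase function that is \<open>1\<close> away from this sheet.
  The weight of a sheet is the value there of a flat section, which exists off
  \<open>F \<ge> 0\<close> because the double zero along \<open>a = 0\<close> makes the required
  square root single-valued.\<close>

lemma homotopic_paths_convex_image: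
  fixes K :: "'b::real_normed_vector set"
  assumes "convex K" "continuous_on K H" "H ` K \<subseteq> S"
    "path p" "path_image p \<subseteq> K" "path q" "path_image q \<subseteq> K"
    "pathstart q = pathstart p" "pathfinish q = pathfinish p"
  shows "homotopic_paths S (H \<circ> p) (H \<circ> q)"
proof -
  have "homotopic_paths K p q"
    using convex_imp_simply_connected[OF assms(1)] assms(4-)
    by (simp add: simply_connected_eq_homotopic_paths)
  then show ?thesis
    by (rule homotopic_paths_continuous_image) (use assms in auto)
qed

text \<open>
  \<open>L\<close> is the linear part and \<open>c\<close> the translation part of the action of paths on an affine line:
  \<open>\<gamma>\<close> carries \<open>v\<close> over its end to \<open>L \<gamma> * v - c \<gamma>\<close> over its start.
\<close>

locale affine_transport =
  fixes S :: "'a::real_normed_vector set" and L c :: "(real \<Rightarrow> 'a) \<Rightarrow> complex"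
  assumes L_nonzero: "path g \<Longrightarrow> path_image g \<subseteq> S \<Longrightarrow> L g \<noteq> 0"
    and L_homotopic: "homotopic_paths S g h \<Longrightarrow> L g = L h"
    and c_homotopic: "homotopic_paths S g h \<Longrightarrow> c g = c h"
    and L_join: "path g \<Longrightarrow> path_image g \<subseteq> S \<Longrightarrow> path h \<Longrightarrow> path_image h \<subseteq> S \<Longrightarrow>
      pathfinish g = pathstart h \<Longrightarrow> L (g +++ h) = L g * L h"
    and c_join: "path g \<Longrightarrow> path_image g \<subseteq> S \<Longrightarrow> path h \<Longrightarrow> path_image h \<subseteq> S \<Longrightarrow>
      pathfinish g = pathstart h \<Longrightarrow> c (g +++ h) = c g + L g * c h"

text \<open>Invariance of \<open>h\<close> under the affine action over \<open>U\<close>, which is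
  the same as \<open>c\<close> being the coboundary of the 0-cochain \<open>h\<close> on the paths
  in \<open>U\<close>.\<close>

definition flat_on ::
  "((real \<Rightarrow> 'a::topological_space) \<Rightarrow> complex) \<Rightarrow> ((real \<Rightarrow> 'a) \<Rightarrow> complex) \<Rightarrow> 'a set \<Rightarrow> ('a \<Rightarrow> complex) \<Rightarrow> bool"
  where "flat_on L c U h \<longleftrightarrow>
    (\<forall>g. path g \<and> path_image g \<subseteq> U \<longrightarrow> c g = L g * h (pathfinish g) - h (pathstart g))"

lemma flat_onI:
  "(\<And>g. path g \<Longrightarrow> path_image g \<subseteq> U \<Longrightarrow> c g = L g * h (pathfinish g) - h (pathstart g)) \<Longrightarrow> flat_on L c U h"
  by (simp add: flat_on_def)

lemma flat_onD:
  "flat_on L c U h \<Longrightarrow> path g \<Longrightarrow> path_image g \<subseteq> U \<Longrightarrow> c g = L g * h (pathfinish g) - h (pathstart g)"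
  by (simp add: flat_on_def)

lemma flat_on_mono: "flat_on L c U h \<Longrightarrow> V \<subseteq> U \<Longrightarrow> flat_on L c V h"
  unfolding flat_on_def by blast

lemma flat_on_cong: "flat_on L c U h \<Longrightarrow> (\<And>w. w \<in> U \<Longrightarrow> k w = h w) \<Longrightarrow> flat_on L c U k"
  unfolding flat_on_def by (metis pathfinish_in_path_image pathstart_in_path_image subsetD)

context affine_transport
begin

lemma const:
  assumes "a \<in> S"
  shows "L (linepath a a) = 1" "c (linepath a a) = 0"
proof -
  have *: "homotopic_paths S (linepath a a +++ linepath a a) (linepath a a)"
    by (metis assms homotopic_paths_rid' path_linepath pathfinish_linepath path_image_const
        linepath_refl[symmetric] path_image_linepath closed_segment_idem empty_subsetI insert_subset)
  have "L (linepath a a +++ linepath a a) = L (linepath a a) * L (linepath a a)"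
    using assms by (intro L_join) auto
  then show 1: "L (linepath a a) = 1"
    using L_homotopic[OF *] L_nonzero[of "linepath a a"] assms by auto
  have "c (linepath a a +++ linepath a a) = c (linepath a a) + L (linepath a a) * c (linepath a a)"
    using assms by (intro c_join) auto
  then show "c (linepath a a) = 0"
    using c_homotopic[OF *] 1 by auto
qed

lemma reverse:
  assumes "path g" "path_image g \<subseteq> S"
  shows "L g * L (reversepath g) = 1" "c g + L g * c (reversepath g) = 0"
proof -
  have *: "homotopic_paths S (g +++ reversepath g) (linepath (pathstart g) (pathstart g))"
    using assms by (rule homotopic_paths_rinv)
  have "pathstart g \<in> S" using assms by auto
  note const[OF this]
  moreover have "L (g +++ reversepath g) = L g * L (reversepath g)"
      "c (g +++ reversepath g) = c g + L g * c (reversepath g)"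
    using assms by (auto intro!: L_join c_join)
  ultimately show "L g * L (reversepath g) = 1" "c g + L g * c (reversepath g) = 0"
    using L_homotopic[OF *] c_homotopic[OF *] by simp_all
qed

lemma pullback:
  fixes i :: "'b::real_normed_vector \<Rightarrow> 'a"
  assumes "continuous_on T i" "i ` T \<subseteq> S"
  shows "affine_transport T (\<lambda>g. L (i \<circ> g)) (\<lambda>g. c (i \<circ> g))"
proof
  have im: "path (i \<circ> g) \<and> path_image (i \<circ> g) \<subseteq> S" if "path g" "path_image g \<subseteq> T" for g
    using path_continuous_image[OF that(1) continuous_on_subset[OF assms(1) that(2)]] that(2) assms(2)
    by (fastforce simp: path_image_compose)
  show "L (i \<circ> g) \<noteq> 0" if "path g" "path_image g \<subseteq> T" for g
    using im[OF that] L_nonzero by blast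
  have hom: "homotopic_paths S (i \<circ> g) (i \<circ> h)" if "homotopic_paths T g h" for g h
    using that assms by (intro homotopic_paths_continuous_image) auto
  show "L (i \<circ> g) = L (i \<circ> h)" "c (i \<circ> g) = c (i \<circ> h)" if "homotopic_paths T g h" for g h
    using hom[OF that] L_homotopic c_homotopic by auto
  fix g h :: "real \<Rightarrow> 'b"
  assume *: "path g" "path_image g \<subseteq> T" "path h" "path_image h \<subseteq> T" "pathfinish g = pathstart h"
  have "pathfinish (i \<circ> g) = pathstart (i \<circ> h)"
    using * by (simp add: pathfinish_compose pathstart_compose)
  then show "L (i \<circ> (g +++ h)) = L (i \<circ> g) * L (i \<circ> h)"
      "c (i \<circ> (g +++ h)) = c (i \<circ> g) + L (i \<circ> g) * c (i \<circ> h)"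
    unfolding path_compose_join using im[OF *(1,2)] im[OF *(3,4)] by (simp_all add: L_join c_join)
qed

lemma flat_on_pullback:
  fixes i :: "'b::topological_space \<Rightarrow> 'a"
  assumes "flat_on L c V h" "continuous_on T i" "i ` T \<subseteq> V"
  shows "flat_on (\<lambda>g. L (i \<circ> g)) (\<lambda>g. c (i \<circ> g)) T (h \<circ> i)"
proof (rule flat_onI)
  fix g assume g: "path g" "path_image g \<subseteq> T"
  then have "path (i \<circ> g)" "path_image (i \<circ> g) \<subseteq> V"
    using path_continuous_image[OF g(1) continuous_on_subset[OF assms(2) g(2)]] assms(3)
    by (auto simp: path_image_compose)
  from flat_onD[OF assms(1) this]
  show "c (i \<circ> g) = L (i \<circ> g) * (h \<circ> i) (pathfinish g) - (h \<circ> i) (pathstart g)"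
    by (simp add: pathfinish_compose pathstart_compose)
qed

text \<open>In the convex parameter square the two ways around the boundary and the diagonal are
  homotopic, and \<open>H\<close> carries the homotopies into \<open>S\<close>.\<close>

lemma square:
  fixes H :: "real \<times> real \<Rightarrow> 'a"
  assumes "continuous_on ({0..1} \<times> {0..1}) H" "H ` ({0..1} \<times> {0..1}) \<subseteq> S"
  shows "L (\<lambda>s. H (s,0)) * L (\<lambda>u. H (1,u)) = L (\<lambda>u. H (0,u)) * L (\<lambda>s. H (s,1))"
    and "c (\<lambda>s. H (s,0)) + L (\<lambda>s. H (s,0)) * c (\<lambda>u. H (1,u))
       = c (\<lambda>u. H (0,u)) + L (\<lambda>u. H (0,u)) * c (\<lambda>s. H (s,1))"
    and "L (\<lambda>s. H (s,s)) = L (\<lambda>s. H (s,0)) * L (\<lambda>u. H (1,u))"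
proof -
  let ?Q = "{0..1} \<times> {0..1::real} :: (real \<times> real) set"
  have cv: "convex ?Q" by (intro convex_Times) auto
  have in_Q: "path_image (linepath a b) \<subseteq> ?Q" if "a \<in> ?Q" "b \<in> ?Q" for a b
    using cv that by (simp add: closed_segment_subset)
  have im: "path (H \<circ> linepath a b) \<and> path_image (H \<circ> linepath a b) \<subseteq> S" if "a \<in> ?Q" "b \<in> ?Q" for a b
    using path_continuous_image[OF path_linepath continuous_on_subset[OF assms(1) in_Q[OF that]]]
      assms(2) in_Q[OF that] by (force simp: path_image_compose simp del: path_image_linepath)
  have eqs: "H \<circ> linepath (0,0) (1,0) = (\<lambda>s. H (s,0))" "H \<circ> linepath (1,0) (1,1) = (\<lambda>u. H (1,u))"
    "H \<circ> linepath (0,0) (0,1) = (\<lambda>u. H (0,u))" "H \<circ> linepath (0,1) (1,1) = (\<lambda>s. H (s,1))"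
    "H \<circ> linepath (0,0) (1,1) = (\<lambda>s. H (s,s))"
    by (auto simp: linepath_def fun_eq_iff)
  have hom: "homotopic_paths S (H \<circ> (linepath (0,0) (1,0) +++ linepath (1,0) (1,1)))
                       (H \<circ> (linepath (0,0) (0,1) +++ linepath (0,1) (1,1)))"
    by (rule homotopic_paths_convex_image[OF cv assms]) (auto simp: subset_path_image_join in_Q simp del: path_image_linepath)
  have hom2: "homotopic_paths S (H \<circ> linepath (0,0) (1,1)) (H \<circ> (linepath (0,0) (1,0) +++ linepath (1,0) (1,1)))"
    by (rule homotopic_paths_convex_image[OF cv assms]) (auto simp: subset_path_image_join in_Q simp del: path_image_linepath)
  have J1: "L (H \<circ> (linepath (0,0) (1,0) +++ linepath (1,0) (1,1))) = L (\<lambda>s. H (s,0)) * L (\<lambda>u. H (1,u))"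
     "c (H \<circ> (linepath (0,0) (1,0) +++ linepath (1,0) (1,1))) = c (\<lambda>s. H (s,0)) + L (\<lambda>s. H (s,0)) * c (\<lambda>u. H (1,u))"
    unfolding path_compose_join eqs(1,2)[symmetric]
    using im[of "(0,0)" "(1,0)"] im[of "(1,0)" "(1,1)"] im[of "(0,0)" "(0,1)"] im[of "(0,1)" "(1,1)"]
    by (simp_all add: L_join c_join pathfinish_compose pathstart_compose)
  have J2: "L (H \<circ> (linepath (0,0) (0,1) +++ linepath (0,1) (1,1))) = L (\<lambda>s. H (0,s)) * L (\<lambda>u. H (u,1))"
     "c (H \<circ> (linepath (0,0) (0,1) +++ linepath (0,1) (1,1))) = c (\<lambda>s. H (0,s)) + L (\<lambda>s. H (0,s)) * c (\<lambda>u. H (u,1))"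
    unfolding path_compose_join eqs(3,4)[symmetric]
    using im[of "(0,0)" "(1,0)"] im[of "(1,0)" "(1,1)"] im[of "(0,0)" "(0,1)"] im[of "(0,1)" "(1,1)"]
    by (simp_all add: L_join c_join pathfinish_compose pathstart_compose)
  show "L (\<lambda>s. H (s,0)) * L (\<lambda>u. H (1,u)) = L (\<lambda>u. H (0,u)) * L (\<lambda>s. H (s,1))"
    "c (\<lambda>s. H (s,0)) + L (\<lambda>s. H (s,0)) * c (\<lambda>u. H (1,u))
       = c (\<lambda>u. H (0,u)) + L (\<lambda>u. H (0,u)) * c (\<lambda>s. H (s,1))"
    using L_homotopic[OF hom] c_homotopic[OF hom] J1 J2 by simp_all
  show "L (\<lambda>s. H (s,s)) = L (\<lambda>s. H (s,0)) * L (\<lambda>u. H (1,u))"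
    using L_homotopic[OF hom2] J1 eqs by simp
qed

text \<open>Two loops that bound a torus have the same fixed point.\<close>

lemma torus_commute:
  fixes H :: "real \<times> real \<Rightarrow> 'a"
  assumes "continuous_on ({0..1} \<times> {0..1}) H" "H ` ({0..1} \<times> {0..1}) \<subseteq> S"
    "\<And>s. H (s,0) = H (s,1)" "\<And>u. H (0,u) = H (1,u)"
  shows "c (\<lambda>s. H (s,0)) * (L (\<lambda>u. H (0,u)) - 1) = c (\<lambda>u. H (0,u)) * (L (\<lambda>s. H (s,0)) - 1)"
    and "L (\<lambda>s. H (s,s)) = L (\<lambda>s. H (s,0)) * L (\<lambda>u. H (0,u))"
  using square[OF assms(1,2)] assms(3,4) by (simp_all add: algebra_simps)

text \<open>The family over the path \<open>g\<close> is a square: its vertical sides are the loops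
  at the two ends, and both horizontal sides are \<open>i \<circ> g\<close>. Cancelling the common
  factor \<open>L (i \<circ> g)\<close> gives equal monodromy.\<close>

lemma loop_family:
  fixes i :: "'b::real_normed_vector \<Rightarrow> 'a"
  assumes cont: "continuous_on (U \<times> {0..1}) (\<lambda>(w,s). \<phi> w s)"
    and sub: "\<And>w s. w \<in> U \<Longrightarrow> s \<in> {0..1} \<Longrightarrow> \<phi> w s \<in> S"
    and ends: "\<And>w. w \<in> U \<Longrightarrow> \<phi> w 0 = i w" "\<And>w. w \<in> U \<Longrightarrow> \<phi> w 1 = i w"
    and g: "path g" "path_image g \<subseteq> U"
  shows "L (\<phi> (pathstart g)) = L (\<phi> (pathfinish g))"
    and "c (i \<circ> g) * (L (\<phi> (pathstart g)) - 1) = L (i \<circ> g) * c (\<phi> (pathfinish g)) - c (\<phi> (pathstart g))"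
proof -
  define H where "H = (\<lambda>(s,u). \<phi> (g s) u)"
  have gU: "s \<in> {0..1} \<Longrightarrow> g s \<in> U" for s using g by (auto simp: path_image_def)
  have cg: "continuous_on {0..1} g" using g by (simp add: path_def)
  have cH: "continuous_on ({0..1} \<times> {0..1}) H"
  proof -
    have "continuous_on ({0..1} \<times> {0..1}) ((\<lambda>(w,s). \<phi> w s) \<circ> (\<lambda>(s,u). (g s, u)))"
    proof (rule continuous_on_compose)
      show "continuous_on ({0..1} \<times> {0..1}) (\<lambda>(s,u::real). (g s, u))"
        unfolding case_prod_unfold
        by (intro continuous_intros continuous_on_compose2[OF cg]) auto
      show "continuous_on ((\<lambda>(s,u::real). (g s, u)) ` ({0..1} \<times> {0..1})) (\<lambda>(w,s). \<phi> w s)"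
        by (rule continuous_on_subset[OF cont]) (use gU in auto)
    qed
    then show ?thesis by (simp add: H_def o_def case_prod_unfold)
  qed
  have HS: "H ` ({0..1} \<times> {0..1}) \<subseteq> S" using sub gU by (auto simp: H_def)
  have ig: "path (i \<circ> g)" "path_image (i \<circ> g) \<subseteq> S"
  proof -
    have "continuous_on {0..1} (\<lambda>s. H (s,0))"
      by (rule continuous_on_compose2[OF cH]) (auto intro!: continuous_intros)
    then have "continuous_on {0..1} (i \<circ> g)"
      by (rule continuous_on_eq) (use ends gU in \<open>auto simp: H_def\<close>)
    then show "path (i \<circ> g)" by (simp add: path_def)
    have "i (g s) \<in> S" if "s \<in> {0..1}" for s
      using sub[OF gU[OF that], of 0] ends gU[OF that] by auto
    then show "path_image (i \<circ> g) \<subseteq> S" by (auto simp: path_image_def)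
  qed
  \<comment> \<open>The hypotheses control these paths only on \<open>[0,1]\<close>, where they
    agree; as functions they may differ, so homotopy replaces equality.\<close>
  have hom: "homotopic_paths S (\<lambda>s. H (s,k)) (i \<circ> g)" if "k = 0 \<or> k = 1" for k
    by (rule homotopic_paths_sym, rule homotopic_paths_eq)
      (use ig that ends gU in \<open>auto simp: H_def\<close>)
  have e: "L (\<lambda>s. H (s,k)) = L (i \<circ> g)" "c (\<lambda>s. H (s,k)) = c (i \<circ> g)" if "k = 0 \<or> k = 1" for k
    using L_homotopic[OF hom[OF that]] c_homotopic[OF hom[OF that]] by auto
  have f: "(\<lambda>u. H (1,u)) = \<phi> (pathfinish g)" "(\<lambda>u. H (0,u)) = \<phi> (pathstart g)"
    by (auto simp: H_def pathfinish_def pathstart_def fun_eq_iff)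
  note sq = square[OF cH HS]
  have nz: "L (i \<circ> g) \<noteq> 0" using ig L_nonzero by blast
  show "L (\<phi> (pathstart g)) = L (\<phi> (pathfinish g))"
    using sq(1) nz by (simp add: e f)
  show "c (i \<circ> g) * (L (\<phi> (pathstart g)) - 1) = L (i \<circ> g) * c (\<phi> (pathfinish g)) - c (\<phi> (pathstart g))"
    using sq(2) by (simp add: e f algebra_simps)
qed

text \<open>The fixed points of a continuous family of loops with non-trivial monodromy form a flat section.\<close>

lemma flat_on_loop_family:
  fixes i :: "'b::real_normed_vector \<Rightarrow> 'a"
  assumes "continuous_on (U \<times> {0..1}) (\<lambda>(w,s). \<phi> w s)"
    and "\<And>w s. w \<in> U \<Longrightarrow> s \<in> {0..1} \<Longrightarrow> \<phi> w s \<in> S"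
    and "\<And>w. w \<in> U \<Longrightarrow> \<phi> w 0 = i w" "\<And>w. w \<in> U \<Longrightarrow> \<phi> w 1 = i w"
    and \<tau>: "\<And>w. w \<in> U \<Longrightarrow> L (\<phi> w) = \<tau>" "\<tau> \<noteq> 1"
  shows "flat_on (\<lambda>g. L (i \<circ> g)) (\<lambda>g. c (i \<circ> g)) U (\<lambda>w. c (\<phi> w) / (\<tau> - 1))"
proof (rule flat_onI)
  fix g assume g: "path g" "path_image g \<subseteq> U"
  then have "L (\<phi> (pathstart g)) = \<tau>"
    using \<tau> by (metis pathstart_in_path_image subsetD)
  with loop_family(2)[of U \<phi> i g, OF assms(1-4) g]
  have *: "c (i \<circ> g) * (\<tau> - 1) = L (i \<circ> g) * c (\<phi> (pathfinish g)) - c (\<phi> (pathstart g))"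
    by simp
  have "\<tau> - 1 \<noteq> 0" using \<tau> by simp
  with * show "c (i \<circ> g) = L (i \<circ> g) * (c (\<phi> (pathfinish g)) / (\<tau> - 1)) - c (\<phi> (pathstart g)) / (\<tau> - 1)"
    by (metis (no_types, lifting) diff_divide_distrib nonzero_eq_divide_eq times_divide_eq_right)
qed

text \<open>A loop acts by \<open>v \<mapsto> L g * v - c g\<close>, and a flat section passes
  through a fixed point. For \<open>L g \<noteq> 1\<close> this determines its value at the base
  point.\<close>

lemma flat_loop:
  assumes "flat_on L c U h" "path g" "path_image g \<subseteq> U" "pathfinish g = pathstart g"
  shows "c g = (L g - 1) * h (pathstart g)"
  using flat_onD[OF assms(1-3)] assms(4) by (simp add: algebra_simps)

text \<open>The difference of two flat sections is transported by the nonzero factor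
  \<open>L\<close> alone, so a zero of it spreads along paths.\<close>

lemma flat_on_unique:
  assumes "flat_on L c U h" "flat_on L c U k" "path_connected U" "U \<subseteq> S" "a \<in> U" "h a = k a" "b \<in> U"
  shows "h b = k b"
proof -
  obtain g where g: "path g" "path_image g \<subseteq> U" "pathstart g = a" "pathfinish g = b"
    using assms(3,5,7) unfolding path_connected_def by blast
  have "L g * h b - h a = L g * k b - k a"
    using flat_onD[OF assms(1) g(1,2)] flat_onD[OF assms(2) g(1,2)] g by simp
  moreover have "L g \<noteq> 0" using g assms by (intro L_nonzero) auto
  ultimately show ?thesis using assms(6) by auto
qed

lemma flat_on_simply_connected:
  assumes "simply_connected U" "U \<subseteq> S" "a \<in> U"
  obtains h where "flat_on L c U h" "h a = v"
proof -
  have pc: "path_connected U"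
    and hom: "\<And>p q. \<lbrakk>path p; path_image p \<subseteq> U; path q; path_image q \<subseteq> U;
                pathstart q = pathstart p; pathfinish q = pathfinish p\<rbrakk> \<Longrightarrow> homotopic_paths U p q"
    using assms(1) unfolding simply_connected_eq_homotopic_paths by auto
  have "\<exists>g. path g \<and> path_image g \<subseteq> U \<and> pathstart g = a \<and> pathfinish g = b" if "b \<in> U" for b
    using pc assms(3) that unfolding path_connected_def by blast
  then obtain \<gamma> where \<gamma>: "\<And>b. b \<in> U \<Longrightarrow> path (\<gamma> b) \<and> path_image (\<gamma> b) \<subseteq> U \<and> pathstart (\<gamma> b) = a \<and> pathfinish (\<gamma> b) = b"
    by metis
  \<comment> \<open>The solution of \<open>L (\<gamma> b) * h b - c (\<gamma> b) = v\<close>, that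
    is, the value over \<open>b\<close> that is carried to \<open>v\<close> over
    \<open>a\<close>.\<close>
  define h where "h b = (c (\<gamma> b) + v) / L (\<gamma> b)" for b
  have "flat_on L c U h"
  proof (rule flat_onI)
    fix g assume g: "path g" "path_image g \<subseteq> U"
    define p q where "p = pathstart g" and "q = pathfinish g"
    have pq: "p \<in> U" "q \<in> U" using g by (auto simp: p_def q_def)
    have "homotopic_paths U (\<gamma> p +++ g) (\<gamma> q)"
      by (rule hom) (use g \<gamma>[OF pq(1)] \<gamma>[OF pq(2)] in \<open>auto simp: p_def q_def subset_path_image_join\<close>)
    then have *: "homotopic_paths S (\<gamma> p +++ g) (\<gamma> q)"
      using assms(2) homotopic_paths_subset by blast
    have "L (\<gamma> p +++ g) = L (\<gamma> p) * L g" "c (\<gamma> p +++ g) = c (\<gamma> p) + L (\<gamma> p) * c g"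
      using \<gamma>[OF pq(1)] g assms(2) by (auto intro!: L_join c_join simp: p_def)
    then have "L (\<gamma> q) = L (\<gamma> p) * L g" "c (\<gamma> q) = c (\<gamma> p) + L (\<gamma> p) * c g"
      using L_homotopic[OF *] c_homotopic[OF *] by simp_all
    moreover have "L (\<gamma> p) \<noteq> 0" "L g \<noteq> 0"
      using \<gamma>[OF pq(1)] g assms(2) L_nonzero subset_trans by blast+
    ultimately show "c g = L g * h (pathfinish g) - h (pathstart g)"
      unfolding h_def p_def[symmetric] q_def[symmetric] by (simp add: field_simps)
  qed
  moreover have "h a = v"
  proof -
    have "homotopic_paths U (\<gamma> a) (linepath a a)"
      using \<gamma>[OF assms(3)] assms(3) by (intro hom) auto
    then have "homotopic_paths S (\<gamma> a) (linepath a a)"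
      using assms(2) homotopic_paths_subset by blast
    moreover have "a \<in> S" using assms by auto
    ultimately show ?thesis unfolding h_def
      using L_homotopic c_homotopic const by (metis add_0 div_by_1)
  qed
  ultimately show thesis using that by blast
qed

text \<open>That the subpath between two parameters transports \<open>h\<close> correctly is an
  equivalence relation on \<open>[0,1]\<close>. The local hypothesis makes it hold near each
  parameter, and connectedness relates 0 to 1.\<close>

lemma flat_on_local:
  assumes "U \<subseteq> S"
    and loc: "\<And>w. w \<in> U \<Longrightarrow> \<exists>V. open V \<and> w \<in> V \<and> flat_on L c (U \<inter> V) h"
  shows "flat_on L c U h"
proof (rule flat_onI)
  fix g assume g: "path g" "path_image g \<subseteq> U"
  have cg: "continuous_on {0..1} g" using g by (simp add: path_def)
  define R where "R s t \<longleftrightarrow> c (subpath s t g) = L (subpath s t g) * h (g t) - h (g s)" for s t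
  have sp: "path (subpath s t g)" "path_image (subpath s t g) \<subseteq> S" "path_image (subpath s t g) \<subseteq> U"
    if "s \<in> {0..1}" "t \<in> {0..1}" for s t
    using path_subpath[OF g(1)] path_image_subpath_subset[of s t g] that g(2) assms(1)
    by auto
  have "R 0 1"
  proof (rule connected_equivalence_relation[where S="{0..1::real}" and a=0 and b=1])
    show "connected {0..1::real}" by simp
    fix x y z :: real
    show "R y x" if "R x y" "x \<in> {0..1}" "y \<in> {0..1}"
    proof -
      note r = reverse[OF sp(1,2)[OF that(2,3)], unfolded reversepath_subpath]
      have nz: "L (subpath x y g) \<noteq> 0" using L_nonzero sp that by blast
      have "L (subpath x y g) * c (subpath y x g) = - (L (subpath x y g) * h (g y) - h (g x))"
        using r(2) that(1) unfolding R_def by (metis add.commute eq_neg_iff_add_eq_0)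
      also have "\<dots> = L (subpath x y g) * (L (subpath y x g) * h (g x) - h (g y))"
        using r(1) by (simp add: right_diff_distrib flip: mult.assoc)
      finally show ?thesis unfolding R_def using nz by simp
    qed
    show "R x z" if "R x y" "R y z" "x \<in> {0..1}" "y \<in> {0..1}" "z \<in> {0..1}"
    proof -
      have "homotopic_paths S (subpath x y g +++ subpath y z g) (subpath x z g)"
        using g assms that by (intro homotopic_join_subpaths) auto
      note L_homotopic[OF this] c_homotopic[OF this]
      moreover have "L (subpath x y g +++ subpath y z g) = L (subpath x y g) * L (subpath y z g)"
        "c (subpath x y g +++ subpath y z g) = c (subpath x y g) + L (subpath x y g) * c (subpath y z g)"
        using sp[OF that(3,4)] sp[OF that(4,5)] by (simp_all add: L_join c_join)
      ultimately show ?thesis using that(1,2) unfolding R_def by (simp add: algebra_simps)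
    qed
    show "\<exists>T. openin (top_of_set {0..1}) T \<and> x \<in> T \<and> (\<forall>y\<in>T. R x y)" if x: "x \<in> {0..1}"
    proof -
      have "g x \<in> U" using g x by (auto simp: path_image_def)
      then obtain V where V: "open V" "g x \<in> V" "flat_on L c (U \<inter> V) h" using loc by blast
      obtain \<epsilon> where \<epsilon>: "\<epsilon> > 0" "\<And>y. dist y (g x) < \<epsilon> \<Longrightarrow> y \<in> V"
        using V(1,2) unfolding open_dist by blast
      obtain d where d: "d > 0" "\<And>y. y \<in> {0..1} \<Longrightarrow> dist y x < d \<Longrightarrow> g y \<in> V"
        using cg[unfolded continuous_on_iff, rule_format, OF x \<epsilon>(1)] \<epsilon>(2) by blast
      have "R x y" if "y \<in> {0..1} \<inter> ball x d" for y
      proof -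
        have y: "y \<in> {0..1}" using that by auto
        have "path_image (subpath x y g) \<subseteq> V"
        proof -
          have "closed_segment x y \<subseteq> {0..1} \<inter> ball x d"
            using that x d(1) by (intro closed_segment_subset convex_Int) auto
          then have "g u \<in> V" if "u \<in> closed_segment x y" for u
            using d(2)[of u] that by (simp add: dist_commute subset_iff)
          then show ?thesis unfolding path_image_subpath_gen by blast
        qed
        then have "path_image (subpath x y g) \<subseteq> U \<inter> V" using sp[OF x y] by blast
        from flat_onD[OF V(3) sp(1)[OF x y] this]
        show ?thesis by (simp add: R_def)
      qed
      then show ?thesis using x d(1) by (intro exI[of _ "{0..1} \<inter> ball x d"]) (auto simp: openin_open_Int)
    qed
  qed auto
  then show "c g = L g * h (pathfinish g) - h (pathstart g)"
    by (simp add: R_def pathstart_def pathfinish_def)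
qed

end

section \<open>Twisted cocycles as functions on paths\<close>

text \<open>The parameter is the barycentric coordinate of vertex 1, which makes this inverse to
  \<open>first_edge\<close> on \<open>[0,1]\<close>; \<open>restrict\<close> provides the
  extensionality that singular simplices must have.\<close>

definition path_simplex :: "(real \<Rightarrow> 'a) \<Rightarrow> (nat \<Rightarrow> real) \<Rightarrow> 'a" where
  "path_simplex g = restrict (\<lambda>v. g (v 1)) (standard_simplex 1)"

definition unit_triangle :: "(real \<times> real) set" where
  "unit_triangle = {(a,b). 0 \<le> a \<and> 0 \<le> b \<and> a + b \<le> 1}"

definition triangle_simplex :: "(real \<times> real \<Rightarrow> 'a) \<Rightarrow> (nat \<Rightarrow> real) \<Rightarrow> 'a" where
  "triangle_simplex G = restrict (\<lambda>v. G (v 1, v 2)) (standard_simplex 2)"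

lemma standard_simplex_1_iff:
  "v \<in> standard_simplex (Suc 0) \<longleftrightarrow> 0 \<le> v 0 \<and> 0 \<le> v 1 \<and> v 0 + v 1 = 1 \<and> (\<forall>i>1. v i = 0)"
proof
  assume "v \<in> standard_simplex (Suc 0)"
  then show "0 \<le> v 0 \<and> 0 \<le> v 1 \<and> v 0 + v 1 = 1 \<and> (\<forall>i>1. v i = 0)"
    by (auto simp: standard_simplex_def)
next
  assume *: "0 \<le> v 0 \<and> 0 \<le> v 1 \<and> v 0 + v 1 = 1 \<and> (\<forall>i>1. v i = 0)"
  have "0 \<le> v i \<and> v i \<le> 1" for i
  proof -
    consider "i = 0" | "i = 1" | "i > 1" by linarith
    then show ?thesis using * by cases auto
  qed
  then show "v \<in> standard_simplex (Suc 0)" using * by (auto simp: standard_simplex_def)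
qed

lemma standard_simplex_2_iff:
  "v \<in> standard_simplex 2 \<longleftrightarrow>
     0 \<le> v 0 \<and> 0 \<le> v 1 \<and> 0 \<le> v 2 \<and> v 0 + v 1 + v 2 = 1 \<and> (\<forall>i>2. v i = 0)"
proof
  assume "v \<in> standard_simplex 2"
  then show "0 \<le> v 0 \<and> 0 \<le> v 1 \<and> 0 \<le> v 2 \<and> v 0 + v 1 + v 2 = 1 \<and> (\<forall>i>2. v i = 0)"
    by (auto simp: standard_simplex_def numeral_2_eq_2)
next
  assume *: "0 \<le> v 0 \<and> 0 \<le> v 1 \<and> 0 \<le> v 2 \<and> v 0 + v 1 + v 2 = 1 \<and> (\<forall>i>2. v i = 0)"
  have "0 \<le> v i \<and> v i \<le> 1" for i
  proof -
    consider "i = 0" | "i = 1" | "i = 2" | "i > 2" by linarith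
    then show ?thesis using * by cases auto
  qed
  then show "v \<in> standard_simplex 2" using * by (auto simp: standard_simplex_def numeral_2_eq_2)
qed

lemma singular_simplex_restrict:
  fixes k :: "(nat \<Rightarrow> real) \<Rightarrow> 'b::topological_space" and g :: "'b \<Rightarrow> 'a::topological_space"
  assumes "continuous_map (powertop_real UNIV) euclidean k" "k ` standard_simplex p \<subseteq> T"
    "continuous_on T g" "g ` T \<subseteq> S"
  shows "singular_simplex p (top_of_set S) (restrict (\<lambda>v. g (k v)) (standard_simplex p))"
proof -
  let ?D = "subtopology (powertop_real UNIV) (standard_simplex p)"
  have "continuous_map ?D (top_of_set T) k"
    using assms(1,2) by (auto simp: continuous_map_in_subtopology continuous_map_from_subtopology)
  moreover have "continuous_map (top_of_set T) (top_of_set S) g"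
    using assms(3,4) by (auto simp: continuous_map_in_subtopology)
  ultimately have "continuous_map ?D (top_of_set S) (g \<circ> k)"
    by (rule continuous_map_compose)
  then have "continuous_map ?D (top_of_set S) (restrict (\<lambda>v. g (k v)) (standard_simplex p))"
    by (rule continuous_map_eq) auto
  then show ?thesis by (simp add: singular_simplex_def)
qed

lemma singular_simplex_path_simplex:
  assumes "path g" "path_image g \<subseteq> S"
  shows "singular_simplex 1 (top_of_set S) (path_simplex g)"
  unfolding path_simplex_def
  by (rule singular_simplex_restrict[where T="{0..1}"])
    (use assms in \<open>auto simp: path_def path_image_def standard_simplex_1_iff intro!: continuous_map_product_projection\<close>)

lemma singular_simplex_triangle_simplex:
  assumes "continuous_on unit_triangle G" "G ` unit_triangle \<subseteq> S"
  shows "singular_simplex 2 (top_of_set S) (triangle_simplex G)"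
  unfolding triangle_simplex_def
proof (rule singular_simplex_restrict[where T=unit_triangle])
  have "continuous_map (powertop_real UNIV) (prod_topology euclideanreal euclideanreal) (\<lambda>v::nat \<Rightarrow> real. (v 1, v 2))"
    unfolding continuous_map_paired by (auto intro!: continuous_map_product_projection)
  then show "continuous_map (powertop_real UNIV) euclidean (\<lambda>v::nat \<Rightarrow> real. (v 1, v 2))"
    by (simp only: prod_topology_euclidean)
qed (use assms in \<open>auto simp: unit_triangle_def standard_simplex_2_iff\<close>)

lemma path_simplex_cong: "(\<And>u. u \<in> {0..1} \<Longrightarrow> g u = h u) \<Longrightarrow> path_simplex g = path_simplex h"
  by (auto simp: path_simplex_def standard_simplex_1_iff fun_eq_iff)

text \<open>Face \<open>k\<close> omits vertex \<open>k\<close>, and in the coordinates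
  \<open>(v 1, v 2)\<close> the vertices 0, 1, 2 are \<open>(0, 0)\<close>, \<open>(1, 0)\<close>,
  \<open>(0, 1)\<close>.\<close>

lemma singular_face_triangle_simplex:
  "singular_face 2 0 (triangle_simplex G) = path_simplex (\<lambda>u. G (1 - u, u))"
  "singular_face 2 1 (triangle_simplex G) = path_simplex (\<lambda>u. G (0, u))"
  "singular_face 2 2 (triangle_simplex G) = path_simplex (\<lambda>u. G (u, 0))"
proof -
  have f: "simplical_face k v \<in> standard_simplex 2" if "v \<in> standard_simplex (Suc 0)" "k \<le> 2" for k and v :: "nat \<Rightarrow> real"
    using that by (intro simplical_face_in_standard_simplex) auto
  have v0: "v 0 = 1 - v 1" if "v \<in> standard_simplex (Suc 0)" for v
    using that by (auto simp: standard_simplex_1_iff)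
  show "singular_face 2 0 (triangle_simplex G) = path_simplex (\<lambda>u. G (1 - u, u))"
    "singular_face 2 1 (triangle_simplex G) = path_simplex (\<lambda>u. G (0, u))"
    "singular_face 2 2 (triangle_simplex G) = path_simplex (\<lambda>u. G (u, 0))"
    by (auto simp: singular_face_def triangle_simplex_def path_simplex_def fun_eq_iff restrict_def f v0)
      (auto simp: simplical_face_def v0)
qed

lemma first_edge_triangle_simplex:
  "u \<in> {0..1} \<Longrightarrow> first_edge (triangle_simplex G) u = G (u, 0)"
  by (auto simp: first_edge_def triangle_simplex_def standard_simplex_2_iff)

lemma first_edge_path_simplex:
  "u \<in> {0..1} \<Longrightarrow> first_edge (path_simplex g) u = g u"
  by (auto simp: first_edge_def path_simplex_def standard_simplex_1_iff)

lemma path_simplex_first_edge: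
  assumes "singular_simplex 1 (top_of_set S) \<sigma>"
  shows "path_simplex (first_edge \<sigma>) = \<sigma>"
proof
  fix v
  show "path_simplex (first_edge \<sigma>) v = \<sigma> v"
  proof (cases "v \<in> standard_simplex 1")
    case True
    then have "(\<lambda>i. if i = 0 then 1 - v 1 else if i = 1 then v 1 else 0) = v"
      by (auto simp: standard_simplex_1_iff fun_eq_iff)
    then show ?thesis using True by (simp add: path_simplex_def first_edge_def)
  next
    case False
    then show ?thesis using assms
      by (auto simp: path_simplex_def singular_simplex_def extensional_def)
  qed
qed

definition simplex_on_triangle :: "((nat \<Rightarrow> real) \<Rightarrow> 'a) \<Rightarrow> real \<times> real \<Rightarrow> 'a" where
  "simplex_on_triangle \<sigma> = (\<lambda>(a,b). \<sigma> (\<lambda>i. if i = 0 then 1 - a - b else if i = 1 then a else if i = 2 then b else 0))"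

lemma triangle_simplex_simplex_on_triangle:
  assumes "singular_simplex 2 (top_of_set S) \<sigma>"
  shows "triangle_simplex (simplex_on_triangle \<sigma>) = \<sigma>"
proof
  fix v
  show "triangle_simplex (simplex_on_triangle \<sigma>) v = \<sigma> v"
  proof (cases "v \<in> standard_simplex 2")
    case True
    then have "(\<lambda>i. if i = 0 then 1 - v 1 - v 2 else if i = 1 then v 1 else if i = 2 then v 2 else 0) = v"
      by (auto simp: standard_simplex_2_iff fun_eq_iff)
    then show ?thesis using True by (simp add: triangle_simplex_def simplex_on_triangle_def del: One_nat_def)
  next
    case False
    then show ?thesis using assms
      by (auto simp: triangle_simplex_def singular_simplex_def extensional_def)
  qed
qed

lemma continuous_on_simplex_compose:
  fixes k :: "'b::topological_space \<Rightarrow> nat \<Rightarrow> real"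
  assumes \<sigma>: "singular_simplex p (top_of_set S) \<sigma>"
    and k: "\<And>i. continuous_on T (\<lambda>x. k x i)" "\<And>x. x \<in> T \<Longrightarrow> k x \<in> standard_simplex p"
  shows "continuous_on T (\<lambda>x. \<sigma> (k x))" "\<And>x. x \<in> T \<Longrightarrow> \<sigma> (k x) \<in> S"
proof -
  let ?D = "subtopology (powertop_real UNIV) (standard_simplex p)"
  have "continuous_map (top_of_set T) ?D k"
    using k by (auto simp: continuous_map_in_subtopology continuous_map_componentwise_UNIV)
  moreover have s: "continuous_map ?D (top_of_set S) \<sigma>" using \<sigma> by (simp add: singular_simplex_def)
  ultimately have "continuous_map (top_of_set T) (top_of_set S) (\<sigma> \<circ> k)"
    by (rule continuous_map_compose)
  then show "continuous_on T (\<lambda>x. \<sigma> (k x))" "\<And>x. x \<in> T \<Longrightarrow> \<sigma> (k x) \<in> S"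
    by (auto simp: continuous_map_in_subtopology o_def)
qed

lemma simplex_on_triangle:
  assumes "singular_simplex 2 (top_of_set S) \<sigma>"
  shows "continuous_on unit_triangle (simplex_on_triangle \<sigma>)" "simplex_on_triangle \<sigma> ` unit_triangle \<subseteq> S"
proof -
  let ?k = "\<lambda>x. \<lambda>i::nat. if i = 0 then 1 - fst x - snd x else if i = 1 then fst x else if i = 2 then snd x else (0::real)"
  have 1: "continuous_on unit_triangle (\<lambda>x. ?k x i)" for i
    by (cases "i = 0"; cases "i = 1"; cases "i = 2") (auto intro!: continuous_intros)
  have 2: "?k x \<in> standard_simplex 2" if "x \<in> unit_triangle" for x
    using that by (auto simp: standard_simplex_2_iff unit_triangle_def)
  note * = continuous_on_simplex_compose[of 2 S \<sigma> unit_triangle ?k, OF assms 1 2]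
  show "continuous_on unit_triangle (simplex_on_triangle \<sigma>)" "simplex_on_triangle \<sigma> ` unit_triangle \<subseteq> S"
    using * by (auto simp: simplex_on_triangle_def case_prod_unfold)
qed

lemma first_edge_path:
  assumes "singular_simplex 1 (top_of_set S) \<sigma>"
  shows "path (first_edge \<sigma>)" "path_image (first_edge \<sigma>) \<subseteq> S"
proof -
  let ?k = "\<lambda>u::real. \<lambda>i::nat. if i = 0 then 1 - u else if i = 1 then u else 0"
  have 1: "continuous_on {0..1} (\<lambda>x. ?k x i)" for i
    by (cases "i = 0"; cases "i = 1") (auto intro!: continuous_intros)
  have 2: "?k x \<in> standard_simplex 1" if "x \<in> {0..1}" for x
    using that by (auto simp: standard_simplex_1_iff)
  note * = continuous_on_simplex_compose[of 1 S \<sigma> "{0..1}" ?k, OF assms 1 2]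
  show "path (first_edge \<sigma>)" "path_image (first_edge \<sigma>) \<subseteq> S"
    using * by (auto simp: first_edge_def path_def path_image_def)
qed

section \<open>Coboundaries and the dimension of the first cohomology\<close>

definition point_simplex :: "'a \<Rightarrow> (nat \<Rightarrow> real) \<Rightarrow> 'a" where
  "point_simplex x = restrict (\<lambda>_. x) (standard_simplex 0)"

lemma singular_simplex_point_simplex: "x \<in> S \<Longrightarrow> singular_simplex 0 (top_of_set S) (point_simplex x)"
  unfolding point_simplex_def
  by (rule singular_simplex_restrict[where T=UNIV and k="\<lambda>v. v 0" and g="\<lambda>_. x"])
    (auto intro!: continuous_map_product_projection)

lemma singular_face_1:
  assumes "singular_simplex 1 (top_of_set S) \<sigma>"
  shows "singular_face 1 0 \<sigma> = point_simplex (pathfinish (first_edge \<sigma>))"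
    "singular_face 1 1 \<sigma> = point_simplex (pathstart (first_edge \<sigma>))"
proof -
  let ?e = "\<lambda>j::nat. if j = 0 then 1 else (0::real)"
  have e: "simplical_face 0 ?e = (\<lambda>i. if i = 0 then 1 - 1 else if i = 1 then 1 else 0)"
    "simplical_face 1 ?e = (\<lambda>i. if i = 0 then 1 - 0 else if i = 1 then 0 else 0)"
    by (auto simp: simplical_face_def fun_eq_iff)
  have "singular_face 1 k \<sigma> v = (if v = ?e then \<sigma> (simplical_face k ?e) else undefined)" for k v
    by (auto simp: singular_face_def standard_simplex_0)
  moreover have "point_simplex x v = (if v = ?e then x else undefined)" for x :: 'a and v
    by (auto simp: point_simplex_def standard_simplex_0)
  ultimately have "singular_face 1 k \<sigma> = point_simplex (\<sigma> (simplical_face k ?e))" for k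
    by presburger
  then show "singular_face 1 0 \<sigma> = point_simplex (pathfinish (first_edge \<sigma>))"
    "singular_face 1 1 \<sigma> = point_simplex (pathstart (first_edge \<sigma>))"
    unfolding first_edge_def pathfinish_def pathstart_def by (simp_all only: e)
qed

text \<open>A 0-simplex is a point, so a 0-cochain is a function on \<open>S\<close>. Face 0 of a
  1-simplex is its end, whose value is transported back by \<open>L\<close>; face 1 is its
  start.\<close>

lemma twisted_coboundaries_1_iff:
  assumes "f \<in> twisted_cochains 1 S"
  shows "f \<in> twisted_coboundaries 1 S L \<longleftrightarrow>
    (\<exists>h. \<forall>\<sigma>. singular_simplex 1 (top_of_set S) \<sigma> \<longrightarrow>
      f \<sigma> = L (first_edge \<sigma>) * h (pathfinish (first_edge \<sigma>)) - h (pathstart (first_edge \<sigma>)))"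
    (is "?l \<longleftrightarrow> (\<exists>h. ?r h)")
proof
  assume ?l
  then obtain k where "k \<in> twisted_cochains 0 S" "f = twisted_coboundary 0 S L k"
    by (auto simp: twisted_coboundaries_def)
  moreover have "twisted_coboundary 0 S L k \<sigma> = L (first_edge \<sigma>) * k (point_simplex (pathfinish (first_edge \<sigma>)))
      - k (point_simplex (pathstart (first_edge \<sigma>)))" if "singular_simplex 1 (top_of_set S) \<sigma>" for \<sigma>
    unfolding twisted_coboundary_def using that by (simp flip: singular_face_1[OF that])
  ultimately have "?r (\<lambda>x. k (point_simplex x))" by simp
  then show "\<exists>h. ?r h" by (rule exI[of ?r "\<lambda>x. k (point_simplex x)"])
next
  assume "\<exists>h. ?r h"
  then obtain h where h: "?r h" ..
  \<comment> \<open>The argument of \<open>\<tau>\<close> is the only point of the standard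
    0-simplex; the value 0 elsewhere makes \<open>k\<close> a cochain.\<close>
  define k where "k \<tau> = (if singular_simplex 0 (top_of_set S) \<tau> then h (\<tau> (\<lambda>j. if j = 0 then 1 else 0)) else 0)" for \<tau>
  have kp: "k (point_simplex x) = h x" if "x \<in> S" for x
    using singular_simplex_point_simplex[OF that] by (simp add: k_def point_simplex_def)
  have "f = twisted_coboundary 0 S L k"
  proof
    fix \<sigma>
    show "f \<sigma> = twisted_coboundary 0 S L k \<sigma>"
    proof (cases "singular_simplex 1 (top_of_set S) \<sigma>")
      case True
      have "pathstart (first_edge \<sigma>) \<in> S" "pathfinish (first_edge \<sigma>) \<in> S"
        using first_edge_path[OF True] by auto
      with True h show ?thesis
        unfolding twisted_coboundary_def by (simp add: singular_face_1[OF True, simplified] kp)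
    next
      case False
      then show ?thesis using assms by (simp add: twisted_coboundary_def twisted_cochains_def)
    qed
  qed
  moreover have "k \<in> twisted_cochains 0 S" by (simp add: twisted_cochains_def k_def)
  ultimately show ?l by (simp add: twisted_coboundaries_def)
qed

text \<open>An independent family of positive length begins with a cocycle that is no coboundary.
  Conversely such a cocycle is an independent family of length 1, because coboundaries can be
  divided by a nonzero scalar.\<close>

lemma cohomology_dim_pos_iff:
  "enat 1 \<le> twisted_cohomology_dim 1 S L \<longleftrightarrow> (\<exists>f \<in> twisted_cocycles 1 S L. f \<notin> twisted_coboundaries 1 S L)"
proof
  let ?A = "{enat d | d. \<exists>f :: nat \<Rightarrow> ((nat \<Rightarrow> real) \<Rightarrow> 'a) \<Rightarrow> complex. (\<forall>i<d. f i \<in> twisted_cocycles 1 S L) \<and>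
            (\<forall>c :: nat \<Rightarrow> complex. (\<lambda>s. \<Sum>i<d. c i * f i s) \<in> twisted_coboundaries 1 S L \<longrightarrow> (\<forall>i<d. c i = 0))}"
  have dim: "twisted_cohomology_dim 1 S L = Sup ?A"
    by (simp add: twisted_cohomology_dim_def quotient_dim_def)
  {
    assume "enat 1 \<le> twisted_cohomology_dim 1 S L"
    then have "\<exists>x\<in>?A. 0 < x"
      unfolding dim less_Sup_iff[symmetric] one_enat_def[symmetric]
      by (rule order_less_le_trans[rotated]) simp
    then obtain d and f :: "nat \<Rightarrow> ((nat \<Rightarrow> real) \<Rightarrow> 'a) \<Rightarrow> complex" where d: "0 < d" and f: "\<forall>i<d. f i \<in> twisted_cocycles 1 S L"
      and ind: "\<forall>c. (\<lambda>s. \<Sum>i<d. c i * f i s) \<in> twisted_coboundaries 1 S L \<longrightarrow> (\<forall>i<d. c i = (0::complex))"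
      by (auto simp: zero_enat_def)
    have "(\<lambda>s. \<Sum>i<d. (if i = 0 then 1 else 0) * f i s) = f 0"
    proof
      fix s
      have "(\<Sum>i<d. (if i = 0 then 1 else 0) * f i s) = (\<Sum>i<d. if i = 0 then f i s else 0)"
        by (rule sum.cong) auto
      then show "(\<Sum>i<d. (if i = 0 then 1 else 0) * f i s) = f 0 s" using d by simp
    qed
    then have "f 0 \<notin> twisted_coboundaries 1 S L"
      using ind[rule_format, of "\<lambda>i. if i = 0 then 1 else 0" 0] d by auto
    then show "\<exists>f \<in> twisted_cocycles 1 S L. f \<notin> twisted_coboundaries 1 S L" using f d by blast
  }
  {
    assume "\<exists>f \<in> twisted_cocycles 1 S L. f \<notin> twisted_coboundaries 1 S L"
    then obtain f where f: "f \<in> twisted_cocycles 1 S L" "f \<notin> twisted_coboundaries 1 S L" ..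
    have fc: "f \<in> twisted_cochains 1 S" using f by (simp add: twisted_cocycles_def)
    have c0: "c 0 = 0" if c: "(\<lambda>s. c 0 * f s) \<in> twisted_coboundaries 1 S L" for c :: "nat \<Rightarrow> complex"
    proof (rule ccontr)
      assume nz: "c 0 \<noteq> 0"
      have "(\<lambda>s. c 0 * f s) \<in> twisted_cochains 1 S" using fc by (simp add: twisted_cochains_def)
      from c obtain h where h: "\<And>\<sigma>. singular_simplex 1 (top_of_set S) \<sigma> \<Longrightarrow>
        c 0 * f \<sigma> = L (first_edge \<sigma>) * h (pathfinish (first_edge \<sigma>)) - h (pathstart (first_edge \<sigma>))"
        unfolding twisted_coboundaries_1_iff[OF \<open>(\<lambda>s. c 0 * f s) \<in> twisted_cochains 1 S\<close>] by blast
      have "f \<sigma> = L (first_edge \<sigma>) * (h (pathfinish (first_edge \<sigma>)) / c 0) - h (pathstart (first_edge \<sigma>)) / c 0"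
        if "singular_simplex 1 (top_of_set S) \<sigma>" for \<sigma>
        using h[OF that] nz by (simp add: field_simps)
      then have "f \<in> twisted_coboundaries 1 S L"
        unfolding twisted_coboundaries_1_iff[OF fc] by (intro exI[of _ "\<lambda>x. h x / c 0"]) auto
      with f show False by blast
    qed
    have "(\<forall>i<1::nat. f \<in> twisted_cocycles 1 S L) \<and> (\<forall>c :: nat \<Rightarrow> complex.
          (\<lambda>s. \<Sum>i<1. c i * f s) \<in> twisted_coboundaries 1 S L \<longrightarrow> (\<forall>i<1. c i = 0))"
      using f(1) c0 by simp
    then have "enat 1 \<in> ?A"
      by (intro CollectI exI[of _ 1] conjI[OF refl] exI[of _ "\<lambda>_. f"])
    then show "enat 1 \<le> twisted_cohomology_dim 1 S L"
      unfolding dim by (rule Sup_upper)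
  }
qed

lemma sum_1_2: "(\<Sum>k = 1..2. (-1)^k * (x k :: complex)) = x 2 - x 1"
proof -
  have "{1..2} = {1, 2::nat}" by auto
  then show ?thesis by simp
qed

text \<open>The cocycle condition on the boundary of a triangle whose sides are only given on \<open>[0,1]\<close>.\<close>

definition triangle_cocycle ::
  "'a::topological_space set \<Rightarrow> ((real \<Rightarrow> 'a) \<Rightarrow> complex) \<Rightarrow> ((real \<Rightarrow> 'a) \<Rightarrow> complex) \<Rightarrow> bool" where
  "triangle_cocycle S L c \<longleftrightarrow> (\<forall>G p q r. continuous_on unit_triangle G \<and> G ` unit_triangle \<subseteq> S \<and>
     (\<forall>u\<in>{0..1}. p u = G (u, 0)) \<and> (\<forall>u\<in>{0..1}. q u = G (1 - u, u)) \<and> (\<forall>u\<in>{0..1}. r u = G (0, u))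
     \<longrightarrow> c p + L p * c q = c r)"

lemma triangle_cocycleD:
  "triangle_cocycle S L c \<Longrightarrow> continuous_on unit_triangle G \<Longrightarrow> G ` unit_triangle \<subseteq> S \<Longrightarrow>
   (\<And>u. u \<in> {0..1} \<Longrightarrow> p u = G (u, 0)) \<Longrightarrow> (\<And>u. u \<in> {0..1} \<Longrightarrow> q u = G (1 - u, u)) \<Longrightarrow>
   (\<And>u. u \<in> {0..1} \<Longrightarrow> r u = G (0, u)) \<Longrightarrow> c p + L p * c q = c r"
  unfolding triangle_cocycle_def by blast

lemma rank_one_cong:
  assumes "rank_one_local_system S L" "path p" "path_image p \<subseteq> S" "\<And>u. u \<in> {0..1} \<Longrightarrow> p u = q u"
  shows "L p = L q"
proof -
  have "homotopic_paths S p q" using assms(2-) by (intro homotopic_paths_eq) auto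
  then show ?thesis using assms(1) by (simp add: rank_one_local_system_def)
qed

lemma triangle_edges:
  assumes "continuous_on unit_triangle G" "G ` unit_triangle \<subseteq> S"
  shows "path (\<lambda>u. G (u, 0))" "path_image (\<lambda>u. G (u, 0)) \<subseteq> S"
    "path (\<lambda>u. G (1 - u, u))" "path_image (\<lambda>u. G (1 - u, u)) \<subseteq> S"
    "path (\<lambda>u. G (0, u))" "path_image (\<lambda>u. G (0, u)) \<subseteq> S"
proof -
  show "path (\<lambda>u. G (u, 0))" "path (\<lambda>u. G (1 - u, u))" "path (\<lambda>u. G (0, u))"
    unfolding path_def
    by (rule continuous_on_compose2[OF assms(1)]; force simp: unit_triangle_def intro!: continuous_intros)+
  show "path_image (\<lambda>u. G (u, 0)) \<subseteq> S" "path_image (\<lambda>u. G (1 - u, u)) \<subseteq> S" "path_image (\<lambda>u. G (0, u)) \<subseteq> S"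
    using assms(2) by (auto simp: path_image_def unit_triangle_def)
qed

lemma twisted_coboundary_triangle:
  assumes "rank_one_local_system S L" "continuous_on unit_triangle G" "G ` unit_triangle \<subseteq> S"
  shows "twisted_coboundary 1 S L f (triangle_simplex G) =
    L (\<lambda>u. G (u, 0)) * f (path_simplex (\<lambda>u. G (1 - u, u)))
     + f (path_simplex (\<lambda>u. G (u, 0))) - f (path_simplex (\<lambda>u. G (0, u)))"
proof -
  have "L (\<lambda>u. G (u, 0)) = L (first_edge (triangle_simplex G))"
    using assms(1) triangle_edges(1,2)[OF assms(2,3)]
    by (rule rank_one_cong) (simp add: first_edge_triangle_simplex)
  then show ?thesis
    using singular_simplex_triangle_simplex[OF assms(2,3)]
    by (simp add: twisted_coboundary_def sum_1_2 singular_face_triangle_simplex numeral_2_eq_2[symmetric] del: One_nat_def)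
qed

lemma triangle_cocycle_of_twisted_cocycle:
  assumes L: "rank_one_local_system S L" and f: "f \<in> twisted_cocycles 1 S L"
  shows "triangle_cocycle S L (\<lambda>g. f (path_simplex g))"
  unfolding triangle_cocycle_def
proof clarify
  fix G and p q r :: "real \<Rightarrow> 'a" assume G: "continuous_on unit_triangle G" "G ` unit_triangle \<subseteq> S"
    and e: "\<forall>u\<in>{0..1}. p u = G (u, 0)" "\<forall>u\<in>{0..1}. q u = G (1 - u, u)" "\<forall>u\<in>{0..1}. r u = G (0, u)"
  have "path_simplex p = path_simplex (\<lambda>u. G (u, 0))" "path_simplex q = path_simplex (\<lambda>u. G (1 - u, u))"
    "path_simplex r = path_simplex (\<lambda>u. G (0, u))"
    using e by (auto intro!: path_simplex_cong)
  moreover have "L p = L (\<lambda>u. G (u, 0))"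
    using rank_one_cong[OF L triangle_edges(1,2)[OF G], of p] e by auto
  moreover have "twisted_coboundary 1 S L f (triangle_simplex G) = 0"
    using f by (simp add: twisted_cocycles_def)
  ultimately show "f (path_simplex p) + L p * f (path_simplex q) = f (path_simplex r)"
    unfolding twisted_coboundary_triangle[OF L G] by (simp add: algebra_simps)
qed

text \<open>A homotopy is a square, cut by its diagonal into two triangles in each of which one side
  is constant and contributes nothing. A join is the long side of a degenerate triangle.\<close>

lemma affine_transport_of_triangle_cocycle:
  fixes S :: "'a::real_normed_vector set"
  assumes L: "rank_one_local_system S L" and c: "triangle_cocycle S L c"
  shows "affine_transport S L c"
proof
  note cD = triangle_cocycleD[OF c]
  have LD: "path g \<Longrightarrow> path_image g \<subseteq> S \<Longrightarrow> L g \<noteq> 0" "homotopic_paths S g h \<Longrightarrow> L g = L h"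
      "path g \<Longrightarrow> path_image g \<subseteq> S \<Longrightarrow> path h \<Longrightarrow> path_image h \<subseteq> S \<Longrightarrow>
      pathfinish g = pathstart h \<Longrightarrow> L (g +++ h) = L g * L h" for g h
    using L by (auto simp: rank_one_local_system_def)
  show "path g \<Longrightarrow> path_image g \<subseteq> S \<Longrightarrow> L g \<noteq> 0" "homotopic_paths S g h \<Longrightarrow> L g = L h"
      "path g \<Longrightarrow> path_image g \<subseteq> S \<Longrightarrow> path h \<Longrightarrow> path_image h \<subseteq> S \<Longrightarrow>
      pathfinish g = pathstart h \<Longrightarrow> L (g +++ h) = L g * L h" for g h
    using LD by auto
  have const: "c p = 0" "L p = 1" if "x \<in> S" "\<And>u. u \<in> {0..1} \<Longrightarrow> p u = x" for p x
  proof -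
    have "c p + L p * c p = c p"
      by (rule cD[where G="\<lambda>_. x"]) (use that in auto)
    moreover have "L p = L (linepath x x)"
      by (rule sym, rule rank_one_cong[OF L]) (use that in auto)
    moreover have "L (linepath x x +++ linepath x x) = L (linepath x x) * L (linepath x x)"
      by (rule LD(3)) (use that in auto)
    moreover have "L (linepath x x +++ linepath x x) = L (linepath x x)"
      by (rule LD(2), rule homotopic_paths_rid') (use that in auto)
    moreover have "L (linepath x x) \<noteq> 0" by (rule LD(1)) (use that in auto)
    ultimately show "c p = 0" "L p = 1" by auto
  qed
  show "c g = c h" if hom: "homotopic_paths S g h" for g h
  proof -
    obtain k :: "real \<times> real \<Rightarrow> 'a" where k0: "continuous_on ({0..1} \<times> {0..1}) k" "k \<in> {0..1} \<times> {0..1} \<rightarrow> S"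
      "\<And>x. x \<in> {0..1} \<Longrightarrow> k (0,x) = g x" "\<And>x. x \<in> {0..1} \<Longrightarrow> k (1,x) = h x"
      "\<And>t. t \<in> {0..1} \<Longrightarrow> k (t, 0) = g 0" "\<And>t. t \<in> {0..1} \<Longrightarrow> k (t, 1) = g 1"
      using hom unfolding homotopic_paths
      unfolding pathstart_def pathfinish_def o_def by blast
    have k: "continuous_on ({0..1} \<times> {0..1}) k" "k ` ({0..1} \<times> {0..1}) \<subseteq> S"
      "\<And>x. x \<in> {0..1} \<Longrightarrow> k (0,x) = g x" "\<And>x. x \<in> {0..1} \<Longrightarrow> k (1,x) = h x"
      "\<And>t. t \<in> {0..1} \<Longrightarrow> k (t, 0) = g 0" "\<And>t. t \<in> {0..1} \<Longrightarrow> k (t, 1) = g 1"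
      using k0 by (auto simp: image_subset_iff_funcset)
    have tri: "(b, a + b) \<in> {0..1} \<times> {0..1}" "(a + b, b) \<in> {0..1} \<times> {0..1}" if "(a,b) \<in> unit_triangle" for a b
      using that by (auto simp: unit_triangle_def)
    have "path g" "path_image g \<subseteq> S"
      using homotopic_paths_imp_path[OF hom] homotopic_paths_imp_subset[OF hom] by auto
    then have gS: "g 0 \<in> S" "g 1 \<in> S"
      by (auto simp: path_image_def)
    \<comment> \<open>The triangle \<open>(a, b) \<mapsto> (b, a + b)\<close> of the square has the
      sides \<open>g\<close>, the constant end point, and the diagonal.\<close>
    have "c g + L g * c (\<lambda>_. g 1) = c (\<lambda>u. k (u,u))"
    proof (rule cD[where G="k \<circ> (\<lambda>(a,b). (b, a + b))"])
      show "continuous_on unit_triangle (k \<circ> (\<lambda>(a, b). (b, a + b)))"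
        by (rule continuous_on_compose, force simp: case_prod_unfold intro!: continuous_intros,
            rule continuous_on_subset[OF k(1)]) (use tri in \<open>auto simp: unit_triangle_def\<close>)
      show "(k \<circ> (\<lambda>(a, b). (b, a + b))) ` unit_triangle \<subseteq> S"
        using tri(1) k(2) by fastforce
    qed (use k in auto)
    \<comment> \<open>The complementary triangle has the sides constant start point,
      \<open>h\<close>, and the same diagonal.\<close>
    moreover have "c (\<lambda>_. g 0) + L (\<lambda>_. g 0) * c h = c (\<lambda>u. k (u,u))"
    proof (rule cD[where G="k \<circ> (\<lambda>(a,b). (a + b, b))"])
      show "continuous_on unit_triangle (k \<circ> (\<lambda>(a, b). (a + b, b)))"
        by (rule continuous_on_compose, force simp: case_prod_unfold intro!: continuous_intros,
            rule continuous_on_subset[OF k(1)]) (use tri in \<open>auto simp: unit_triangle_def\<close>)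
      show "(k \<circ> (\<lambda>(a, b). (a + b, b))) ` unit_triangle \<subseteq> S"
        using tri(2) k(2) by fastforce
    qed (use k in auto)
    ultimately show ?thesis using const[of "g 0" "\<lambda>_. g 0"] const[of "g 1" "\<lambda>_. g 1"] gS by simp
  qed
  show "c (g +++ h) = c g + L g * c h"
    if *: "path g" "path_image g \<subseteq> S" "path h" "path_image h \<subseteq> S" "pathfinish g = pathstart h" for g h
  \<comment> \<open>The map \<open>a / 2 + b\<close> sends the vertices 0, 1, 2 to the parameters
    \<open>0\<close>, \<open>1/2\<close>, \<open>1\<close>, so the sides become \<open>g\<close>,
    \<open>h\<close> and \<open>g +++ h\<close>.\<close>
  proof (rule sym, rule cD[where G="(g +++ h) \<circ> (\<lambda>(a,b). a / 2 + b)"])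
    have p: "path (g +++ h)" "path_image (g +++ h) \<subseteq> S" using * by (auto simp: subset_path_image_join)
    have tri: "a / 2 + b \<in> {0..1}" if "(a,b) \<in> unit_triangle" for a b
      using that by (auto simp: unit_triangle_def)
    show "continuous_on unit_triangle ((g +++ h) \<circ> (\<lambda>(a,b). a / 2 + b))"
      by (rule continuous_on_compose, force simp: case_prod_unfold intro!: continuous_intros,
          rule continuous_on_subset[OF p(1)[unfolded path_def]]) (use tri in \<open>auto simp: unit_triangle_def\<close>)
    show "((g +++ h) \<circ> (\<lambda>(a, b). a / 2 + b)) ` unit_triangle \<subseteq> S"
      using p(2) tri by (fastforce simp: path_image_def)
    show "h u = ((g +++ h) \<circ> (\<lambda>(a, b). a / 2 + b)) (1 - u, u)" if "u \<in> {0..1}" for u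
    proof (cases "u = 0")
      case True
      then show ?thesis using *(5) by (simp add: joinpaths_def pathstart_def pathfinish_def)
    next
      case False
      have e: "(1 - u) / 2 + u = (1 + u) / 2" by (simp add: field_simps)
      show ?thesis using False that by (simp add: joinpaths_def e add_divide_distrib)
    qed
  qed (auto simp: joinpaths_def)
qed

text \<open>Every 1-simplex is the path simplex of its first edge, so a flat section for the induced
  function on paths would exhibit the cocycle as a coboundary.\<close>

lemma nonflat_transport_of_cohomology:
  fixes S :: "'a::real_normed_vector set"
  assumes L: "rank_one_local_system S L" and dim: "enat 1 \<le> twisted_cohomology_dim 1 S L"
  obtains c where "affine_transport S L c" "\<nexists>h. flat_on L c S h"
proof -
  obtain f where f: "f \<in> twisted_cocycles 1 S L" "f \<notin> twisted_coboundaries 1 S L"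
    using dim cohomology_dim_pos_iff by blast
  have fc: "f \<in> twisted_cochains 1 S" using f by (simp add: twisted_cocycles_def)
  let ?c = "\<lambda>g. f (path_simplex g)"
  have "\<nexists>h. flat_on L ?c S h"
  proof
    assume "\<exists>h. flat_on L ?c S h"
    then obtain h where h: "flat_on L ?c S h" ..
    have "f \<sigma> = L (first_edge \<sigma>) * h (pathfinish (first_edge \<sigma>)) - h (pathstart (first_edge \<sigma>))"
      if "singular_simplex 1 (top_of_set S) \<sigma>" for \<sigma>
      using flat_onD[OF h first_edge_path[OF that]] path_simplex_first_edge[OF that] by simp
    then show False using f twisted_coboundaries_1_iff[OF fc] by blast
  qed
  then show thesis
    using that affine_transport_of_triangle_cocycle[OF L triangle_cocycle_of_twisted_cocycle[OF L f(1)]] by blast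
qed

lemma cohomology_of_nonflat_triangle_cocycle:
  fixes S :: "'a::real_normed_vector set"
  assumes L: "rank_one_local_system S L" and c: "triangle_cocycle S L c" and nf: "\<nexists>h. flat_on L c S h"
  shows "enat 1 \<le> twisted_cohomology_dim 1 S L"
proof -
  interpret affine_transport S L c
    using L c by (rule affine_transport_of_triangle_cocycle)
  define f where "f \<sigma> = (if singular_simplex 1 (top_of_set S) \<sigma> then c (first_edge \<sigma>) else 0)" for \<sigma>
  have fp: "f (path_simplex g) = c g" if "path g" "path_image g \<subseteq> S" for g
  proof -
    \<comment> \<open>Passing to the simplex forgets \<open>g\<close> outside \<open>[0,1]\<close>;
      homotopy invariance of \<open>c\<close> bridges the difference.\<close>
    have "homotopic_paths S g (first_edge (path_simplex g))"
      using that by (intro homotopic_paths_eq) (auto simp: first_edge_path_simplex)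
    then show ?thesis
      using singular_simplex_path_simplex[OF that] c_homotopic by (simp add: f_def)
  qed
  have fc: "f \<in> twisted_cochains 1 S" by (simp add: twisted_cochains_def f_def)
  have "twisted_coboundary 1 S L f \<sigma> = 0" for \<sigma>
  proof (cases "singular_simplex 2 (top_of_set S) \<sigma>")
    case True
    note G = simplex_on_triangle[OF True]
    note e = triangle_edges[OF G]
    have "c (\<lambda>u. simplex_on_triangle \<sigma> (u, 0)) + L (\<lambda>u. simplex_on_triangle \<sigma> (u, 0)) * c (\<lambda>u. simplex_on_triangle \<sigma> (1 - u, u))
        = c (\<lambda>u. simplex_on_triangle \<sigma> (0, u))"
      by (rule triangle_cocycleD[OF c G]) auto
    then show ?thesis
      using twisted_coboundary_triangle[OF L G, of f] fp[OF e(1,2)] fp[OF e(3,4)] fp[OF e(5,6)]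
      by (simp add: triangle_simplex_simplex_on_triangle[OF True] algebra_simps)
  next
    case False
    then show ?thesis by (simp add: twisted_coboundary_def numeral_2_eq_2)
  qed
  then have "f \<in> twisted_cocycles 1 S L" using fc by (auto simp: twisted_cocycles_def)
  moreover have "f \<notin> twisted_coboundaries 1 S L"
  proof
    assume "f \<in> twisted_coboundaries 1 S L"
    then obtain h where h: "\<And>\<sigma>. singular_simplex 1 (top_of_set S) \<sigma> \<Longrightarrow>
      f \<sigma> = L (first_edge \<sigma>) * h (pathfinish (first_edge \<sigma>)) - h (pathstart (first_edge \<sigma>))"
      unfolding twisted_coboundaries_1_iff[OF fc] by blast
    have "flat_on L c S h"
    proof (rule flat_onI)
      fix g :: "real \<Rightarrow> 'a" assume g: "path g" "path_image g \<subseteq> S"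
      have "L g = L (first_edge (path_simplex g))"
        by (rule rank_one_cong[OF L g]) (simp add: first_edge_path_simplex)
      then show "c g = L g * h (pathfinish g) - h (pathstart g)"
        using h[OF singular_simplex_path_simplex[OF g]] fp[OF g]
        by (simp add: pathfinish_def pathstart_def first_edge_path_simplex)
    qed
    with nf show False by blast
  qed
  ultimately show ?thesis using cohomology_dim_pos_iff by blast
qed

section \<open>Winding local systems\<close>

definition rot :: "real \<Rightarrow> complex" where
  "rot s = exp (2 * of_real pi * \<i> * of_real s)"

lemma circlepath_eq_rot: "circlepath z r s = z + of_real r * rot s"
  by (simp add: circlepath rot_def)

lemma rot_simps [simp]: "norm (rot s) = 1" "rot 0 = 1" "rot 1 = 1" "rot s \<noteq> 0"
  by (simp_all add: rot_def)

lemma continuous_on_rot [continuous_intros]: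
  "continuous_on A f \<Longrightarrow> continuous_on A (\<lambda>x. rot (f x))"
  unfolding rot_def by (intro continuous_intros)

lemma Im_rot: "Im (rot s) = sin (2 * pi * s)"
  by (simp add: rot_def Im_exp)

text \<open>For paths that are not closed the winding number is not an integer; this is then the
  change of any continuous logarithm along \<open>p\<close>, see
  \<open>log_change_eq\<close>.\<close>

definition log_change :: "(real \<Rightarrow> complex) \<Rightarrow> complex" where
  "log_change p = 2 * of_real pi * \<i> * winding_number p 0"

text \<open>Distinct values of \<open>f\<close> differ by nonzero multiples of
  \<open>2 * pi * \<i>\<close>, so its range is discrete.\<close>

lemma constant_on_of_exp:
  fixes f :: "'a::topological_space \<Rightarrow> complex"
  assumes "connected S" "continuous_on S f" "\<And>x. x \<in> S \<Longrightarrow> exp (f x) = k" "a \<in> S" "b \<in> S"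
  shows "f a = f b"
proof -
  have "f constant_on S"
  proof (rule continuous_discrete_range_constant[OF assms(1,2)])
    fix x assume x: "x \<in> S"
    have "2 * pi \<le> norm (f y - f x)" if y: "y \<in> S" "f y \<noteq> f x" for y
    proof -
      have "exp (f y) = exp (f x)" using assms(3) x y by simp
      then obtain n :: int where n: "f y = f x + of_int (2 * n) * of_real pi * \<i>"
        unfolding exp_eq by auto
      with y have "n \<noteq> 0" by auto
      then have "2 * pi * 1 \<le> 2 * pi * \<bar>of_int n\<bar>"
        by (intro mult_left_mono) auto
      also have "\<dots> = norm (f y - f x)" using n by (simp add: norm_mult)
      finally show ?thesis by simp
    qed
    then show "\<exists>e>0. \<forall>y. y \<in> S \<and> f y \<noteq> f x \<longrightarrow> e \<le> norm (f y - f x)"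
      by (intro exI[of _ "2 * pi"]) auto
  qed
  then show ?thesis using assms(4,5) by (auto simp: constant_on_def)
qed

lemma log_change_eq:
  assumes "path q" "\<And>t. t \<in> {0..1} \<Longrightarrow> p t = exp (q t)"
  shows "log_change p = q 1 - q 0"
proof -
  have "path (exp \<circ> q)" using assms(1) by (intro path_continuous_image continuous_intros)
  then have "path p" unfolding path_def by (rule continuous_on_eq) (use assms(2) in auto)
  moreover have "0 \<notin> path_image p" using assms(2) by (auto simp: path_image_def)
  ultimately obtain r where r: "path r" "pathfinish r - pathstart r = 2 * of_real pi * \<i> * winding_number p 0"
    "\<And>t. t \<in> {0..1} \<Longrightarrow> p t = 0 + exp (r t)"
    using winding_number_as_continuous_log by blast
  have "q 0 - r 0 = q 1 - r 1"
    by (rule constant_on_of_exp[where S="{0..1}" and f="\<lambda>t. q t - r t" and k=1])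
      (use assms r in \<open>auto simp: exp_diff path_def intro!: continuous_intros\<close>)
  then show ?thesis using r(2) unfolding log_change_def pathfinish_def pathstart_def
    by (simp add: algebra_simps)
qed

lemma log_change_circle:
  assumes "A = 0 \<and> B \<noteq> 0"
  shows "log_change (\<lambda>s. A + B * rot s) = 2 * of_real pi * \<i>"
proof -
  have "log_change (\<lambda>s. A + B * rot s) = (\<lambda>s. Ln B + 2 * of_real pi * \<i> * of_real s) 1
      - (\<lambda>s. Ln B + 2 * of_real pi * \<i> * of_real s) 0"
    by (rule log_change_eq)
      (use assms in \<open>auto simp: path_def exp_add rot_def intro!: continuous_intros\<close>)
  then show ?thesis by simp
qed

text \<open>After division by \<open>A\<close> the circle lies in the open unit disc about 1, where
  \<open>Ln\<close> is continuous.\<close>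

lemma log_change_circle_outside:
  assumes "norm B < norm A"
  shows "log_change (\<lambda>s. A + B * rot s) = 0"
proof -
  have A: "A \<noteq> 0" using assms by auto
  have n: "norm (B / A * rot s) < 1" for s
    using assms A by (simp add: norm_mult norm_divide)
  have nz: "1 + B / A * rot s \<notin> \<real>\<^sub>\<le>\<^sub>0" for s
  proof
    assume *: "1 + B / A * rot s \<in> \<real>\<^sub>\<le>\<^sub>0"
    have "1 \<le> \<bar>Re (B / A * rot s)\<bar>" using * by (auto simp: complex_nonpos_Reals_iff)
    also have "\<dots> \<le> norm (B / A * rot s)" by (rule abs_Re_le_cmod)
    finally show False using n[of s] by simp
  qed
  have nz': "1 + B / A * rot s \<noteq> 0" for s using nz[of s] by auto
  have "log_change (\<lambda>s. A + B * rot s) = (\<lambda>s. Ln A + Ln (1 + B / A * rot s)) 1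
      - (\<lambda>s. Ln A + Ln (1 + B / A * rot s)) 0"
  proof (rule log_change_eq)
    show "path (\<lambda>s. Ln A + Ln (1 + B / A * rot s))"
      unfolding path_def using nz by (intro continuous_intros) auto
    show "A + B * rot t = exp (Ln A + Ln (1 + B / A * rot t))" for t
      using A nz'[of t] by (simp add: exp_add field_simps)
  qed
  then show ?thesis by simp
qed

text \<open>The local system with monodromy \<open>exp (2 * pi * \<i> * a i)\<close> around the zeros of \<open>F i\<close>.\<close>

definition winding_system ::
  "('n::finite \<Rightarrow> 'a \<Rightarrow> complex) \<Rightarrow> ('n \<Rightarrow> complex) \<Rightarrow> (real \<Rightarrow> 'a) \<Rightarrow> complex" where
  "winding_system F a g = exp (\<Sum>i\<in>UNIV. a i * log_change (F i \<circ> g))"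

lemma winding_system:
  fixes S :: "'a::topological_space set"
  assumes cont: "\<And>i. continuous_on S (F i)" and nz: "\<And>i w. w \<in> S \<Longrightarrow> F i w \<noteq> 0"
  shows "rank_one_local_system S (winding_system F a)"
proof -
  have im: "path (F i \<circ> g) \<and> 0 \<notin> path_image (F i \<circ> g)" if "path g" "path_image g \<subseteq> S" for i g
    using path_continuous_image[OF that(1) continuous_on_subset[OF cont that(2)]] nz that(2)
    by (force simp: path_image_compose)
  have "winding_system F a g = winding_system F a h" if hom: "homotopic_paths S g h" for g h
  proof -
    have "homotopic_paths (- {0}) (F i \<circ> g) (F i \<circ> h)" for i
      using hom cont by (rule homotopic_paths_continuous_image) (use nz in auto)
    from winding_number_homotopic_paths[OF this] show ?thesis
      by (simp add: winding_system_def log_change_def)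
  qed
  moreover have "winding_system F a (g +++ h) = winding_system F a g * winding_system F a h"
    if *: "path g \<and> path_image g \<subseteq> S \<and> path h \<and> path_image h \<subseteq> S \<and> pathfinish g = pathstart h" for g h
  proof -
    have "log_change (F i \<circ> (g +++ h)) = log_change (F i \<circ> g) + log_change (F i \<circ> h)" for i
      unfolding path_compose_join log_change_def using * im[of g i] im[of h i]
      by (subst winding_number_join) (auto simp: pathfinish_compose pathstart_compose algebra_simps)
    then show ?thesis
      by (simp add: winding_system_def algebra_simps sum.distrib flip: exp_add)
  qed
  ultimately show ?thesis by (auto simp: rank_one_local_system_def winding_system_def)
qed

lemma winding_system_prod:
  assumes "\<And>i. i \<in> I \<Longrightarrow> log_change (F i \<circ> g) = 2 * of_real pi * \<i>"
    and "\<And>i. i \<notin> I \<Longrightarrow> log_change (F i \<circ> g) = 0"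
  shows "winding_system F a g = (\<Prod>i\<in>I. exp (2 * of_real pi * \<i> * a i))"
proof -
  have "(\<Sum>i\<in>UNIV. a i * log_change (F i \<circ> g)) = (\<Sum>i\<in>I. a i * log_change (F i \<circ> g))"
    by (rule sum.mono_neutral_right) (use assms in auto)
  also have "\<dots> = (\<Sum>i\<in>I. 2 * of_real pi * \<i> * a i)"
    using assms(1) by (intro sum.cong) (auto simp: mult_ac)
  finally show ?thesis by (simp add: winding_system_def exp_sum finite_subset[OF subset_UNIV])
qed

lemma affine_transport_zero:
  fixes S :: "'a::real_normed_vector set"
  assumes "rank_one_local_system S L"
  shows "affine_transport S L (\<lambda>_. 0)"
  using assms by unfold_locales (auto simp: rank_one_local_system_def)

lemma (in affine_transport) rank_one: "rank_one_local_system S L"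
  using L_nonzero L_homotopic L_join unfolding rank_one_local_system_def by blast

lemma path_connectedE:
  assumes "path_connected S" "x \<in> S" "y \<in> S"
  obtains g where "path g" "path_image g \<subseteq> S" "pathstart g = x" "pathfinish g = y"
  using assms unfolding path_connected_def by blast

text \<open>
  A local system on the complex line minus finitely many real points that is trivial around each of them
  is trivial: the flat sections over the closed upper and lower half planes match, because their quotient along
  the real line does not jump at the punctures.
\<close>

lemma trivial_monodromy_punctured_line:
  fixes T :: "real set"
  defines "S \<equiv> - (of_real ` T) :: complex set"
  assumes L: "rank_one_local_system S L" and fin: "finite T"
    and small: "\<And>q. q \<in> T \<Longrightarrow> \<exists>e>0. \<forall>r. 0 < r \<and> r < e \<longrightarrow> L (\<lambda>s. of_real q + of_real r * rot s) = 1"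
    and g: "path g" "path_image g \<subseteq> S" "pathfinish g = pathstart g"
  shows "L g = 1"
proof -
  interpret affine_transport S L "\<lambda>_. 0" using L by (rule affine_transport_zero)
  have notin: "z \<in> S" if "Im z \<noteq> 0" for z using that by (auto simp: S_def)
  have realS: "complex_of_real a \<in> S \<longleftrightarrow> a \<notin> T" for a by (auto simp: S_def)
  define Hp where "Hp = {z. Im z \<ge> 0} \<inter> S"
  define Hm where "Hm = {z. Im z \<le> 0} \<inter> S"
  \<comment> \<open>A segment from \<open>\<i>\<close> to a point of the closed half plane is in the
    open half plane before its end, so the removed real points do not obstruct it.\<close>
  have "starlike Hp"
    unfolding starlike_def
  proof (intro bexI ballI subsetI)
    show "\<i> \<in> Hp" using notin by (simp add: Hp_def)
    fix x z assume x: "x \<in> Hp" and "z \<in> closed_segment \<i> x"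
    then obtain u where u: "0 \<le> u" "u \<le> 1" "z = (1 - u) *\<^sub>R \<i> + u *\<^sub>R x" by (auto simp: closed_segment_def)
    have Im: "Im z = (1 - u) + u * Im x" using u by simp
    show "z \<in> Hp"
    proof (cases "u = 1")
      case True then show ?thesis using u x by simp
    next
      case False
      then have "Im z > 0" using Im u x by (simp add: Hp_def add_pos_nonneg)
      then show ?thesis using notin by (simp add: Hp_def)
    qed
  qed
  have "starlike Hm"
    unfolding starlike_def
  proof (intro bexI ballI subsetI)
    show "- \<i> \<in> Hm" using notin by (simp add: Hm_def)
    fix x z assume x: "x \<in> Hm" and "z \<in> closed_segment (- \<i>) x"
    then obtain u where u: "0 \<le> u" "u \<le> 1" "z = (1 - u) *\<^sub>R (- \<i>) + u *\<^sub>R x" by (auto simp: closed_segment_def)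
    have Im: "Im z = - (1 - u) + u * Im x" using u by simp
    show "z \<in> Hm"
    proof (cases "u = 1")
      case True then show ?thesis using u x by simp
    next
      case False
      have "u * Im x \<le> 0" using u x by (simp add: Hm_def mult_nonneg_nonpos)
      then have "Im z < 0" using Im u False by linarith
      then show ?thesis using notin by (simp add: Hm_def)
    qed
  qed
  have sub: "Hp \<subseteq> S" "Hm \<subseteq> S" by (auto simp: Hp_def Hm_def)
  have i: "\<i> \<in> Hp" "- \<i> \<in> Hm" using notin by (auto simp: Hp_def Hm_def)
  obtain sp where sp: "flat_on L (\<lambda>_. 0) Hp sp" "sp \<i> = 1"
    using flat_on_simply_connected[OF starlike_imp_simply_connected[OF \<open>starlike Hp\<close>] sub(1) i(1)] by metis
  obtain sm where sm: "flat_on L (\<lambda>_. 0) Hm sm" "sm (- \<i>) = 1"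
    using flat_on_simply_connected[OF starlike_imp_simply_connected[OF \<open>starlike Hm\<close>] sub(2) i(2)] by metis
  have spD: "L g * sp (pathfinish g) = sp (pathstart g)" if "path g" "path_image g \<subseteq> Hp" for g
    using flat_onD[OF sp(1) that] by simp
  have smD: "L g * sm (pathfinish g) = sm (pathstart g)" if "path g" "path_image g \<subseteq> Hm" for g
    using flat_onD[OF sm(1) that] by simp
  have sp0: "sp x \<noteq> 0" if x: "x \<in> Hp" for x
  proof -
    obtain g where "path g" "path_image g \<subseteq> Hp" "pathstart g = \<i>" "pathfinish g = x"
      by (rule path_connectedE[OF starlike_imp_path_connected[OF \<open>starlike Hp\<close>] i(1) x])
    then show ?thesis using spD[of g] sp(2) by auto
  qed
  have sm0: "sm x \<noteq> 0" if x: "x \<in> Hm" for x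
  proof -
    obtain g where "path g" "path_image g \<subseteq> Hm" "pathstart g = - \<i>" "pathfinish g = x"
      by (rule path_connectedE[OF starlike_imp_path_connected[OF \<open>starlike Hm\<close>] i(2) x])
    then show ?thesis using smD[of g] sm(2) by auto
  qed
  \<comment> \<open>The sections \<open>sp\<close> and \<open>sm\<close> glue if this ratio is
    constant on the real line off \<open>T\<close>: then \<open>sm\<close> only has to be
    rescaled.\<close>
  define \<kappa> where "\<kappa> a = sp (of_real a) / sm (of_real a)" for a
  have seg: "\<kappa> x = \<kappa> y" if "closed_segment x y \<inter> T = {}" for x y :: real
  proof -
    have "closed_segment (of_real x) (of_real y :: complex) = of_real ` closed_segment x y"
      by (simp add: closed_segment_of_real)
    then have *: "path_image (linepath (of_real x) (of_real y)) \<subseteq> Hp \<inter> Hm"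
      using that by (auto simp: Hp_def Hm_def realS)
    define l where "l = L (linepath (of_real x) (of_real y))"
    have "l * sp (of_real y) = sp (of_real x)" "l * sm (of_real y) = sm (of_real x)"
      using spD[of "linepath (of_real x) (of_real y)"] smD[of "linepath (of_real x) (of_real y)"] * by (auto simp: l_def)
    moreover have "l \<noteq> 0" unfolding l_def by (rule L_nonzero) (use * sub in auto)
    ultimately show ?thesis unfolding \<kappa>_def by (metis mult_divide_mult_cancel_left)
  qed
  \<comment> \<open>The small circle runs from \<open>q + r\<close> through the upper half plane to
    \<open>q - r\<close> and back below. Its upper half transports \<open>sp\<close>, its lower half
    \<open>sm\<close>, and the two factors multiply to 1.\<close>
  have jump: "\<exists>e>0. \<forall>r. 0 < r \<and> r < e \<longrightarrow> \<kappa> (q - r) = \<kappa> (q + r)" if q: "q \<in> T" for q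
  proof -
    obtain e where e: "e > 0" "\<And>r. 0 < r \<Longrightarrow> r < e \<Longrightarrow> L (\<lambda>s. of_real q + of_real r * rot s) = 1"
      using small[OF q] by blast
    obtain d where d: "d > 0" "\<And>x. x \<in> T \<Longrightarrow> x \<noteq> q \<Longrightarrow> d \<le> dist q x"
      using finite_set_avoid[OF fin, of q] by blast
    have "\<kappa> (q - r) = \<kappa> (q + r)" if r: "0 < r" "r < min e d" for r
    proof -
      define C where "C = (\<lambda>s. of_real q + of_real r * rot s)"
      have pC: "path C" unfolding C_def path_def by (intro continuous_intros)
      have CS: "C s \<in> S" for s
      proof (rule ccontr)
        assume "C s \<notin> S"
        then obtain x where x: "x \<in> T" "of_real q + of_real r * rot s = of_real x" by (auto simp: S_def C_def)
        then have "complex_of_real (x - q) = of_real r * rot s" by (metis add_diff_cancel_left' of_real_diff)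
        then have "norm (complex_of_real (x - q)) = norm (of_real r * rot s)" by simp
        then have "\<bar>x - q\<bar> = r" using r by (simp add: norm_mult del: of_real_diff)
        then show False using d(2)[OF x(1)] r by (auto simp: dist_real_def)
      qed
      then have CS': "path_image C \<subseteq> S" by (auto simp: path_image_def)
      have Im: "Im (C s) = r * sin (2 * pi * s)" for s by (simp add: C_def Im_rot)
      have pos: "0 \<le> sin (2 * pi * s)" if "0 \<le> s" "s \<le> 1/2" for s
      proof (rule sin_ge_zero)
        show "0 \<le> 2 * pi * s" using that by simp
        have "2 * pi * s \<le> 2 * pi * (1/2)" using that by (intro mult_left_mono) auto
        then show "2 * pi * s \<le> pi" by simp
      qed
      have neg: "sin (2 * pi * s) \<le> 0" if "1/2 \<le> s" "s \<le> 1" for s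
      proof -
        have "sin (2 * pi * s) = - sin (2 * pi * (1 - s))" by (simp add: right_diff_distrib sin_diff)
        then show ?thesis using pos[of "1 - s"] that by simp
      qed
      have up: "path_image (subpath 0 (1/2) C) \<subseteq> Hp"
      proof
        fix z assume "z \<in> path_image (subpath 0 (1/2) C)"
        then obtain s where s: "z = C s" "0 \<le> s" "s \<le> 1/2" by (auto simp: path_image_subpath)
        then have "0 \<le> Im z" unfolding s(1) Im using r pos[of s] by (intro mult_nonneg_nonneg) auto
        then show "z \<in> Hp" using CS s by (simp add: Hp_def)
      qed
      have down: "path_image (subpath (1/2) 1 C) \<subseteq> Hm"
      proof
        fix z assume "z \<in> path_image (subpath (1/2) 1 C)"
        then obtain s where s: "z = C s" "1/2 \<le> s" "s \<le> 1" by (auto simp: path_image_subpath)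
        then have "Im z \<le> 0" unfolding s(1) Im using r neg[of s] by (intro mult_nonneg_nonpos) auto
        then show "z \<in> Hm" using CS s by (simp add: Hm_def)
      qed
      have rh: "rot (1/2) = -1" by (simp add: rot_def exp_pi_i' mult.commute)
      have ps: "path (subpath 0 (1/2) C)" "path (subpath (1/2) 1 C)" using pC by (auto intro!: path_subpath)
      have "homotopic_paths S (subpath 0 (1/2) C +++ subpath (1/2) 1 C) (subpath 0 1 C)"
        by (rule homotopic_join_subpaths) (use pC CS' in auto)
      then have "L (subpath 0 (1/2) C +++ subpath (1/2) 1 C) = L C"
        using L_homotopic by (metis subpath_trivial)
      moreover have "L (subpath 0 (1/2) C +++ subpath (1/2) 1 C) = L (subpath 0 (1/2) C) * L (subpath (1/2) 1 C)"
        using ps up down sub by (intro L_join) auto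
      moreover have "L C = 1" unfolding C_def using r e(2) by simp
      ultimately have one: "L (subpath 0 (1/2) C) * L (subpath (1/2) 1 C) = 1" by simp
      have 1: "L (subpath 0 (1/2) C) * sp (of_real (q - r)) = sp (of_real (q + r))"
        using spD[OF ps(1) up] by (simp add: C_def rh)
      have 2: "L (subpath (1/2) 1 C) * sm (of_real (q + r)) = sm (of_real (q - r))"
        using smD[OF ps(2) down] by (simp add: C_def rh)
      have m: "of_real (q + r) \<in> Hm" "of_real (q - r) \<in> Hm"
        using CS[of 0] CS[of "1/2"] by (auto simp: Hm_def C_def rh)
      have "sp (of_real (q + r)) * sm (of_real (q - r))
          = L (subpath 0 (1/2) C) * L (subpath (1/2) 1 C) * (sp (of_real (q - r)) * sm (of_real (q + r)))"
        unfolding 1[symmetric] 2[symmetric] by (simp add: mult_ac)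
      then show ?thesis unfolding \<kappa>_def one using sm0[OF m(1)] sm0[OF m(2)] by (simp add: frac_eq_eq)
    qed
    then show ?thesis using e d by (intro exI[of _ "min e d"]) auto
  qed
  have "infinite (UNIV :: real set)" by (rule infinite_UNIV_char_0)
  then obtain a0 where a0: "a0 \<notin> T" using fin by (metis UNIV_I finite_subset subsetI)
  have \<kappa>const: "\<kappa> b = \<kappa> a0" if "b \<notin> T" for b
  \<comment> \<open>The induction runs over the whole connected line while the claim is made only
    off \<open>T\<close>, so that it can pass over the punctures.\<close>
  proof (rule connected_induction[where S="UNIV::real set" and P="\<lambda>a. a \<notin> T" and Q="\<lambda>a. \<kappa> a = \<kappa> a0" and a=a0])
    show "\<exists>z. z \<in> V \<and> z \<notin> T" if "openin (top_of_set UNIV) V" "a \<in> V" for V a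
    proof (rule ccontr)
      assume "\<not> ?thesis"
      then have "V \<subseteq> T" by auto
      then have "finite V" using fin finite_subset by blast
      then show False using that by (metis finite_imp_not_open empty_iff open_openin subtopology_UNIV)
    qed
    show "\<exists>V. openin (top_of_set UNIV) V \<and> a \<in> V \<and>
         (\<forall>x\<in>V. \<forall>y\<in>V. x \<notin> T \<and> y \<notin> T \<and> \<kappa> x = \<kappa> a0 \<longrightarrow> \<kappa> y = \<kappa> a0)" for a
    proof -
      obtain d where d: "d > 0" "\<And>x. x \<in> T \<Longrightarrow> x \<noteq> a \<Longrightarrow> d \<le> dist a x"
        using finite_set_avoid[OF fin, of a] by blast
      have side: "\<kappa> x = \<kappa> y" if xy: "x \<in> ball a d" "y \<in> ball a d" "x \<le> y" "a \<notin> T \<or> y < a \<or> a < x" for x y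
      proof (rule seg, rule ccontr)
        assume "closed_segment x y \<inter> T \<noteq> {}"
        then obtain u where u: "u \<in> T" "x \<le> u" "u \<le> y" using xy(3) by (auto simp: closed_segment_eq_real_ivl)
        have "u \<noteq> a" using u xy(4) by auto
        from d(2)[OF u(1) this] show False using u xy(1,2) by (auto simp: dist_real_def)
      qed
      have across: "\<kappa> x = \<kappa> y" if xy: "x \<in> ball a d" "y \<in> ball a d" "x \<notin> T" "y \<notin> T" "x \<le> y" for x y
      proof (cases "a \<notin> T \<or> y < a \<or> a < x")
        case True then show ?thesis using side xy by blast
      next
        case False
        then have "a \<in> T" "x \<le> a" "a \<le> y" "x \<noteq> a" "y \<noteq> a" using xy by auto
        then have a: "a \<in> T" "x < a" "a < y" by auto
        obtain e where e: "e > 0" "\<And>r. 0 < r \<Longrightarrow> r < e \<Longrightarrow> \<kappa> (a - r) = \<kappa> (a + r)" using jump[OF a(1)] by blast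
        define r where "r = min (e/2) (min (a - x) (y - a))"
        have r: "0 < r" "r < e" "r \<le> a - x" "r \<le> y - a" using e a by (auto simp: r_def)
        have "\<kappa> x = \<kappa> (a - r)" using r a xy by (intro side) (auto simp: dist_real_def)
        also have "\<dots> = \<kappa> (a + r)" using e r by auto
        also have "\<dots> = \<kappa> y" using r a xy by (intro side) (auto simp: dist_real_def)
        finally show ?thesis .
      qed
      show ?thesis
      proof (intro exI[of _ "ball a d"] conjI ballI impI)
        fix x y assume "x \<in> ball a d" "y \<in> ball a d" "x \<notin> T \<and> y \<notin> T \<and> \<kappa> x = \<kappa> a0"
        then show "\<kappa> y = \<kappa> a0" using across[of x y] across[of y x] by (metis linear)
      qed (use d in auto)
    qed
  qed (use that a0 in auto)
  define s where "s x = (if Im x \<ge> 0 then sp x else \<kappa> a0 * sm x)" for x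
  have "of_real a0 \<in> Hp" "of_real a0 \<in> Hm" using a0 by (auto simp: Hp_def Hm_def realS)
  then have \<kappa>0: "\<kappa> a0 \<noteq> 0" using sp0 sm0 by (simp add: \<kappa>_def)
  have smk: "flat_on L (\<lambda>_. 0) Hm (\<lambda>x. \<kappa> a0 * sm x)"
    using sm(1) by (simp add: flat_on_def algebra_simps)
  have "open S" unfolding S_def using fin by (intro open_Compl finite_imp_closed) auto
  have "flat_on L (\<lambda>_. 0) S s"
  proof (rule flat_on_local)
    fix w assume w: "w \<in> S"
    consider "Im w > 0" | "Im w < 0" | "Im w = 0" by linarith
    then show "\<exists>V. open V \<and> w \<in> V \<and> flat_on L (\<lambda>_. 0) (S \<inter> V) s"
    proof cases
      case 1
      have "flat_on L (\<lambda>_. 0) (S \<inter> {z. Im z > 0}) s"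
        by (rule flat_on_cong[OF flat_on_mono[OF sp(1)]]) (auto simp: Hp_def s_def)
      then show ?thesis using 1 by (intro exI[of _ "{z. Im z > 0}"]) (auto simp: open_halfspace_Im_gt)
    next
      case 2
      have "flat_on L (\<lambda>_. 0) (S \<inter> {z. Im z < 0}) s"
        by (rule flat_on_cong[OF flat_on_mono[OF smk]]) (auto simp: Hm_def s_def)
      then show ?thesis using 2 by (intro exI[of _ "{z. Im z < 0}"]) (auto simp: open_halfspace_Im_lt)
    next
      case 3
      obtain r where r: "r > 0" "ball w r \<subseteq> S" using \<open>open S\<close> w open_contains_ball by blast
      obtain s' where s': "flat_on L (\<lambda>_. 0) (ball w r) s'" "s' w = sp w"
        using flat_on_simply_connected[of "ball w r" w "sp w"] r by (auto simp: convex_imp_simply_connected)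
      have wr: "w = of_real (Re w)" using 3 by (simp add: complex_eq_iff)
      with w have "Re w \<notin> T" using realS by metis
      then have "\<kappa> (Re w) = \<kappa> a0" by (rule \<kappa>const)
      moreover have "sm w \<noteq> 0" using w 3 by (intro sm0) (auto simp: Hm_def)
      ultimately have sw: "\<kappa> a0 * sm w = sp w" unfolding \<kappa>_def using wr by (metis nonzero_eq_divide_eq)
      have bH: "ball w r \<inter> {z. Im z \<ge> 0} \<subseteq> Hp" "ball w r \<inter> {z. Im z \<le> 0} \<subseteq> Hm"
        using r unfolding Hp_def Hm_def by blast+
      have e1: "s' x = sp x" if "x \<in> ball w r" "Im x \<ge> 0" for x
      proof (rule flat_on_unique[where U="ball w r \<inter> {z. Im z \<ge> 0}" and a=w and h=s' and k=sp and b=x])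
        show "path_connected (ball w r \<inter> {z. 0 \<le> Im z})"
          by (intro convex_imp_path_connected convex_Int convex_halfspace_Im_ge) auto
      qed (use that r 3 s' bH in \<open>auto intro: flat_on_mono[OF s'(1)] flat_on_mono[OF sp(1)]\<close>)
      have e2: "s' x = \<kappa> a0 * sm x" if "x \<in> ball w r" "Im x \<le> 0" for x
      proof (rule flat_on_unique[where U="ball w r \<inter> {z. Im z \<le> 0}" and a=w and h=s' and k="\<lambda>x. \<kappa> a0 * sm x" and b=x])
        show "path_connected (ball w r \<inter> {z. Im z \<le> 0})"
          by (intro convex_imp_path_connected convex_Int convex_halfspace_Im_le) auto
      qed (use that r 3 s' sw bH in \<open>auto intro: flat_on_mono[OF s'(1)] flat_on_mono[OF smk]\<close>)
      have "flat_on L (\<lambda>_. 0) (S \<inter> ball w r) s"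
        by (rule flat_on_cong[OF flat_on_mono[OF s'(1)]]) (use e1 e2 in \<open>auto simp: s_def\<close>)
      then show ?thesis using r by (intro exI[of _ "ball w r"]) auto
    qed
  qed auto
  from flat_loop[OF this g] have "(L g - 1) * s (pathstart g) = 0" by simp
  moreover have "pathstart g \<in> S" using g by auto
  then have "s (pathstart g) \<noteq> 0"
    using sp0[of "pathstart g"] sm0[of "pathstart g"] \<kappa>0 by (auto simp: s_def Hp_def Hm_def)
  ultimately show ?thesis by simp
qed

section \<open>Coordinates on the arrangement complement\<close>

lemma exhaust_8:
  fixes i :: 8
  shows "i = 1 \<or> i = 2 \<or> i = 3 \<or> i = 4 \<or> i = 5 \<or> i = 6 \<or> i = 7 \<or> i = 8"
proof (induct i)
  case (of_int z)
  then have "z = 0 \<or> z = 1 \<or> z = 2 \<or> z = 3 \<or> z = 4 \<or> z = 5 \<or> z = 6 \<or> z = 7" by auto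
  then show ?case by auto
qed

lemma forall_8: "(\<forall>i::8. P i) \<longleftrightarrow> P 1 \<and> P 2 \<and> P 3 \<and> P 4 \<and> P 5 \<and> P 6 \<and> P 7 \<and> P 8"
  by (metis exhaust_8)

lemma UNIV_8: "UNIV = {1, 2, 3, 4, 5, 6, 7, 8 :: 8}"
  using exhaust_8 by auto

type_synonym c3 = "complex \<times> complex \<times> complex"

text \<open>
  Linear coordinates \<open>a\<close>, \<open>m\<close>, \<open>e\<close> in which the arrangement consists of the root hyperplanes of type B3
  other than \<open>a = 0\<close>.
\<close>

fun root_vector :: "c3 \<Rightarrow> complex^8" where
  "root_vector (a, m, e) = vector [a + e, a - m, a + m, a - e, 2 * m, m - e, 2 * e, m + e]"

definition root_form :: "8 \<Rightarrow> c3 \<Rightarrow> complex" where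
  "root_form i w = root_vector w $ i"

lemma root_form_simps [simp]:
  "root_form 1 (a, m, e) = a + e" "root_form 2 (a, m, e) = a - m"
  "root_form 3 (a, m, e) = a + m" "root_form 4 (a, m, e) = a - e"
  "root_form 5 (a, m, e) = 2 * m" "root_form 6 (a, m, e) = m - e"
  "root_form 7 (a, m, e) = 2 * e" "root_form 8 (a, m, e) = m + e"
  by (simp_all add: root_form_def)

definition root_complement :: "c3 set" where
  "root_complement = {w. \<forall>i. root_form i w \<noteq> 0}"

lemma root_complement_iff:
  "(a, m, e) \<in> root_complement \<longleftrightarrow>
    a + e \<noteq> 0 \<and> a - m \<noteq> 0 \<and> a + m \<noteq> 0 \<and> a - e \<noteq> 0 \<and> m \<noteq> 0 \<and> m - e \<noteq> 0 \<and> e \<noteq> 0 \<and> m + e \<noteq> 0"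
  by (simp add: root_complement_def forall_8)

fun csmul :: "complex \<Rightarrow> c3 \<Rightarrow> c3" where
  "csmul z (a, m, e) = (z * a, z * m, z * e)"

lemma root_form_linear: "root_form i (p + csmul z v) = root_form i p + z * root_form i v"
proof -
  obtain a m e a' m' e' where "p = (a, m, e)" "v = (a', m', e')" by (metis prod_cases3)
  moreover have "\<forall>i. root_form i ((a, m, e) + csmul z (a', m', e')) = root_form i (a, m, e) + z * root_form i (a', m', e')"
    unfolding forall_8 by (simp add: algebra_simps)
  ultimately show ?thesis by blast
qed

lemma continuous_on_root_form: "continuous_on S (root_form i)"
proof -
  have "\<forall>i. continuous_on S (\<lambda>(a, m, e). root_form i (a, m, e))"
    unfolding forall_8 root_form_simps case_prod_unfold by (intro conjI continuous_intros)
  moreover have "(\<lambda>(a, m, e). root_form i (a, m, e)) = root_form i" by auto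
  ultimately show ?thesis by metis
qed

lemma csmul_conv: "csmul z w = (z * fst w, z * fst (snd w), z * snd (snd w))"
  by (cases w) auto

lemma continuous_on_csmul [continuous_intros]:
  "continuous_on S f \<Longrightarrow> continuous_on S g \<Longrightarrow> continuous_on S (\<lambda>x. csmul (f x) (g x))"
  unfolding csmul_conv by (intro continuous_intros)

section \<open>Meridians, and loops in complex lines, in the root coordinates\<close>

definition meridional :: "(8 \<Rightarrow> complex) \<Rightarrow> ((real \<Rightarrow> c3) \<Rightarrow> complex) \<Rightarrow> bool" where
  "meridional t L \<longleftrightarrow> (\<forall>i p v. root_form i p = 0 \<and> (\<forall>j. j \<noteq> i \<longrightarrow> root_form j p \<noteq> 0) \<and>
     (\<forall>z. z \<noteq> 0 \<and> norm z \<le> 1 \<longrightarrow> p + csmul z v \<in> root_complement) \<longrightarrow>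
     L (\<lambda>s. p + csmul (rot s) v) = t i)"

lemma meridionalD:
  assumes "meridional t L" "root_form i p = 0" "\<And>j. j \<noteq> i \<Longrightarrow> root_form j p \<noteq> 0"
    "\<And>z. z \<noteq> 0 \<Longrightarrow> norm z \<le> 1 \<Longrightarrow> p + csmul z v \<in> root_complement"
  shows "L (\<lambda>s. p + csmul (rot s) v) = t i"
  using assms unfolding meridional_def by blast

lemma winding_system_root_form: "rank_one_local_system root_complement (winding_system root_form \<alpha>)"
  by (rule winding_system) (auto simp: continuous_on_root_form root_complement_def)

lemma log_change_root_form_circle:
  "root_form i p = 0 \<and> root_form i v \<noteq> 0 \<Longrightarrow> log_change (root_form i \<circ> (\<lambda>s. p + csmul (rot s) v)) = 2 * of_real pi * \<i>"
  "norm (root_form i v) < norm (root_form i p) \<Longrightarrow> log_change (root_form i \<circ> (\<lambda>s. p + csmul (rot s) v)) = 0"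
  using log_change_circle[of "root_form i p" "root_form i v"]
    log_change_circle_outside[of "root_form i v" "root_form i p"]
  by (simp_all add: o_def root_form_linear mult.commute)

text \<open>Along a meridian of plane \<open>i\<close> the form \<open>i\<close> winds once. Every
  other form has no zero in the disc bounded by the meridian and does not wind.\<close>

lemma meridional_winding_system:
  assumes "\<And>i. exp (2 * of_real pi * \<i> * \<alpha> i) = t i"
  shows "meridional t (winding_system root_form \<alpha>)"
  unfolding meridional_def
proof (intro allI impI)
  fix i p v
  assume *: "root_form i p = 0 \<and> (\<forall>j. j \<noteq> i \<longrightarrow> root_form j p \<noteq> 0) \<and>
     (\<forall>z. z \<noteq> 0 \<and> norm z \<le> 1 \<longrightarrow> p + csmul z v \<in> root_complement)"
  then have nz: "root_form j p + z * root_form j v \<noteq> 0" if "z \<noteq> 0" "norm z \<le> 1" for z j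
    using that by (simp add: root_complement_def root_form_linear)
  have "norm (root_form j v) < norm (root_form j p)" if "j \<noteq> i" for j
  proof (rule ccontr)
    \<comment> \<open>The zero of form \<open>j\<close> on the complex line of the disc; if the
      inequality failed, it would lie in the disc.\<close>
    let ?z = "- root_form j p / root_form j v"
    assume le: "\<not> ?thesis"
    have p: "root_form j p \<noteq> 0" using * that by blast
    then have v: "root_form j v \<noteq> 0" using le by auto
    have "norm ?z \<le> 1" using le v by (simp add: norm_divide)
    then show False using nz[of ?z j] p v by simp
  qed
  moreover have "root_form i v \<noteq> 0" using nz[of 1 i] * by auto
  ultimately have "winding_system root_form \<alpha> (\<lambda>s. p + csmul (rot s) v) = (\<Prod>i\<in>{i}. exp (2 * of_real pi * \<i> * \<alpha> i))"
    by (intro winding_system_prod log_change_root_form_circle) (use * in auto)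
  then show "winding_system root_form \<alpha> (\<lambda>s. p + csmul (rot s) v) = t i" using assms by simp
qed

text \<open>Restricted to the complex line through \<open>p\<close> in direction \<open>v\<close>,
  the local system lives on a line with real punctures. By \<open>ex1\<close> each puncture lies on
  exactly one plane, so small circles around it are meridians, and
  \<open>trivial_monodromy_punctured_line\<close> applies.\<close>

lemma trivial_on_real_line:
  fixes p v :: c3 and T :: "real set"
  assumes L: "rank_one_local_system root_complement L" and mer: "meridional (\<lambda>_. 1) L"
    and fin: "finite T" and T: "\<And>z. p + csmul z v \<in> root_complement \<longleftrightarrow> z \<notin> of_real ` T"
    and ex1: "\<And>q. q \<in> T \<Longrightarrow> \<exists>i. \<forall>j. root_form j (p + csmul (of_real q) v) = 0 \<longleftrightarrow> j = i"
    and g: "0 < r" "r \<notin> T" "- r \<notin> T"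
  shows "L (\<lambda>s. p + csmul (of_real r * rot s) v) = 1"
proof -
  define i where "i z = p + csmul z v" for z
  interpret affine_transport root_complement L "\<lambda>_. 0" using L by (rule affine_transport_zero)
  let ?L = "\<lambda>g. L (i \<circ> g)"
  have "affine_transport (- (of_real ` T)) (\<lambda>g. L (i \<circ> g)) (\<lambda>g. 0)"
    by (rule pullback) (auto simp: i_def T intro!: continuous_intros)
  then have 1: "rank_one_local_system (- (of_real ` T)) ?L" by (rule affine_transport.rank_one)
  have "L (i \<circ> (\<lambda>s. of_real r * rot s)) = 1"
  proof (rule trivial_monodromy_punctured_line[OF 1 fin])
    fix q assume q: "q \<in> T"
    obtain d where d: "d > 0" "\<And>x. x \<in> T \<Longrightarrow> x \<noteq> q \<Longrightarrow> d \<le> dist q x"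
      using finite_set_avoid[OF fin, of q] by blast
    obtain k where k: "\<And>j. root_form j (i (of_real q)) = 0 \<longleftrightarrow> j = k" using ex1[OF q] unfolding i_def by blast
    have "?L (\<lambda>s. of_real q + of_real r * rot s) = 1" if r: "0 < r" "r < d" for r
    proof -
      have e: "i (of_real q + of_real r * z) = i (of_real q) + csmul z (csmul (of_real r) v)" for z
        by (cases p; cases v) (simp add: i_def algebra_simps)
      have "L (\<lambda>s. i (of_real q) + csmul (rot s) (csmul (of_real r) v)) = 1"
      proof (rule meridionalD[OF mer, of k])
        fix z :: complex assume z: "z \<noteq> 0" "norm z \<le> 1"
        have "of_real q + of_real r * z \<noteq> of_real x" if "x \<in> T" for x
        proof
          assume *: "of_real q + of_real r * z = of_real x"
          then have "complex_of_real (x - q) = of_real r * z" by (metis add_diff_cancel_left' of_real_diff)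
          then have "norm (complex_of_real (x - q)) = r * norm z" using r by (simp add: norm_mult)
          then have "\<bar>x - q\<bar> = r * norm z" by (metis norm_of_real)
          moreover have "r * norm z < d" using r z(2) by (smt (verit) mult_left_le)
          ultimately have "x = q" using d(2)[OF that] by (cases "x = q") (auto simp: dist_real_def abs_minus_commute)
          then show False using * z r by simp
        qed
        then show "i (of_real q) + csmul z (csmul (of_real r) v) \<in> root_complement"
          unfolding e[symmetric] unfolding i_def T by auto
      qed (use k in auto)
      then show ?thesis by (simp add: o_def e)
    qed
    then show "\<exists>e>0. \<forall>r. 0 < r \<and> r < e \<longrightarrow> ?L (\<lambda>s. of_real q + of_real r * rot s) = 1"
      using d by blast
  next
    show "path (\<lambda>s. complex_of_real r * rot s)" unfolding path_def by (intro continuous_intros)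
    show "path_image (\<lambda>s. complex_of_real r * rot s) \<subseteq> - of_real ` T"
    proof (clarsimp simp: path_image_def)
      fix s x assume *: "x \<in> T" "complex_of_real r * rot s = complex_of_real x"
      then have "norm (complex_of_real r * rot s) = \<bar>x\<bar>" by simp
      then have "r = \<bar>x\<bar>" using g by (simp add: norm_mult)
      then have "x = r \<or> x = - r" by auto
      then show False using * g by auto
    qed
  qed (auto simp: pathstart_def pathfinish_def)
  then show ?thesis by (simp add: o_def i_def)
qed

section \<open>Loops in a real fibre\<close>

lemma rank_one_local_system_divide:
  assumes "rank_one_local_system S L" "rank_one_local_system S K"
  shows "rank_one_local_system S (\<lambda>g. L g / K g)"
  unfolding rank_one_local_system_def
proof (intro conjI allI impI)
  fix \<gamma> \<delta> :: "real \<Rightarrow> 'a"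
  show "path \<gamma> \<and> path_image \<gamma> \<subseteq> S \<Longrightarrow> L \<gamma> / K \<gamma> \<noteq> 0"
    using assms by (simp add: rank_one_local_system_def)
  show "L \<gamma> / K \<gamma> = L \<delta> / K \<delta>" if "homotopic_paths S \<gamma> \<delta>"
    using assms that unfolding rank_one_local_system_def by metis
  show "L (\<gamma> +++ \<delta>) / K (\<gamma> +++ \<delta>) = L \<gamma> / K \<gamma> * (L \<delta> / K \<delta>)"
    if "path \<gamma> \<and> path_image \<gamma> \<subseteq> S \<and> path \<delta> \<and> path_image \<delta> \<subseteq> S \<and> pathfinish \<gamma> = pathstart \<delta>"
    using assms that by (simp add: rank_one_local_system_def)
qed

lemma norm_neq_imp_nonzero:
  fixes x y :: complex
  shows "norm x \<noteq> norm y \<Longrightarrow> x + y \<noteq> 0" "norm x \<noteq> norm y \<Longrightarrow> x - y \<noteq> 0"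
  by (auto simp: add_eq_0_iff2 dest: arg_cong[of _ _ norm])

text \<open>Each loop is the diagonal of a torus, hence the product of the two sides. The sides are
  again such diagonals, or meridians, or circles in complex lines with real punctures. The loops
  turn around the origin, around the point \<open>(0, 3, 0)\<close> on planes 1, 4, 7, and around
  the point \<open>(-2, 2, 2)\<close> on planes 1, 3, 6.\<close>

lemma trivial_big_loops:
  assumes L: "rank_one_local_system root_complement L" and mer: "meridional (\<lambda>_. 1) L"
  shows "L (\<lambda>s. (5 * rot s, 3 * rot s, rot s)) = 1"
    and "L (\<lambda>s. (2 * rot s, 3, rot s)) = 1"
    and "L (\<lambda>s. (-2, 2 + rot s, 2 - rot s)) = 1"
proof -
  interpret affine_transport root_complement L "\<lambda>_. 0" using L by (rule affine_transport_zero)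
  note line = trivial_on_real_line[OF L mer]
  have a_line: "L (\<lambda>s. (of_real r * rot s, 3, 1)) = 1" if r: "r = 2 \<or> r = 5" for r
  proof -
    have "L (\<lambda>s. (0,3,1) + csmul (of_real r * rot s) (1,0,0)) = 1"
    proof (rule line[of "{-1, 3, -3, 1}"])
      show "((0,3,1) + csmul z (1,0,0) \<in> root_complement) = (z \<notin> of_real ` {-1, 3, -3, 1})" for z
        by (simp add: root_complement_iff add_eq_0_iff2)
      show "\<exists>i. \<forall>j. (root_form j ((0,3,1) + csmul (of_real q) (1,0,0)) = 0) = (j = i)" if "q \<in> {-1, 3, -3, 1}" for q
        using that unfolding forall_8 by (elim insertE emptyE)
          (rule exI[of _ 1] exI[of _ 2] exI[of _ 3] exI[of _ 4], simp; fail)+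
    qed (use r in auto)
    then show ?thesis by simp
  qed
  have m_line: "L (\<lambda>s. (5, 3 * rot s, 1)) = 1"
  proof -
    have "L (\<lambda>s. (5,0,1) + csmul (of_real 3 * rot s) (0,1,0)) = 1"
    proof (rule line[of "{5, -5, 0, 1, -1}"])
      show "((5,0,1) + csmul z (0,1,0) \<in> root_complement) = (z \<notin> of_real ` {5, -5, 0, 1, -1})" for z
        by (auto simp: root_complement_iff eq_neg_iff_add_eq_0 add.commute)
      show "\<exists>i. \<forall>j. (root_form j ((5,0,1) + csmul (of_real q) (0,1,0)) = 0) = (j = i)" if "q \<in> {5, -5, 0, 1, -1}" for q
        using that unfolding forall_8 by (elim insertE emptyE)
          (rule exI[of _ 2] exI[of _ 3] exI[of _ 5] exI[of _ 6] exI[of _ 8], simp; fail)+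
    qed auto
    then show ?thesis by simp
  qed
  \<comment> \<open>The direction is chosen so that forms 3, 4 and 8 are constant on the line; the
    circle of radius 2 encloses the punctures \<open>0\<close> and \<open>1\<close>, which belong to
    planes 6 and 1.\<close>
  have z_line: "L (\<lambda>s. (-1 - rot s, 2 + rot s, 2 - rot s)) = 1"
  proof -
    have "L (\<lambda>s. (-1,2,2) + csmul (of_real 2 * rot s) (-1/2,1/2,-1/2)) = 1"
    proof (rule line[of "{1, -3, -4, 0, 4}"])
      show "((-1,2,2) + csmul z (-1/2,1/2,-1/2) \<in> root_complement) = (z \<notin> of_real ` {1, -3, -4, 0, 4})" for z
        by (auto simp add: root_complement_iff add_eq_0_iff minus_equation_iff[of z] field_simps)
      show "\<exists>i. \<forall>j. (root_form j ((-1,2,2) + csmul (of_real q) (-1/2,1/2,-1/2)) = 0) = (j = i)" if "q \<in> {1, -3, -4, 0, 4}" for q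
        using that unfolding forall_8 by (elim insertE emptyE)
          (rule exI[of _ 1] exI[of _ 2] exI[of _ 5] exI[of _ 6] exI[of _ 7], simp; fail)+
    qed auto
    then show ?thesis by simp
  qed
  have e_line: "L (\<lambda>s. (of_real r, 3, rot s)) = 1" if r: "r = 2 \<or> r = 5" for r
  proof -
    have "L (\<lambda>s. (of_real r,3,0) + csmul (rot s) (0,0,1)) = 1"
    proof (rule meridionalD[OF mer, of 7])
      show "root_form j (of_real r, 3, 0) \<noteq> 0" if "j \<noteq> 7" for j
      proof -
        have "\<forall>j. j \<noteq> 7 \<longrightarrow> root_form j (of_real r, 3, 0) \<noteq> 0" unfolding forall_8 using r by auto
        then show ?thesis using that by blast
      qed
      fix z :: complex assume "z \<noteq> 0" "norm z \<le> 1"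
      then show "(of_real r, 3, 0) + csmul z (0, 0, 1) \<in> root_complement"
        using r by (auto simp: root_complement_iff norm_neq_imp_nonzero)
    qed auto
    then show ?thesis by simp
  qed
  have x_loop: "L (\<lambda>s. (rot s - 3, 3, 1)) = 1"
  proof -
    have "L (\<lambda>s. (-3,3,1) + csmul (rot s) (1,0,0)) = 1"
    proof (rule meridionalD[OF mer, of 3])
      show "root_form j (-3, 3, 1) \<noteq> 0" if "j \<noteq> 3" for j
      proof -
        have "\<forall>j. j \<noteq> 3 \<longrightarrow> root_form j (-3, 3, 1) \<noteq> 0" unfolding forall_8 by auto
        then show ?thesis using that by blast
      qed
      fix z :: complex assume z: "z \<noteq> 0" "norm z \<le> 1"
      have "norm (-2::complex) \<noteq> norm z" "norm (-6::complex) \<noteq> norm z" "norm (-4::complex) \<noteq> norm z" using z by auto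
      from this[THEN norm_neq_imp_nonzero(1)]
      show "(-3, 3, 1) + csmul z (1, 0, 0) \<in> root_complement"
        using z by (simp add: root_complement_iff)
    qed auto
    then show ?thesis by (simp add: add.commute)
  qed
  have nz: "x * rot s + y * rot u \<noteq> 0" "x * rot s - y * rot u \<noteq> 0" if "norm x \<noteq> norm y" for x y s u
    using norm_neq_imp_nonzero[of "x * rot s" "y * rot u"] that by (simp_all add: norm_mult)
  have nz': "x + y * rot u \<noteq> 0" "x - y * rot u \<noteq> 0" "y * rot u - x \<noteq> 0" if "norm x \<noteq> norm y" for x y u
    using norm_neq_imp_nonzero[of x "y * rot u"] norm_neq_imp_nonzero[of "y * rot u" x] that
    by (simp_all add: norm_mult)
  show "L (\<lambda>s. (5 * rot s, 3 * rot s, rot s)) = 1"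
  proof -
    let ?H = "\<lambda>(s,u). (5 * rot s, 3 * rot u, rot u)" and ?K = "\<lambda>(s,u). (5, 3 * rot s, rot u)"
    have "L (\<lambda>s. ?H (s,s)) = L (\<lambda>s. ?H (s,0)) * L (\<lambda>u. ?H (0,u))"
    proof (rule torus_commute(2))
      show "continuous_on ({0..1} \<times> {0..1}) ?H" unfolding case_prod_unfold by (intro continuous_intros)
      show "?H ` ({0..1} \<times> {0..1}) \<subseteq> root_complement"
        using nz[of 5 1] nz[of 5 3] nz[of 3 1] by (auto simp: root_complement_iff)
    qed auto
    moreover have "L (\<lambda>s. ?K (s,s)) = L (\<lambda>s. ?K (s,0)) * L (\<lambda>u. ?K (0,u))"
    proof (rule torus_commute(2))
      show "continuous_on ({0..1} \<times> {0..1}) ?K" unfolding case_prod_unfold by (intro continuous_intros)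
      show "?K ` ({0..1} \<times> {0..1}) \<subseteq> root_complement"
        using nz'[of 5 1] nz'[of 5 3] nz[of 3 1] by (auto simp: root_complement_iff)
    qed auto
    ultimately show ?thesis using a_line[of 5] m_line e_line[of 5] by simp
  qed
  show "L (\<lambda>s. (2 * rot s, 3, rot s)) = 1"
  proof -
    let ?H = "\<lambda>(s,u). (2 * rot s, 3, rot u)"
    have "L (\<lambda>s. ?H (s,s)) = L (\<lambda>s. ?H (s,0)) * L (\<lambda>u. ?H (0,u))"
    proof (rule torus_commute(2))
      show "continuous_on ({0..1} \<times> {0..1}) ?H" unfolding case_prod_unfold by (intro continuous_intros)
      show "?H ` ({0..1} \<times> {0..1}) \<subseteq> root_complement"
        using nz[of 2 1] nz'[of 3 1] nz'[of 3 2] by (auto simp: root_complement_iff add.commute)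
    qed auto
    then show ?thesis using a_line[of 2] e_line[of 2] by simp
  qed
  show "L (\<lambda>s. (-2, 2 + rot s, 2 - rot s)) = 1"
  proof -
    let ?H = "\<lambda>(s,u). (rot s - 2 - rot u, 2 + rot u, 2 - rot u)"
    have "L (\<lambda>s. ?H (s,s)) = L (\<lambda>s. ?H (s,0)) * L (\<lambda>u. ?H (0,u))"
    proof (rule torus_commute(2))
      show "continuous_on ({0..1} \<times> {0..1}) ?H" unfolding case_prod_unfold by (intro continuous_intros)
      have "rot s - 4 - 2 * rot u \<noteq> 0" for s u
      proof
        assume "rot s - 4 - 2 * rot u = 0"
        then have "rot s - 2 * rot u = 4" by (simp add: algebra_simps)
        moreover have "norm (rot s - 2 * rot u) \<le> 3"
          using norm_triangle_ineq4[of "rot s" "2 * rot u"] by (simp add: norm_mult)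
        ultimately show False by simp
      qed
      then show "?H ` ({0..1} \<times> {0..1}) \<subseteq> root_complement"
        using nz[of 1 2] nz'[of 4 1] nz'[of 2 1] by (auto simp: root_complement_iff algebra_simps)
    qed auto
    then show ?thesis using x_loop z_line by simp
  qed
qed

text \<open>Divide \<open>L\<close> by a winding system with the same meridians: the quotient is
  trivial on these loops, and on the winding system each loop counts the planes through its
  centre.\<close>

lemma big_loops:
  assumes L: "rank_one_local_system root_complement L" and mer: "meridional t L" and t: "\<And>i. t i \<noteq> 0"
  shows "L (\<lambda>s. (5 * rot s, 3 * rot s, rot s)) = (\<Prod>i\<in>UNIV. t i)"
    and "L (\<lambda>s. (2 * rot s, 3, rot s)) = t 1 * t 4 * t 7"
    and "L (\<lambda>s. (-2, 2 + rot s, 2 - rot s)) = t 1 * t 3 * t 6"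
proof -
  define \<alpha> where "\<alpha> i = Ln (t i) / (2 * of_real pi * \<i>)" for i
  have \<alpha>: "exp (2 * of_real pi * \<i> * \<alpha> i) = t i" for i using t by (simp add: \<alpha>_def)
  let ?K = "winding_system root_form \<alpha>"
  have "rank_one_local_system root_complement (\<lambda>g. L g / ?K g)"
    using L winding_system_root_form by (rule rank_one_local_system_divide)
  moreover have "meridional (\<lambda>_. 1) (\<lambda>g. L g / ?K g)"
    unfolding meridional_def
  proof (intro allI impI)
    fix i p v
    assume *: "root_form i p = 0 \<and> (\<forall>j. j \<noteq> i \<longrightarrow> root_form j p \<noteq> 0) \<and>
      (\<forall>z. z \<noteq> 0 \<and> norm z \<le> 1 \<longrightarrow> p + csmul z v \<in> root_complement)"
    have "L (\<lambda>s. p + csmul (rot s) v) = t i" "?K (\<lambda>s. p + csmul (rot s) v) = t i"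
      using * mer meridional_winding_system[of \<alpha> t, OF \<alpha>] unfolding meridional_def by blast+
    then show "L (\<lambda>s. p + csmul (rot s) v) / ?K (\<lambda>s. p + csmul (rot s) v) = 1" using t by simp
  qed
  ultimately have "rank_one_local_system root_complement (\<lambda>g. L g / ?K g)" "meridional (\<lambda>_. 1) (\<lambda>g. L g / ?K g)" .
  note triv = trivial_big_loops[OF this]
  have nz: "?K g \<noteq> 0" for g by (simp add: winding_system_def)
  let ?circ = "\<lambda>p v s. p + csmul (rot s) v"
  have K: "?K (?circ p v) = (\<Prod>i\<in>I. t i)"
    if "\<And>i. i \<in> I \<Longrightarrow> root_form i p = 0 \<and> root_form i v \<noteq> 0"
      "\<And>i. i \<notin> I \<Longrightarrow> norm (root_form i v) < norm (root_form i p)" for I p v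
    using that by (subst winding_system_prod[of I]) (auto intro!: log_change_root_form_circle simp: \<alpha>)
  have "\<forall>i. root_form i (5,3,1) \<noteq> 0" "\<forall>i. root_form i (0,0,0) = 0" unfolding forall_8 by auto
  then have "?K (?circ (0,0,0) (5,3,1)) = (\<Prod>i\<in>UNIV. t i)" by (intro K) auto
  then show "L (\<lambda>s. (5 * rot s, 3 * rot s, rot s)) = (\<Prod>i\<in>UNIV. t i)"
    using triv(1) nz by (simp add: mult.commute)
  have "\<forall>i. i \<in> {1,4,7} \<longrightarrow> root_form i (0,3,0) = 0 \<and> root_form i (2,0,1) \<noteq> 0"
    "\<forall>i. i \<notin> {1,4,7} \<longrightarrow> norm (root_form i (2,0,1)) < norm (root_form i (0,3,0))"
    unfolding forall_8 by auto
  then have "?K (?circ (0,3,0) (2,0,1)) = (\<Prod>i\<in>{1,4,7}. t i)" by (intro K) auto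
  then show "L (\<lambda>s. (2 * rot s, 3, rot s)) = t 1 * t 4 * t 7"
    using triv(2) nz by (simp add: mult.commute mult.left_commute)
  have "\<forall>i. i \<in> {1,3,6} \<longrightarrow> root_form i (-2,2,2) = 0 \<and> root_form i (0,1,-1) \<noteq> 0"
    "\<forall>i. i \<notin> {1,3,6} \<longrightarrow> norm (root_form i (0,1,-1)) < norm (root_form i (-2,2,2))"
    unfolding forall_8 by auto
  then have "?K (?circ (-2,2,2) (0,1,-1)) = (\<Prod>i\<in>{1,3,6}. t i)" by (intro K) auto
  then show "L (\<lambda>s. (-2, 2 + rot s, 2 - rot s)) = t 1 * t 3 * t 6"
    using triv(3) nz by (simp add: mult.commute mult.left_commute)
qed

section \<open>Flat sections over one fibre\<close>

lemma path_connected_diff_finite: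
  fixes U :: "complex set"
  assumes "open U" "connected U" "finite T"
  shows "path_connected (U - T)"
  using assms by (intro path_connected_open_diff_countable) (auto simp: countable_finite)

text \<open>The crescent between two circles that touch at \<open>1\<close> is a strip in the coordinate \<open>1 / (1 - a)\<close>.\<close>

lemma path_connected_crescent:
  "path_connected {a::complex. 1 < norm a \<and> norm (a + 3/2) < 5/2 \<and> a \<noteq> -3}"
proof -
  \<comment> \<open>Under \<open>a = 1 - 1 / u\<close> the lines \<open>Re u = 1/2\<close> and
    \<open>Re u = 1/5\<close> go to the circles \<open>norm a = 1\<close> and
    \<open>norm (a + 3/2) = 5/2\<close>, and \<open>1/4\<close> goes to the puncture
    \<open>-3\<close>.\<close>
  let ?U = "{u. 1/5 < Re u} \<inter> {u. Re u < 1/2} - {1/4::complex}"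
  let ?f = "\<lambda>u::complex. 1 - 1 / u"
  have nz: "u \<noteq> 0" if "0 < Re u" for u using that by auto
  have sq: "norm (u - x) < norm u \<longleftrightarrow> x\<^sup>2 < 2 * x * Re u" for u :: complex and x :: real
    by (simp add: cmod_def power2_eq_square algebra_simps)
  have iff1: "1 < norm (?f u) \<longleftrightarrow> Re u < 1/2" if "u \<noteq> 0" for u
  proof -
    have "?f u = (u - 1) / u" using that by (simp add: field_simps)
    then have "1 < norm (?f u) \<longleftrightarrow> norm u < norm (u - 1)"
      using that by (simp add: norm_divide)
    also have "\<dots> \<longleftrightarrow> Re u < 1/2"
      by (simp add: cmod_def power2_eq_square algebra_simps)
    finally show ?thesis .
  qed
  have iff2: "norm (?f u + 3/2) < 5/2 \<longleftrightarrow> 1/5 < Re u" if "u \<noteq> 0" for u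
  proof -
    have "?f u + 3/2 = 5/2 * ((u - 2/5) / u)" using that by (simp add: field_simps)
    then have "norm (?f u + 3/2) = 5/2 * (norm (u - 2/5) / norm u)"
      by (simp only: norm_mult norm_divide) simp
    then have "norm (?f u + 3/2) < 5/2 \<longleftrightarrow> norm (u - 2/5) < norm u"
      using that by (auto simp: divide_less_eq)
    also have "\<dots> \<longleftrightarrow> 1/5 < Re u" using sq[of u "2/5"] by (simp add: power2_eq_square mult.commute)
    finally show ?thesis .
  qed
  have "path_connected (?f ` ?U)"
  proof (rule path_connected_continuous_image)
    show "continuous_on ?U ?f" by (intro continuous_intros) auto
    show "path_connected ?U"
      by (intro path_connected_diff_finite open_Int open_halfspace_Re_gt open_halfspace_Re_lt
          convex_connected convex_Int convex_halfspace_Re_gt convex_halfspace_Re_lt) auto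
  qed
  also have "?f ` ?U = {a. 1 < norm a \<and> norm (a + 3/2) < 5/2 \<and> a \<noteq> -3}"
  proof (intro equalityI subsetI)
    fix a assume "a \<in> ?f ` ?U"
    then obtain u where "a = ?f u" "u \<in> ?U" by blast
    then have u: "a = ?f u" "1/5 < Re u" "Re u < 1/2" "u \<noteq> 1/4" by (simp_all del: divide_eq_eq_numeral1 eq_divide_eq_numeral1)
    have "u \<noteq> 0" using u by auto
    moreover have "?f u \<noteq> -3" using u \<open>u \<noteq> 0\<close> by (auto simp: field_simps)
    ultimately show "a \<in> {a. 1 < norm a \<and> norm (a + 3/2) < 5/2 \<and> a \<noteq> -3}"
      using u iff1[of u] iff2[of u] by simp
  next
    fix a :: complex assume a: "a \<in> {a. 1 < norm a \<and> norm (a + 3/2) < 5/2 \<and> a \<noteq> -3}"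
    define u where "u = 1 / (1 - a)"
    have a1: "a \<noteq> 1" using a by auto
    then have u0: "u \<noteq> 0" and au: "a = ?f u" by (auto simp: u_def)
    have "u \<noteq> 1/4"
    proof
      assume "u = 1/4"
      with au have "a = 1 - 1 / (1 / 4)" by metis
      then have "a = -3" by simp
      then show False using a by simp
    qed
    then have "u \<in> ?U" using a iff1[OF u0] iff2[OF u0] unfolding au by simp
    then show "a \<in> ?f ` ?U" using au by blast
  qed
  finally show ?thesis .
qed

lemma root_complement_csmul:
  assumes "z \<noteq> 0" "w \<in> root_complement"
  shows "csmul z w \<in> root_complement"
proof -
  obtain a m e where w: "w = (a, m, e)" by (metis prod_cases3)
  have "\<forall>i. root_form i (csmul z (a, m, e)) = z * root_form i (a, m, e)"
    unfolding forall_8 by (simp add: algebra_simps)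
  then show ?thesis using assms by (simp add: root_complement_def w)
qed

text \<open>The coordinate \<open>a\<close> on the fibre over \<open>(m, e) = (3, 1)\<close>; the
  removed points are its intersections with planes 1, 2, 3, 4, in this order.\<close>

definition fibre31 :: "complex set" where
  "fibre31 = - {-1, 3, -3, 1}"

abbreviation to_fibre :: "complex \<Rightarrow> c3" where
  "to_fibre \<equiv> \<lambda>a. (a, 3, 1)"

locale meridional_transport = affine_transport root_complement L c
  for L c :: "(real \<Rightarrow> c3) \<Rightarrow> complex" +
  fixes t :: "8 \<Rightarrow> complex"
  assumes meridional: "meridional t L" and t_nonzero: "t i \<noteq> 0"
begin

lemma meridian_7:
  assumes "a \<noteq> 0" "m \<noteq> 0" "a \<noteq> m" "a \<noteq> - m" "norm e < norm m" "norm e < norm a" "e \<noteq> 0"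
  shows "L (\<lambda>s. (a, m, e * rot s)) = t 7"
proof -
  have "L (\<lambda>s. (a, m, 0) + csmul (rot s) (0, 0, e)) = t 7"
  proof (rule meridionalD[OF meridional, of 7])
    show "root_form j (a, m, 0) \<noteq> 0" if "j \<noteq> 7" for j
    proof -
      have "\<forall>j. j \<noteq> 7 \<longrightarrow> root_form j (a, m, 0) \<noteq> 0"
        unfolding forall_8 using assms by (auto simp: eq_neg_iff_add_eq_0)
      then show ?thesis using that by blast
    qed
    fix z :: complex assume z: "z \<noteq> 0" "norm z \<le> 1"
    have "norm (z * e) \<le> norm e" using z by (simp add: norm_mult mult_left_le_one_le)
    then have "norm m \<noteq> norm (z * e)" "norm a \<noteq> norm (z * e)" using assms by linarith+
    from this[THEN norm_neq_imp_nonzero(1)] this[THEN norm_neq_imp_nonzero(2)]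
    show "(a, m, 0) + csmul z (0, 0, e) \<in> root_complement"
      using z assms by (simp add: root_complement_iff eq_neg_iff_add_eq_0)
  qed auto
  then show ?thesis by (simp add: mult.commute)
qed

text \<open>Let \<open>e\<close> turn around 0 while \<open>a\<close> and \<open>m = 3\<close> stay
  fixed. For \<open>norm a > 1\<close> the disc \<open>norm e \<le> 1\<close> meets no plane but
  \<open>e = 0\<close>, so this is a family of meridians of plane 7, whose fixed points form a flat
  section.\<close>

lemma fibre_section_7:
  assumes t7: "t 7 \<noteq> 1"
  defines "\<phi> \<equiv> \<lambda>a s. (a, 3, rot s)"
  shows "flat_on (\<lambda>g. L (to_fibre \<circ> g)) (\<lambda>g. c (to_fibre \<circ> g)) {a \<in> fibre31. 1 < norm a} (\<lambda>a. c (\<phi> a) / (t 7 - 1))"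
    and "\<And>a. a \<in> fibre31 \<Longrightarrow> 1 < norm a \<Longrightarrow> L (\<phi> a) = t 7"
proof -
  show *: "L (\<phi> a) = t 7" if "a \<in> fibre31" "1 < norm a" for a
  proof -
    have "a \<noteq> 0" using that by auto
    then show ?thesis using meridian_7[of a 3 1] that by (auto simp: \<phi>_def fibre31_def)
  qed
  show "flat_on (\<lambda>g. L (to_fibre \<circ> g)) (\<lambda>g. c (to_fibre \<circ> g)) {a \<in> fibre31. 1 < norm a} (\<lambda>a. c (\<phi> a) / (t 7 - 1))"
  proof (rule flat_on_loop_family)
    show "continuous_on ({a \<in> fibre31. 1 < norm a} \<times> {0..1}) (\<lambda>(w, s). \<phi> w s)"
      unfolding \<phi>_def case_prod_unfold by (intro continuous_intros)
    fix a and s :: real assume a: "a \<in> {a \<in> fibre31. 1 < norm a}"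
    then have "norm a \<noteq> norm (rot s)" "norm (3::complex) \<noteq> norm (rot s)" by auto
    from this[THEN norm_neq_imp_nonzero(1)] this[THEN norm_neq_imp_nonzero(2)]
    show "\<phi> a s \<in> root_complement"
      using a by (auto simp: \<phi>_def root_complement_iff fibre31_def eq_neg_iff_add_eq_0[symmetric])
  qed (use * t7 in \<open>auto simp: \<phi>_def\<close>)
qed

text \<open>Multiplication by the unit circle gives a loop through every point of the complement.
  Over the connected fibre its monodromy is constant, and at \<open>a = 5\<close> it is the first of
  the \<open>big_loops\<close>.\<close>

lemma fibre_section_scaling:
  assumes p: "(\<Prod>i\<in>UNIV. t i) \<noteq> 1"
  shows "\<exists>h. flat_on (\<lambda>g. L (to_fibre \<circ> g)) (\<lambda>g. c (to_fibre \<circ> g)) fibre31 h"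
proof
  define \<phi> where "\<phi> = (\<lambda>(a::complex) s. (a * rot s, 3 * rot s, rot s))"
  have cont: "continuous_on (fibre31 \<times> {0..1}) (\<lambda>(w, s). \<phi> w s)"
    unfolding \<phi>_def case_prod_unfold by (intro continuous_intros)
  have sub: "\<phi> a s \<in> root_complement" if "a \<in> fibre31" for a s
  proof -
    have "a + 1 \<noteq> 0" "a - 3 \<noteq> 0" "a + 3 \<noteq> 0" "a - 1 \<noteq> 0"
      using that by (auto simp: fibre31_def eq_neg_iff_add_eq_0[symmetric])
    moreover have "\<phi> a s = csmul (rot s) (a, 3, 1)" by (simp add: \<phi>_def mult.commute)
    ultimately show ?thesis by (simp add: root_complement_csmul root_complement_iff del: csmul.simps)
  qed
  have ends: "\<phi> w 0 = to_fibre w" "\<phi> w 1 = to_fibre w" for w by (auto simp: \<phi>_def)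
  have "L (\<phi> a) = (\<Prod>i\<in>UNIV. t i)" if a: "a \<in> fibre31" for a
  proof -
    have "path_connected fibre31"
      unfolding fibre31_def Compl_eq_Diff_UNIV by (rule path_connected_diff_finite) auto
    moreover have "5 \<in> fibre31" by (auto simp: fibre31_def)
    ultimately obtain g where g: "path g" "path_image g \<subseteq> fibre31" "pathstart g = a" "pathfinish g = 5"
      using a unfolding path_connected_def by blast
    have "L (\<phi> a) = L (\<phi> 5)"
      using loop_family(1)[of fibre31 \<phi> to_fibre g, OF cont sub ends g(1,2)] g by simp
    then show ?thesis using big_loops(1)[OF rank_one meridional t_nonzero] by (simp add: \<phi>_def)
  qed
  then show "flat_on (\<lambda>g. L (to_fibre \<circ> g)) (\<lambda>g. c (to_fibre \<circ> g)) fibre31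
     (\<lambda>a. c (\<phi> a) / ((\<Prod>i\<in>UNIV. t i) - 1))"
    using p sub by (intro flat_on_loop_family cont ends) auto
qed

text \<open>The meridians of plane 7 serve for \<open>norm a > 1\<close>. For
  \<open>norm a < 3\<close> the simultaneous rotation of \<open>a\<close> and \<open>e\<close>,
  around the intersection of planes 1, 4, 7, is available. In the annulus the two loops bound a
  torus, hence share their fixed point, and the sections glue.\<close>

lemma fibre_section_147:
  assumes t7: "t 7 \<noteq> 1" and p: "t 1 * t 4 * t 7 \<noteq> 1"
  shows "\<exists>h. flat_on (\<lambda>g. L (to_fibre \<circ> g)) (\<lambda>g. c (to_fibre \<circ> g)) fibre31 h"
proof -
  define \<phi> where "\<phi> = (\<lambda>(a::complex) s. (a, 3::complex, rot s))"
  define \<psi> where "\<psi> = (\<lambda>(a::complex) s. (a * rot s, 3::complex, rot s))"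
  let ?V = "{a \<in> fibre31. norm a < 3}"
  let ?L = "\<lambda>g. L (to_fibre \<circ> g)" and ?c = "\<lambda>g. c (to_fibre \<circ> g)"
  have s7: "flat_on ?L ?c {a \<in> fibre31. 1 < norm a} (\<lambda>a. c (\<phi> a) / (t 7 - 1))"
    "\<And>a. a \<in> fibre31 \<Longrightarrow> 1 < norm a \<Longrightarrow> L (\<phi> a) = t 7"
    using fibre_section_7[OF t7] by (simp_all add: \<phi>_def)
  have cont: "continuous_on (?V \<times> {0..1}) (\<lambda>(w, s). \<psi> w s)"
    unfolding \<psi>_def case_prod_unfold by (intro continuous_intros)
  have sub: "(a * rot u, 3, z * rot u) \<in> root_complement" if "norm z = 1" "norm a < 3" "a + z \<noteq> 0" "a - z \<noteq> 0" for a z u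
  proof -
    have n: "norm (a * rot u) \<noteq> norm (3::complex)" "norm (3::complex) \<noteq> norm (z * rot u)" using that by (auto simp: norm_mult)
    from this[THEN norm_neq_imp_nonzero(1)] this[THEN norm_neq_imp_nonzero(2)]
    have "a * rot u + 3 \<noteq> 0" "a * rot u - 3 \<noteq> 0" "3 + z * rot u \<noteq> 0" "3 - z * rot u \<noteq> 0" by auto
    moreover have "a * rot u + z * rot u = (a + z) * rot u" "a * rot u - z * rot u = (a - z) * rot u" by (simp_all add: algebra_simps)
    ultimately show ?thesis using that by (auto simp: root_complement_iff)
  qed
  have sub\<psi>: "\<psi> a s \<in> root_complement" if "a \<in> ?V" for a s
    using sub[of 1 a s] that by (auto simp: \<psi>_def fibre31_def eq_neg_iff_add_eq_0[symmetric])
  have ends: "\<psi> w 0 = to_fibre w" "\<psi> w 1 = to_fibre w" for w by (auto simp: \<psi>_def)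
  have \<tau>: "L (\<psi> a) = t 1 * t 4 * t 7" if a: "a \<in> ?V" for a
  proof -
    have "?V = ball 0 3 - {-1, 3, -3, 1}" by (auto simp: fibre31_def)
    then have "path_connected ?V" by (simp add: path_connected_diff_finite)
    moreover have "2 \<in> ?V" by (auto simp: fibre31_def)
    ultimately obtain g where g: "path g" "path_image g \<subseteq> ?V" "pathstart g = a" "pathfinish g = 2"
      using a unfolding path_connected_def by blast
    have "L (\<psi> a) = L (\<psi> 2)"
      using loop_family(1)[of ?V \<psi> to_fibre g, OF cont sub\<psi> ends g(1,2)] g by simp
    then show ?thesis using big_loops(2)[OF rank_one meridional t_nonzero] by (simp add: \<psi>_def)
  qed
  have flat\<psi>: "flat_on ?L ?c ?V (\<lambda>a. c (\<psi> a) / (t 1 * t 4 * t 7 - 1))"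
    using p sub\<psi> \<tau> by (intro flat_on_loop_family cont ends) auto
  have agree: "c (\<phi> a) / (t 7 - 1) = c (\<psi> a) / (t 1 * t 4 * t 7 - 1)" if a: "a \<in> fibre31" "1 < norm a" "norm a < 3" for a
  proof -
    \<comment> \<open>The side \<open>u = 0\<close> is \<open>\<phi> a\<close> and the side
      \<open>s = 0\<close> is \<open>\<psi> a\<close>.\<close>
    let ?H = "\<lambda>(s,u). (a * rot u, 3, rot s * rot u)"
    have "c (\<lambda>s. ?H (s,0)) * (L (\<lambda>u. ?H (0,u)) - 1) = c (\<lambda>u. ?H (0,u)) * (L (\<lambda>s. ?H (s,0)) - 1)"
    proof (rule torus_commute(1))
      show "continuous_on ({0..1} \<times> {0..1}) ?H" unfolding case_prod_unfold by (intro continuous_intros)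
      show "?H ` ({0..1} \<times> {0..1}) \<subseteq> root_complement"
        using a by (auto intro!: sub dest: arg_cong[of _ _ norm] simp: add_eq_0_iff2)
    qed auto
    then have "c (\<phi> a) * (L (\<psi> a) - 1) = c (\<psi> a) * (L (\<phi> a) - 1)" by (simp add: \<phi>_def \<psi>_def)
    then show ?thesis using s7(2)[OF a(1,2)] \<tau>[of a] a t7 p by (simp add: frac_eq_eq)
  qed
  define h where "h a = (if 1 < norm a then c (\<phi> a) / (t 7 - 1) else c (\<psi> a) / (t 1 * t 4 * t 7 - 1))" for a
  interpret F: affine_transport fibre31 ?L ?c
    by (rule pullback) (auto intro!: continuous_intros simp: root_complement_iff fibre31_def eq_neg_iff_add_eq_0[symmetric])
  have "flat_on ?L ?c fibre31 h"
  proof (rule F.flat_on_local)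
    fix a assume a: "a \<in> fibre31"
    show "\<exists>V. open V \<and> a \<in> V \<and> flat_on ?L ?c (fibre31 \<inter> V) h"
    proof (cases "1 < norm a")
      case True
      have "flat_on ?L ?c (fibre31 \<inter> {a. 1 < norm a}) h"
        by (rule flat_on_cong[OF flat_on_mono[OF s7(1)]]) (auto simp: h_def)
      then show ?thesis using True by (intro exI[of _ "{a. 1 < norm a}"]) (auto intro!: open_Collect_less continuous_intros)
    next
      case False
      have "flat_on ?L ?c (fibre31 \<inter> ball 0 3) h"
        by (rule flat_on_cong[OF flat_on_mono[OF flat\<psi>]]) (auto simp: h_def agree)
      then show ?thesis using False by (intro exI[of _ "ball 0 3"]) auto
    qed
  qed auto
  then show ?thesis by blast
qed

lemma meridian_3:
  assumes "0 < norm r" "norm r < 2"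
  shows "L (\<lambda>s. (r * rot s - 3, 3, 1)) = t 3"
proof -
  have "L (\<lambda>s. (-3, 3, 1) + csmul (rot s) (r, 0, 0)) = t 3"
  proof (rule meridionalD[OF meridional, of 3])
    show "root_form j (-3, 3, 1) \<noteq> 0" if "j \<noteq> 3" for j
    proof -
      have "\<forall>j. j \<noteq> 3 \<longrightarrow> root_form j (-3, 3, 1) \<noteq> 0" unfolding forall_8 by auto
      then show ?thesis using that by blast
    qed
    fix z :: complex assume z: "z \<noteq> 0" "norm z \<le> 1"
    have "norm (z * r) \<le> norm r" using z by (simp add: norm_mult mult_left_le_one_le)
    then have "norm (-2::complex) \<noteq> norm (z * r)" "norm (-6::complex) \<noteq> norm (z * r)" "norm (-4::complex) \<noteq> norm (z * r)"
      using assms by auto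
    from this[THEN norm_neq_imp_nonzero(1)]
    show "(-3, 3, 1) + csmul z (r, 0, 0) \<in> root_complement"
      using z assms by (auto simp: root_complement_iff)
  qed auto
  then show ?thesis by (simp add: add.commute mult.commute)
qed

text \<open>As for planes 1, 4, 7, but with rotation about a point on planes 1, 3, 6, which is
  possible over the disc \<open>norm (a + 3/2) < 5/2\<close>. The two sections are compared only at
  \<open>a = -2\<close>; the overlap is the connected crescent, and uniqueness of flat sections does
  the rest.\<close>

lemma fibre_section_136:
  assumes t7: "t 7 \<noteq> 1" and t3: "t 3 \<noteq> 1" and p: "t 1 * t 3 * t 6 \<noteq> 1"
  shows "\<exists>h. flat_on (\<lambda>g. L (to_fibre \<circ> g)) (\<lambda>g. c (to_fibre \<circ> g)) fibre31 h"
proof -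
  define \<phi> where "\<phi> = (\<lambda>(a::complex) s. (a, 3::complex, rot s))"
  \<comment> \<open>The rotation of \<open>(a, 3, 1)\<close> about
    \<open>(-2, 2, 2)\<close>.\<close>
  define \<psi> where "\<psi> = (\<lambda>(a::complex) s. ((a + 2) * rot s - 2, 2 + rot s, 2 - rot s))"
  define \<mu> where "\<mu> = (\<lambda>s. (rot s - 3, 3::complex, 1::complex))"
  \<comment> \<open>This disc lies in the discs of radius 4 about \<open>-3\<close> and
    \<open>-1\<close>, which keeps \<open>a - e\<close> and \<open>a - m\<close> away from 0 during
    the rotation. It contains the closed unit disc except the puncture \<open>1\<close>, so with
    \<open>norm a > 1\<close> it covers the fibre.\<close>
  let ?B = "{a::complex. norm (a + 3/2) < 5/2}"
  let ?V = "fibre31 \<inter> ?B"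
  let ?L = "\<lambda>g. L (to_fibre \<circ> g)" and ?c = "\<lambda>g. c (to_fibre \<circ> g)"
  have s7: "flat_on ?L ?c {a \<in> fibre31. 1 < norm a} (\<lambda>a. c (\<phi> a) / (t 7 - 1))"
    "\<And>a. a \<in> fibre31 \<Longrightarrow> 1 < norm a \<Longrightarrow> L (\<phi> a) = t 7"
    using fibre_section_7[OF t7] by (simp_all add: \<phi>_def)
  have ball: "?B = ball (-3/2) (5/2)" by (auto simp: dist_norm norm_minus_commute)
  have cont: "continuous_on (?V \<times> {0..1}) (\<lambda>(w, s). \<psi> w s)"
    unfolding \<psi>_def case_prod_unfold by (intro continuous_intros)
  have sub: "(x * rot u - 2 - rot u, 2 + rot u, 2 - rot u) \<in> root_complement"
    if x: "norm x < 4" "norm (x - 2) < 4" "x \<noteq> 0" "x \<noteq> 2" for x u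
  proof -
    have n: "norm (x * rot u) \<noteq> norm (4::complex)" "norm ((x - 2) * rot u) \<noteq> norm (4::complex)"
      "norm (2::complex) \<noteq> norm (rot u)"
      using x by (auto simp: norm_mult)
    note n(1,2)[THEN norm_neq_imp_nonzero(2)] n(3)[THEN norm_neq_imp_nonzero(1)] n(3)[THEN norm_neq_imp_nonzero(2)]
    moreover have "(x - 2) * rot u \<noteq> 0" using x by simp
    ultimately show ?thesis using x
      by (auto simp: root_complement_iff algebra_simps)
  qed
  have sub\<psi>: "\<psi> a s \<in> root_complement" if "a \<in> ?V" for a s
  proof -
    have "norm (a + 3) < 4"
      using norm_triangle_ineq[of "a + 3/2" "3/2"] that by (simp add: add.commute)
    moreover have "norm (a + 3 - 2) < 4"
      using norm_triangle_ineq[of "a + 3/2" "-1/2"] that by (simp add: add.commute)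
    moreover have "a + 3 \<noteq> 0" "a + 3 \<noteq> 2"
    proof -
      show "a + 3 \<noteq> 0" using that by (auto simp: fibre31_def eq_neg_iff_add_eq_0[symmetric])
      show "a + 3 \<noteq> 2"
      proof
        assume "a + 3 = 2"
        then have "a = 2 - 3" by (metis add_diff_cancel_right')
        then show False using that by (auto simp: fibre31_def)
      qed
    qed
    ultimately show ?thesis using sub[of "a + 3" s] by (simp add: \<psi>_def algebra_simps)
  qed
  have ends: "\<psi> w 0 = to_fibre w" "\<psi> w 1 = to_fibre w" for w by (auto simp: \<psi>_def)
  have m2: "-2 \<in> ?V" by (auto simp: fibre31_def)
  have \<tau>: "L (\<psi> a) = t 1 * t 3 * t 6" if a: "a \<in> ?V" for a
  proof -
    have "?V = ball (-3/2) (5/2) - {-1, 3, -3, 1}" unfolding ball fibre31_def by auto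
    then have "path_connected ?V" by (simp add: path_connected_diff_finite)
    then obtain g where g: "path g" "path_image g \<subseteq> ?V" "pathstart g = a" "pathfinish g = -2"
      using a m2 unfolding path_connected_def by blast
    have "L (\<psi> a) = L (\<psi> (-2))"
      using loop_family(1)[of ?V \<psi> to_fibre g, OF cont sub\<psi> ends g(1,2)] g by simp
    then show ?thesis using big_loops(3)[OF rank_one meridional t_nonzero] by (simp add: \<psi>_def)
  qed
  have flat\<psi>: "flat_on ?L ?c ?V (\<lambda>a. c (\<psi> a) / (t 1 * t 3 * t 6 - 1))"
    using p sub\<psi> \<tau> by (intro flat_on_loop_family cont ends) auto
  have \<mu>3: "L \<mu> = t 3" using meridian_3[of 1] by (simp add: \<mu>_def)
  have m2': "-2 \<in> fibre31" "1 < norm (-2::complex)" using m2 by auto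
  text \<open>Near the puncture \<open>-3\<close> both sections are the fixed point of the loop \<open>\<mu>\<close> around it.\<close>
  have e1: "c (\<phi> (-2)) / (t 7 - 1) = c \<mu> / (t 3 - 1)"
  proof -
    let ?H = "\<lambda>(s,u). (rot s - 3, 3, rot u)"
    have "c (\<lambda>s. ?H (s,0)) * (L (\<lambda>u. ?H (0,u)) - 1) = c (\<lambda>u. ?H (0,u)) * (L (\<lambda>s. ?H (s,0)) - 1)"
    proof (rule torus_commute(1))
      show "continuous_on ({0..1} \<times> {0..1}) ?H" unfolding case_prod_unfold by (intro continuous_intros)
      show "?H ` ({0..1} \<times> {0..1}) \<subseteq> root_complement"
      proof clarify
        fix s u :: real
        have "norm (rot s + rot u) \<le> 2" "norm (rot s - rot u) \<le> 2"
          using norm_triangle_ineq[of "rot s" "rot u"] norm_triangle_ineq4[of "rot s" "rot u"] by auto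
        then have "norm (rot s + rot u) \<noteq> norm (3::complex)" "norm (rot s - rot u) \<noteq> norm (3::complex)"
          "norm (rot s) \<noteq> norm (6::complex)" "norm (3::complex) \<noteq> norm (rot u)" by auto
        from this[THEN norm_neq_imp_nonzero(2)] this(4)[THEN norm_neq_imp_nonzero(1)]
        show "(rot s - 3, 3, rot u) \<in> root_complement" by (simp add: root_complement_iff algebra_simps)
      qed
    qed auto
    then have "c \<mu> * (L (\<phi> (-2)) - 1) = c (\<phi> (-2)) * (L \<mu> - 1)" by (simp add: \<phi>_def \<mu>_def)
    then show ?thesis using s7(2)[OF m2'] \<mu>3 t7 t3 by (simp add: frac_eq_eq)
  qed
  have e2: "c (\<psi> (-2)) / (t 1 * t 3 * t 6 - 1) = c \<mu> / (t 3 - 1)"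
  proof -
    let ?H = "\<lambda>(s,u). (rot s * rot u - 2 - rot u, 2 + rot u, 2 - rot u)"
    have "c (\<lambda>s. ?H (s,0)) * (L (\<lambda>u. ?H (0,u)) - 1) = c (\<lambda>u. ?H (0,u)) * (L (\<lambda>s. ?H (s,0)) - 1)"
    proof (rule torus_commute(1))
      show "continuous_on ({0..1} \<times> {0..1}) ?H" unfolding case_prod_unfold by (intro continuous_intros)
      have "norm (rot s - 2) < 4" "rot s \<noteq> 2" for s
        using norm_triangle_ineq4[of "rot s" 2] by (auto dest: arg_cong[of _ _ norm])
      then show "?H ` ({0..1} \<times> {0..1}) \<subseteq> root_complement" by (auto intro!: sub)
    qed auto
    then have "c \<mu> * (L (\<psi> (-2)) - 1) = c (\<psi> (-2)) * (L \<mu> - 1)" by (simp add: \<psi>_def \<mu>_def)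
    then show ?thesis using \<tau>[OF m2] \<mu>3 p t3 by (simp add: frac_eq_eq)
  qed
  interpret F: affine_transport fibre31 ?L ?c
    by (rule pullback) (auto intro!: continuous_intros simp: root_complement_iff fibre31_def eq_neg_iff_add_eq_0[symmetric])
  let ?O = "{a::complex. 1 < norm a \<and> norm (a + 3/2) < 5/2 \<and> a \<noteq> -3}"
  have O: "?O \<subseteq> ?V" "?O \<subseteq> {a \<in> fibre31. 1 < norm a}" by (auto simp: fibre31_def)
  have agree: "c (\<phi> a) / (t 7 - 1) = c (\<psi> a) / (t 1 * t 3 * t 6 - 1)" if a: "a \<in> ?O" for a
  proof (rule F.flat_on_unique[where a="-2" and b=a and h="\<lambda>a. c (\<phi> a) / (t 7 - 1)"
        and k="\<lambda>a. c (\<psi> a) / (t 1 * t 3 * t 6 - 1)", OF _ _ path_connected_crescent _ _ _ a])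
    show "flat_on ?L ?c ?O (\<lambda>a. c (\<phi> a) / (t 7 - 1))" using s7(1) O(2) by (rule flat_on_mono)
    show "flat_on ?L ?c ?O (\<lambda>a. c (\<psi> a) / (t 1 * t 3 * t 6 - 1))" using flat\<psi> O(1) by (rule flat_on_mono)
  qed (use O e1 e2 in auto)
  define h where "h a = (if 1 < norm a then c (\<phi> a) / (t 7 - 1) else c (\<psi> a) / (t 1 * t 3 * t 6 - 1))" for a
  have "flat_on ?L ?c fibre31 h"
  proof (rule F.flat_on_local)
    fix a assume a: "a \<in> fibre31"
    show "\<exists>V. open V \<and> a \<in> V \<and> flat_on ?L ?c (fibre31 \<inter> V) h"
    proof (cases "1 < norm a")
      case True
      have "flat_on ?L ?c (fibre31 \<inter> {a. 1 < norm a}) h"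
        by (rule flat_on_cong[OF flat_on_mono[OF s7(1)]]) (auto simp: h_def)
      then show ?thesis using True by (intro exI[of _ "{a. 1 < norm a}"]) (auto intro!: open_Collect_less continuous_intros)
    next
      case False
      have "flat_on ?L ?c (fibre31 \<inter> ?B) h"
        by (rule flat_on_cong[OF flat\<psi>]) (auto simp: h_def agree fibre31_def)
      moreover have "norm (a + 3/2) < 5/2"
      proof -
        have "Re a \<noteq> 1"
        proof
          assume r: "Re a = 1"
          have "(Re a)\<^sup>2 + (Im a)\<^sup>2 \<le> 1" using False by (simp add: cmod_power2[symmetric] power_le_one)
          then have "Im a = 0" using r by simp
          then have "a = 1" using r by (simp add: complex_eq_iff)
          then show False using a by (simp add: fibre31_def)
        qed
        moreover have "Re a \<le> 1" using False complex_Re_le_cmod[of a] by linarith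
        ultimately have r: "Re a < 1" by simp
        have s: "(Re a)\<^sup>2 + (Im a)\<^sup>2 \<le> 1" using False by (simp add: cmod_power2[symmetric] power_le_one)
        have "(norm (a + 3/2))\<^sup>2 = (Re a)\<^sup>2 + (Im a)\<^sup>2 + 3 * Re a + 9/4"
          unfolding cmod_power2 by (simp add: power2_eq_square algebra_simps)
        also have "\<dots> < (5/2)\<^sup>2" using r s by (simp add: power2_eq_square)
        finally show ?thesis by (rule power2_less_imp_less) simp
      qed
      moreover have "open ?B" unfolding ball by simp
      ultimately show ?thesis by (intro exI[of _ ?B]) simp
    qed
  qed auto
  then show ?thesis by blast
qed

end

section \<open>Propagation over the base\<close>

text \<open>
  The arrangement complement fibres over \<open>base\<close>; the fibre over \<open>(m, e)\<close> is the line minus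
  the four points \<open>-e\<close>, \<open>m\<close>, \<open>-m\<close>, \<open>e\<close>.
\<close>

definition punct :: "8 \<Rightarrow> complex \<times> complex \<Rightarrow> complex" where
  "punct i \<beta> = (if i = 1 then - snd \<beta> else if i = 2 then fst \<beta> else if i = 3 then - fst \<beta> else snd \<beta>)"

abbreviation I4 :: "8 set" where "I4 \<equiv> {1, 2, 3, 4}"

definition base :: "(complex \<times> complex) set" where
  "base = {\<beta>. fst \<beta> \<noteq> 0 \<and> snd \<beta> \<noteq> 0 \<and> fst \<beta> \<noteq> snd \<beta> \<and> fst \<beta> \<noteq> - snd \<beta>}"

lemma base_iff: "\<beta> \<in> base \<longleftrightarrow> (\<forall>i\<in>I4. \<forall>j\<in>I4. i \<noteq> j \<longrightarrow> punct i \<beta> \<noteq> punct j \<beta>)"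
  unfolding base_def by (auto simp: punct_def) (metis minus_minus)+

lemma root_form_punct: "i \<in> I4 \<Longrightarrow> root_form i (a, \<beta>) = a - punct i \<beta>"
  by (cases \<beta>) (auto simp: punct_def)

lemma root_complement_fibre:
  "(a, \<beta>) \<in> root_complement \<longleftrightarrow> \<beta> \<in> base \<and> (\<forall>i\<in>I4. a \<noteq> punct i \<beta>)"
  by (cases \<beta>) (auto simp: root_complement_iff base_def punct_def eq_neg_iff_add_eq_0)

lemma norm_punct_diff: "norm (punct i \<beta> - punct i \<beta>') \<le> dist \<beta> \<beta>'"
proof -
  have "norm (fst \<beta> - fst \<beta>') \<le> dist \<beta> \<beta>'" "norm (snd \<beta> - snd \<beta>') \<le> dist \<beta> \<beta>'"
    using dist_fst_le[of \<beta> \<beta>'] dist_snd_le[of \<beta> \<beta>'] by (simp_all add: dist_norm)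
  then show ?thesis by (simp add: punct_def norm_minus_commute)
qed

lemma continuous_on_punct [continuous_intros]:
  "continuous_on S f \<Longrightarrow> continuous_on S (\<lambda>x. punct i (f x))"
  unfolding punct_def by (cases "i = 1"; cases "i = 2"; cases "i = 3") (auto intro!: continuous_intros)

text \<open>The condition says that the circle through the point about puncture \<open>i\<close>,
  within its fibre, bounds a disc without further punctures, so that it is a meridian of plane
  \<open>i\<close>.\<close>

definition tube :: "8 \<Rightarrow> c3 set" where
  "tube i = {w. snd w \<in> base \<and> fst w \<noteq> punct i (snd w) \<and>
     (\<forall>j\<in>I4 - {i}. norm (fst w - punct i (snd w)) < norm (punct j (snd w) - punct i (snd w)))}"

definition circ :: "8 \<Rightarrow> c3 \<Rightarrow> real \<Rightarrow> c3" where
  "circ i w s = (punct i (snd w) + (fst w - punct i (snd w)) * rot s, snd w)"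

abbreviation fibre :: "complex \<times> complex \<Rightarrow> c3 set" where
  "fibre \<beta> \<equiv> {w \<in> root_complement. snd w = \<beta>}"

lemma path_connected_fibre: "path_connected (fibre \<beta>)"
proof (cases "\<beta> \<in> base")
  case True
  have "path_connected ((\<lambda>a. (a, \<beta>)) ` (UNIV - {punct 1 \<beta>, punct 2 \<beta>, punct 3 \<beta>, punct 4 \<beta>}))"
    by (intro path_connected_continuous_image path_connected_diff_finite continuous_intros) auto
  moreover have "(\<lambda>a. (a, \<beta>)) ` (UNIV - {punct 1 \<beta>, punct 2 \<beta>, punct 3 \<beta>, punct 4 \<beta>}) = fibre \<beta>"
    using True by (auto simp: root_complement_fibre)
  ultimately show ?thesis by simp
next
  case False
  then have "fibre \<beta> = {}" by (auto simp: root_complement_fibre)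
  then show ?thesis by (simp only: path_connected_empty)
qed

lemma circ_in_fibre:
  assumes "i \<in> I4" "w \<in> tube i"
  shows "circ i w s \<in> fibre (snd w)"
proof -
  let ?r = "(fst w - punct i (snd w)) * rot s"
  have "punct i (snd w) + ?r \<noteq> punct j (snd w)" if "j \<in> I4" for j
  proof (cases "j = i")
    case True then show ?thesis using assms by (auto simp: tube_def)
  next
    case False
    then have "norm ?r < norm (punct j (snd w) - punct i (snd w))"
      using assms that by (simp add: tube_def norm_mult)
    then show ?thesis by (metis add_diff_cancel_left' less_irrefl)
  qed
  then show ?thesis using assms by (simp add: circ_def root_complement_fibre tube_def)
qed

lemma tube_subset: "i \<in> I4 \<Longrightarrow> tube i \<subseteq> root_complement"
  using circ_in_fibre[of i _ 0] by (auto simp: circ_def)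

lemma path_circ: "path (circ i w)"
  unfolding circ_def path_def by (intro continuous_intros)

context meridional_transport
begin

lemma L_circ:
  assumes i: "i \<in> I4" and w: "w \<in> tube i"
  shows "L (circ i w) = t i"
proof -
  obtain a m e where ame: "w = (a, m, e)" by (metis prod_cases3)
  let ?P = "punct i (m, e)"
  have b: "(m, e) \<in> base" using w by (simp add: tube_def ame)
  have "L (\<lambda>s. (?P, m, e) + csmul (rot s) (a - ?P, 0, 0)) = t i"
  proof (rule meridionalD[OF meridional, of i])
    show "root_form i (?P, m, e) = 0" using i by (simp add: root_form_punct)
    show "root_form j (?P, m, e) \<noteq> 0" if "j \<noteq> i" for j
    proof (cases "j \<in> I4")
      case True
      then show ?thesis using b that i by (auto simp: root_form_punct base_iff)
    next
      case False
      then have "j = 5 \<or> j = 6 \<or> j = 7 \<or> j = 8" using exhaust_8[of j] by auto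
      then show ?thesis using b by (auto simp: base_def eq_neg_iff_add_eq_0)
    qed
    fix z :: complex assume z: "z \<noteq> 0" "norm z \<le> 1"
    have "?P + z * (a - ?P) \<noteq> punct j (m, e)" if "j \<in> I4" for j
    proof (cases "j = i")
      case True then show ?thesis using w z by (simp add: tube_def ame)
    next
      case False
      then have "norm (a - ?P) < norm (punct j (m, e) - ?P)"
        using w that by (simp add: tube_def ame)
      moreover have "norm (z * (a - ?P)) \<le> norm (a - ?P)" using z by (simp add: norm_mult mult_left_le_one_le)
      ultimately show ?thesis by (metis add_diff_cancel_left' not_le)
    qed
    then show "(?P, m, e) + csmul z (a - ?P, 0, 0) \<in> root_complement"
      using b by (simp add: root_complement_fibre)
  qed
  moreover have "circ i w = (\<lambda>s. (?P, m, e) + csmul (rot s) (a - ?P, 0, 0))"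
    by (auto simp: circ_def ame fun_eq_iff mult.commute)
  ultimately show ?thesis by simp
qed

lemma flat_on_tube:
  assumes i: "i \<in> I4" and t: "t i \<noteq> 1"
  shows "flat_on L c (tube i) (\<lambda>w. c (circ i w) / (t i - 1))"
proof -
  have "flat_on (\<lambda>g. L ((\<lambda>w. w) \<circ> g)) (\<lambda>g. c ((\<lambda>w. w) \<circ> g)) (tube i) (\<lambda>w. c (circ i w) / (t i - 1))"
  proof (rule flat_on_loop_family)
    show "continuous_on (tube i \<times> {0..1}) (\<lambda>(w, s). circ i w s)"
      unfolding circ_def case_prod_unfold by (intro continuous_intros)
    show "circ i w s \<in> root_complement" if "w \<in> tube i" for w s
      using circ_in_fibre[OF i that] by simp
  qed (use i t L_circ in \<open>auto simp: circ_def\<close>)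
  then show ?thesis by (simp add: o_def)
qed

text \<open>The meridian through \<open>w\<close> lies in the fibre and has nontrivial monodromy, so
  a flat section over the fibre has to take its fixed point.\<close>

lemma fibre_section_at_tube:
  assumes "flat_on L c (fibre (snd w)) h" "i \<in> I4" "t i \<noteq> 1" "w \<in> tube i"
  shows "h w = c (circ i w) / (t i - 1)"
proof -
  have "path_image (circ i w) \<subseteq> fibre (snd w)"
    using circ_in_fibre[OF assms(2,4)] by (auto simp: path_image_def)
  then have "c (circ i w) = (L (circ i w) - 1) * h (pathstart (circ i w))"
    by (intro flat_loop[OF assms(1) path_circ]) (auto simp: circ_def pathstart_def pathfinish_def)
  moreover have "pathstart (circ i w) = w" by (simp add: circ_def pathstart_def)
  ultimately show ?thesis using assms L_circ by simp
qed

text \<open>Close to puncture 3 the value is forced by the meridian of plane 3, and the fibre is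
  connected.\<close>

lemma fibre_section_unique:
  assumes "flat_on L c (fibre \<beta>) h" "flat_on L c (fibre \<beta>) k" "t 3 \<noteq> 1" "w \<in> fibre \<beta>"
  shows "h w = k w"
proof -
  have "(fst w, \<beta>) \<in> root_complement" using assms(4) by auto
  then have b: "\<beta> \<in> base" unfolding root_complement_fibre by blast
  let ?D = "(\<lambda>j. norm (punct j \<beta> - punct 3 \<beta>)) ` (I4 - {3})"
  have "0 < Min ?D"
  proof (subst Min_gr_iff)
    show "\<forall>a\<in>?D. 0 < a" using b by (auto simp: base_iff)
  qed auto
  then obtain d where d: "0 < d" "d < Min ?D" using dense by blast
  define w3 where "w3 = (punct 3 \<beta> + of_real d, \<beta>)"
  have "d < x" if "x \<in> ?D" for x using d(2) that by (subst (asm) Min_gr_iff) auto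
  then have w3: "w3 \<in> tube 3" using d(1) b by (auto simp: w3_def tube_def)
  have snd: "snd w3 = \<beta>" by (simp add: w3_def)
  have "h w3 = k w3"
    using fibre_section_at_tube[of w3 h 3] fibre_section_at_tube[of w3 k 3] assms w3 snd by simp
  moreover have "w3 \<in> fibre \<beta>" using w3 tube_subset[of 3] snd by auto
  ultimately show ?thesis
    using flat_on_unique[OF assms(1,2) path_connected_fibre _ _ _ assms(4)] by blast
qed

text \<open>A flat section over one fibre is carried to nearby fibres along the segments of the base.\<close>

lemma product_section:
  assumes h1: "flat_on L c (fibre \<beta>1) h1" and V: "convex V" "\<beta>1 \<in> V" and sub: "A \<times> V \<subseteq> root_complement"
  defines "\<gamma> \<equiv> \<lambda>(w::c3) u. (fst w, \<beta>1 + u *\<^sub>R (snd w - \<beta>1))"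
  defines "h \<equiv> \<lambda>w. (c (\<gamma> w) + h1 (fst w, \<beta>1)) / L (\<gamma> w)"
  shows "flat_on L c (A \<times> V) h"
proof (rule flat_onI)
  fix g assume g: "path g" "path_image g \<subseteq> A \<times> V"
  have seg: "\<beta>1 + u *\<^sub>R (\<beta> - \<beta>1) \<in> V" if "\<beta> \<in> V" "u \<in> {0..1}" for \<beta> u
  proof -
    have "(1 - u) *\<^sub>R \<beta>1 + u *\<^sub>R \<beta> \<in> V" using V that by (intro convexD) auto
    then show ?thesis by (simp add: algebra_simps)
  qed
  have gA: "g s \<in> A \<times> V" if "s \<in> {0..1}" for s using g that by (auto simp: path_image_def)
  have cg: "continuous_on {0..1} g" using g by (simp add: path_def)
  \<comment> \<open>A square with top \<open>g\<close> and bottom in the fibre over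
    \<open>\<beta>1\<close>, where \<open>h1\<close> is flat; the vertical sides are the transport
    paths that enter the definition of \<open>h\<close>.\<close>
  define H where "H = (\<lambda>(s,u). \<gamma> (g s) u)"
  have cH: "continuous_on ({0..1} \<times> {0..1}) H"
    unfolding H_def \<gamma>_def case_prod_unfold
    by (intro continuous_intros continuous_on_compose2[OF cg]) auto
  have HA: "H (s,u) \<in> A \<times> V" if "s \<in> {0..1}" "u \<in> {0..1}" for s u
    using gA[OF that(1)] seg[OF _ that(2)] by (auto simp: H_def \<gamma>_def mem_Times_iff)
  then have HS: "H ` ({0..1} \<times> {0..1}) \<subseteq> root_complement" using sub by blast
  have top: "(\<lambda>s. H (s,1)) = g" by (auto simp: H_def \<gamma>_def)
  have lr: "(\<lambda>u. H (0,u)) = \<gamma> (pathstart g)" "(\<lambda>u. H (1,u)) = \<gamma> (pathfinish g)"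
    by (auto simp: H_def pathstart_def pathfinish_def)
  let ?b = "\<lambda>s. H (s,0)"
  have "path ?b"
    unfolding path_def by (rule continuous_on_compose2[OF cH]) (auto intro!: continuous_intros)
  moreover have "path_image ?b \<subseteq> fibre \<beta>1"
    using HA sub by (force simp: path_image_def H_def \<gamma>_def)
  ultimately have cb: "c ?b = L ?b * h1 (fst (pathfinish g), \<beta>1) - h1 (fst (pathstart g), \<beta>1)"
    using flat_onD[OF h1] by (simp add: pathstart_def pathfinish_def H_def \<gamma>_def)
  have nz: "L (\<gamma> w) \<noteq> 0" if "w \<in> A \<times> V" for w
  proof (rule L_nonzero)
    show "path (\<gamma> w)" unfolding \<gamma>_def path_def by (intro continuous_intros)
    show "path_image (\<gamma> w) \<subseteq> root_complement"
      using seg that sub by (force simp: path_image_def \<gamma>_def)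
  qed
  have ends: "pathstart g \<in> A \<times> V" "pathfinish g \<in> A \<times> V" using g(2) pathstart_in_path_image pathfinish_in_path_image by blast+
  note nz[OF ends(1)] nz[OF ends(2)]
  moreover note sq = square(1,2)[OF cH HS, unfolded top lr]
  ultimately show "c g = L g * h (pathfinish g) - h (pathstart g)"
  proof -
    assume n: "L (\<gamma> (pathstart g)) \<noteq> 0" "L (\<gamma> (pathfinish g)) \<noteq> 0"
    have h: "L (\<gamma> w) * h w = c (\<gamma> w) + h1 (fst w, \<beta>1)" if "L (\<gamma> w) \<noteq> 0" for w
      using that by (simp add: h_def)
    have "L (\<gamma> (pathstart g)) * c g = c ?b + L ?b * c (\<gamma> (pathfinish g)) - c (\<gamma> (pathstart g))"
      using sq(2) by (simp add: algebra_simps)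
    also have "\<dots> = L ?b * (L (\<gamma> (pathfinish g)) * h (pathfinish g)) - L (\<gamma> (pathstart g)) * h (pathstart g)"
      unfolding h[OF n(1)] h[OF n(2)] cb by (simp add: algebra_simps)
    also have "\<dots> = L (\<gamma> (pathstart g)) * (L g * h (pathfinish g) - h (pathstart g))"
      using arg_cong[OF sq(1), of "\<lambda>x. x * h (pathfinish g)"] by (simp add: right_diff_distrib mult.assoc)
    finally show ?thesis using n(1) by simp
  qed
qed

text \<open>Over a small ball the punctures hardly move. Away from them the family of fibres
  contains a product, along which the given section is transported. Near them the fixed points of
  the meridians are used, and these are what any section over a fibre has to be there.\<close>

lemma local_propagation:
  assumes t: "\<And>i. i \<in> I4 \<Longrightarrow> t i \<noteq> 1" and \<beta>0: "\<beta>0 \<in> base"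
  obtains V where "open V" "\<beta>0 \<in> V"
    "\<And>\<beta>1 h1. \<beta>1 \<in> V \<Longrightarrow> flat_on L c (fibre \<beta>1) h1 \<Longrightarrow> \<exists>h. flat_on L c {w \<in> root_complement. snd w \<in> V} h"
proof -
  let ?D = "(\<lambda>(i, j). norm (punct i \<beta>0 - punct j \<beta>0)) ` {(i, j) \<in> I4 \<times> I4. i \<noteq> j}"
  have fin: "finite ?D" by (rule finite_imageI, rule finite_subset[of _ "I4 \<times> I4"]) auto
  have "(1, 2) \<in> {(i, j) \<in> I4 \<times> I4. i \<noteq> j}" by simp
  then have "?D \<noteq> {}" by blast
  then have Min: "0 < Min ?D" using \<beta>0 fin by (subst Min_gr_iff) (auto simp: base_iff)
  define \<delta> where "\<delta> = Min ?D"
  have \<delta>: "0 < \<delta>" "\<And>i j. i \<in> I4 \<Longrightarrow> j \<in> I4 \<Longrightarrow> i \<noteq> j \<Longrightarrow> \<delta> \<le> norm (punct i \<beta>0 - punct j \<beta>0)"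
  proof -
    show "0 < \<delta>" using Min by (simp add: \<delta>_def)
    fix i j assume "i \<in> I4" "j \<in> I4" "i \<noteq> j"
    then have "(i, j) \<in> {(i, j) \<in> I4 \<times> I4. i \<noteq> j}" by blast
    then have "(\<lambda>(i, j). norm (punct i \<beta>0 - punct j \<beta>0)) (i, j) \<in> ?D" by (rule imageI)
    then show "\<delta> \<le> norm (punct i \<beta>0 - punct j \<beta>0)" unfolding \<delta>_def using Min_le[OF fin] by simp
  qed
  \<comment> \<open>Here \<open>\<delta>\<close> is the least distance of two punctures over
    \<open>\<beta>0\<close>. Over \<open>V\<close> each puncture moves by less than
    \<open>\<delta>/16\<close>, so distances stay above \<open>7/8 * \<delta>\<close>.\<close>
  define V where "V = ball \<beta>0 (\<delta>/16)"
  have near: "norm (punct i \<beta> - punct i \<beta>0) < \<delta>/16" if "\<beta> \<in> V" for i \<beta>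
    using norm_punct_diff[of i \<beta> \<beta>0] that by (simp add: V_def dist_commute)
  have far: "7/8 * \<delta> < norm (punct i \<beta> - punct j \<beta>)" if "\<beta> \<in> V" "i \<in> I4" "j \<in> I4" "i \<noteq> j" for i j \<beta>
  proof -
    have "\<delta> \<le> norm (punct i \<beta>0 - punct j \<beta>0)" using \<delta>(2) that by blast
    also have "\<dots> = norm ((punct i \<beta> - punct j \<beta>) - (punct i \<beta> - punct i \<beta>0) + (punct j \<beta> - punct j \<beta>0))"
      by (simp add: algebra_simps)
    also have "\<dots> \<le> norm (punct i \<beta> - punct j \<beta>) + norm (punct i \<beta> - punct i \<beta>0) + norm (punct j \<beta> - punct j \<beta>0)"
      by (metis (no_types) add_mono norm_triangle_ineq norm_triangle_ineq4 order.refl order_trans)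
    finally show ?thesis using near[OF that(1), of i] near[OF that(1), of j] by simp
  qed
  have Vb: "\<beta> \<in> base" if "\<beta> \<in> V" for \<beta>
    unfolding base_iff using far[OF that] \<delta>(1) by (metis diff_self mult_pos_pos norm_zero not_less_iff_gr_or_eq zero_less_divide_iff zero_less_numeral)
  have tube: "(a, \<beta>) \<in> tube i" if "\<beta> \<in> V" "i \<in> I4" "a \<noteq> punct i \<beta>" "norm (a - punct i \<beta>) < \<delta>/2" for a \<beta> i
  proof -
    have "norm (a - punct i \<beta>) < norm (punct j \<beta> - punct i \<beta>)" if j: "j \<in> I4 - {i}" for j
    proof -
      have "7/8 * \<delta> < norm (punct j \<beta> - punct i \<beta>)" using far[of \<beta> j i] that \<open>\<beta> \<in> V\<close> \<open>i \<in> I4\<close> by blast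
      then show ?thesis using \<open>norm (a - punct i \<beta>) < \<delta>/2\<close> \<delta>(1) by linarith
    qed
    then show ?thesis using that Vb by (auto simp: tube_def)
  qed
  \<comment> \<open>The radius \<open>\<delta>/8\<close> exceeds the motion
    \<open>\<delta>/16\<close>, so \<open>A \<times> V\<close> misses the punctures. A point outside
    \<open>A\<close> is within \<open>3/16 * \<delta>\<close> of a moving puncture, hence within the
    radius \<open>\<delta>/4\<close> used for the meridians.\<close>
  define A where "A = {a. \<forall>i\<in>I4. \<delta>/8 < norm (a - punct i \<beta>0)}"
  have opA: "open A"
    unfolding A_def by (simp add: Collect_conj_eq, intro open_Int open_Collect_less continuous_intros)
  have away: "\<delta>/16 < norm (a - punct i \<beta>)" if "a \<in> A" "\<beta> \<in> V" "i \<in> I4" for a \<beta> i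
  proof -
    have "\<delta>/8 < norm (a - punct i \<beta>0)" using that unfolding A_def by blast
    also have "\<dots> = norm ((a - punct i \<beta>) + (punct i \<beta> - punct i \<beta>0))" by simp
    also have "\<dots> \<le> norm (a - punct i \<beta>) + norm (punct i \<beta> - punct i \<beta>0)" by (rule norm_triangle_ineq)
    finally show ?thesis using near[OF that(2), of i] by simp
  qed
  have AV: "A \<times> V \<subseteq> root_complement"
  proof clarify
    fix a m e assume *: "a \<in> A" "(m, e) \<in> V"
    then have "a \<noteq> punct i (m, e)" if "i \<in> I4" for i using away[OF * that] \<delta>(1) by auto
    then show "(a, m, e) \<in> root_complement" using Vb[OF *(2)] by (simp add: root_complement_fibre)
  qed
  have "\<exists>h. flat_on L c {w \<in> root_complement. snd w \<in> V} h"
    if \<beta>1: "\<beta>1 \<in> V" and h1: "flat_on L c (fibre \<beta>1) h1" for \<beta>1 h1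
  proof -
    define \<gamma> where "\<gamma> = (\<lambda>(w::c3) u. (fst w, \<beta>1 + u *\<^sub>R (snd w - \<beta>1)))"
    define hO where "hO w = (c (\<gamma> w) + h1 (fst w, \<beta>1)) / L (\<gamma> w)" for w
    have cvV: "convex V" by (simp add: V_def)
    have flatO: "flat_on L c (A \<times> V) hO"
      using product_section[OF h1 cvV \<beta>1 AV] unfolding hO_def \<gamma>_def .
    define k where "k i w = c (circ i w) / (t i - 1)" for i w
    have flatT: "flat_on L c (tube i) (k i)" if "i \<in> I4" for i
      unfolding k_def using that t by (intro flat_on_tube) auto
    have seg: "\<beta>1 + u *\<^sub>R (\<beta> - \<beta>1) \<in> V" if "\<beta> \<in> V" "u \<in> {0..1}" for \<beta> u
    proof -
      have "(1 - u) *\<^sub>R \<beta>1 + u *\<^sub>R \<beta> \<in> V" using cvV \<beta>1 that by (intro convexD) auto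
      then show ?thesis by (simp add: algebra_simps)
    qed
    \<comment> \<open>The transport path from \<open>(a, \<beta>1)\<close> to
      \<open>(a, \<beta>)\<close> stays in the tube, where the fixed points are flat; at
      \<open>\<beta>1\<close> the given section is already the fixed point.\<close>
    have agree: "hO (a, \<beta>) = k i (a, \<beta>)" if a: "a \<in> A" "\<beta> \<in> V" "i \<in> I4" "norm (a - punct i \<beta>) < \<delta>/4" for a \<beta> i
    proof -
      have inT: "(a, \<beta>') \<in> tube i" if \<beta>': "\<beta>' \<in> V" for \<beta>'
      proof (rule tube[OF \<beta>' a(3)])
        show "a \<noteq> punct i \<beta>'" using away[OF a(1) \<beta>' a(3)] \<delta>(1) by auto
        have "norm (a - punct i \<beta>') = norm ((a - punct i \<beta>) + (punct i \<beta> - punct i \<beta>0) - (punct i \<beta>' - punct i \<beta>0))"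
          by (simp add: algebra_simps)
        also have "\<dots> \<le> norm (a - punct i \<beta>) + norm (punct i \<beta> - punct i \<beta>0) + norm (punct i \<beta>' - punct i \<beta>0)"
          by (metis (no_types) add_mono norm_triangle_ineq norm_triangle_ineq4 order.refl order_trans)
        finally show "norm (a - punct i \<beta>') < \<delta>/2"
          using a(4) near[OF a(2), of i] near[OF \<beta>', of i] \<delta>(1) by linarith
      qed
      have pi: "path_image (\<gamma> (a, \<beta>)) \<subseteq> tube i"
        using inT[OF seg[OF a(2)]] by (auto simp: path_image_def \<gamma>_def)
      have p: "path (\<gamma> (a, \<beta>))" unfolding \<gamma>_def path_def by (intro continuous_intros)
      have "c (\<gamma> (a, \<beta>)) = L (\<gamma> (a, \<beta>)) * k i (a, \<beta>) - k i (a, \<beta>1)"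
        using flat_onD[OF flatT[OF a(3)] p pi] by (simp add: \<gamma>_def pathstart_def pathfinish_def)
      moreover have "h1 (a, \<beta>1) = k i (a, \<beta>1)"
        unfolding k_def by (rule fibre_section_at_tube) (use h1 a t inT[OF \<beta>1] in auto)
      moreover have "L (\<gamma> (a, \<beta>)) \<noteq> 0"
        using p pi tube_subset[OF a(3)] by (intro L_nonzero) auto
      ultimately show ?thesis by (simp add: hO_def)
    qed
    define near_i where "near_i i w \<longleftrightarrow> i \<in> I4 \<and> norm (fst w - punct i (snd w)) < \<delta>/4" for i :: 8 and w :: c3
    have near_unique: "i = j" if "near_i i w" "near_i j w" "snd w \<in> V" for i j w
    proof (rule ccontr)
      assume "i \<noteq> j"
      then have "7/8 * \<delta> < norm (punct i (snd w) - punct j (snd w))" using far that by (auto simp: near_i_def)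
      also have "\<dots> = norm ((fst w - punct j (snd w)) - (fst w - punct i (snd w)))" by (simp add: algebra_simps)
      also have "\<dots> \<le> norm (fst w - punct j (snd w)) + norm (fst w - punct i (snd w))" by (rule norm_triangle_ineq4)
      finally show False using that \<delta>(1) by (auto simp: near_i_def)
    qed
    define h where "h w = (if \<exists>i. near_i i w then k (THE i. near_i i w) w else hO w)" for w
    have hk: "h w = k i w" if "near_i i w" "snd w \<in> V" for i w
    proof -
      have "(THE i. near_i i w) = i" using that near_unique by blast
      then show ?thesis using that by (auto simp: h_def)
    qed
    let ?W = "{w \<in> root_complement. snd w \<in> V}"
    have "flat_on L c ?W h"
    proof (rule flat_on_local)
      fix w assume w: "w \<in> ?W"
      show "\<exists>Y. open Y \<and> w \<in> Y \<and> flat_on L c (?W \<inter> Y) h"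
      proof (cases "fst w \<in> A")
        case True
        have "flat_on L c (A \<times> V) h"
        proof (rule flat_on_cong[OF flatO])
          fix v assume v: "v \<in> A \<times> V"
          show "h v = hO v"
          proof (cases "\<exists>i. near_i i v")
            case True
            then obtain i where i: "near_i i v" ..
            then have "h v = k i v" using hk v by auto
            also have "\<dots> = hO v" using agree[of "fst v" "snd v" i] i v by (auto simp: near_i_def)
            finally show ?thesis .
          qed (simp add: h_def)
        qed
        then have "flat_on L c (?W \<inter> (A \<times> V)) h" by (rule flat_on_mono) auto
        moreover have "open (A \<times> V)" using opA by (simp add: open_Times V_def)
        ultimately show ?thesis using True w by (intro exI[of _ "A \<times> V"]) (auto simp: mem_Times_iff)
      next
        case False
        then obtain i where i: "i \<in> I4" "norm (fst w - punct i \<beta>0) \<le> \<delta>/8" by (force simp: A_def not_less)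
        let ?Y = "{v. norm (fst v - punct i (snd v)) < \<delta>/4} \<inter> {v. snd v \<in> V}"
        have "norm (fst w - punct i (snd w)) \<le> norm (fst w - punct i \<beta>0) + norm (punct i (snd w) - punct i \<beta>0)"
          using norm_triangle_ineq4[of "fst w - punct i \<beta>0" "punct i (snd w) - punct i \<beta>0"] by simp
        then have "w \<in> ?Y" using i near[of "snd w" i] w \<delta>(1) by auto
        moreover have "open ?Y"
        proof (rule open_Int)
          show "open {v::c3. norm (fst v - punct i (snd v)) < \<delta>/4}"
            by (intro open_Collect_less continuous_intros)
          have "open (snd -` V :: c3 set)" by (rule open_vimage) (auto simp: V_def intro!: continuous_intros)
          then show "open {v::c3. snd v \<in> V}" by (simp add: vimage_def)
        qed
        moreover have "flat_on L c (?W \<inter> ?Y) h"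
        proof (rule flat_on_cong[OF flat_on_mono[OF flatT[OF i(1)]]])
          show "?W \<inter> ?Y \<subseteq> tube i"
          proof
            fix v assume v: "v \<in> ?W \<inter> ?Y"
            then have "fst v \<noteq> punct i (snd v)" using i root_complement_fibre[of "fst v" "snd v"] by auto
            then show "v \<in> tube i" using tube[of "snd v" i "fst v"] v i \<delta>(1) by auto
          qed
          show "h v = k i v" if "v \<in> ?W \<inter> ?Y" for v
            using that i by (intro hk) (auto simp: near_i_def)
        qed
        ultimately show ?thesis by blast
      qed
    qed auto
    then show ?thesis by blast
  qed
  then show thesis using that[of V] \<delta>(1) by (simp add: V_def)
qed

text \<open>In the coordinates \<open>(m / e, e)\<close> the base is a product of punctured
  lines.\<close>

lemma connected_base: "connected base"
proof -
  let ?f = "\<lambda>(\<zeta>, e). (\<zeta> * e, e :: complex)"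
  have "connected (UNIV - T)" if "finite T" for T :: "complex set"
    using that by (intro path_connected_imp_connected path_connected_diff_finite) auto
  from this[of "{0, 1, - 1}"] this[of "{0}"]
  have "connected (UNIV - {0, 1, - 1 :: complex})" "connected (UNIV - {0::complex})" by simp_all
  then have "connected ((UNIV - {0, 1, - 1 :: complex}) \<times> (UNIV - {0 :: complex}))" by (rule connected_Times)
  moreover have "continuous_on S ?f" for S
    unfolding case_prod_unfold by (intro continuous_intros)
  ultimately have "connected (?f ` ((UNIV - {0, 1, - 1}) \<times> (UNIV - {0})))"
    using connected_continuous_image by blast
  also have "?f ` ((UNIV - {0, 1, - 1}) \<times> (UNIV - {0})) = base"
  proof (intro equalityI subsetI)
    fix \<beta> assume \<beta>: "\<beta> \<in> base"
    then have e: "snd \<beta> \<noteq> 0" by (simp add: base_def)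
    have "fst \<beta> / snd \<beta> \<noteq> -1" using \<beta> e by (auto simp: base_def divide_eq_eq)
    then have "(fst \<beta> / snd \<beta>, snd \<beta>) \<in> (UNIV - {0, 1, - 1}) \<times> (UNIV - {0})"
      using \<beta> by (auto simp: base_def)
    moreover have "\<beta> = ?f (fst \<beta> / snd \<beta>, snd \<beta>)" using e by (simp add: prod_eq_iff)
    ultimately show "\<beta> \<in> ?f ` ((UNIV - {0, 1, - 1}) \<times> (UNIV - {0}))" by blast
  next
    fix \<beta> assume "\<beta> \<in> ?f ` ((UNIV - {0, 1, - 1}) \<times> (UNIV - {0}))"
    then obtain \<zeta> e where *: "\<beta> = (\<zeta> * e, e)" "\<zeta> \<noteq> 0" "\<zeta> \<noteq> 1" "\<zeta> \<noteq> -1" "e \<noteq> 0" by auto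
    have "\<zeta> * e \<noteq> - e"
    proof
      assume "\<zeta> * e = - e"
      then have "\<zeta> * e = (-1) * e" by simp
      then show False using * by (metis mult_right_cancel)
    qed
    then show "\<beta> \<in> base" using * by (simp add: base_def)
  qed
  finally show ?thesis .
qed

text \<open>The existence of a section over the fibre is locally constant on the connected base.
  Sections over single fibres are unique, so they agree with the local ones and form one flat
  section.\<close>

theorem propagation:
  assumes t: "\<And>i. i \<in> I4 \<Longrightarrow> t i \<noteq> 1" and \<beta>0: "\<beta>0 \<in> base" "flat_on L c (fibre \<beta>0) h0"
  shows "\<exists>h. flat_on L c root_complement h"
proof -
  have good: "\<exists>h. flat_on L c (fibre \<beta>) h" if \<beta>: "\<beta> \<in> base" for \<beta>
  proof (rule connected_induction_simple[OF connected_base, where P="\<lambda>\<beta>. \<exists>h. flat_on L c (fibre \<beta>) h" and a=\<beta>0])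
    fix \<alpha> assume "\<alpha> \<in> base"
    with t obtain V where V: "open V" "\<alpha> \<in> V"
      "\<And>\<beta>1 h1. \<beta>1 \<in> V \<Longrightarrow> flat_on L c (fibre \<beta>1) h1 \<Longrightarrow> \<exists>h. flat_on L c {w \<in> root_complement. snd w \<in> V} h"
      using local_propagation by blast
    show "\<exists>T. openin (top_of_set base) T \<and> \<alpha> \<in> T \<and>
        (\<forall>x\<in>T. \<forall>y\<in>T. (\<exists>h. flat_on L c (fibre x) h) \<longrightarrow> (\<exists>h. flat_on L c (fibre y) h))"
    proof (intro exI[of _ "base \<inter> V"] conjI ballI impI)
      fix x y assume "x \<in> base \<inter> V" "y \<in> base \<inter> V" "\<exists>h. flat_on L c (fibre x) h"
      then obtain h where "flat_on L c {w \<in> root_complement. snd w \<in> V} h" using V(3) by blast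
      then have "flat_on L c (fibre y) h" by (rule flat_on_mono) (use \<open>y \<in> base \<inter> V\<close> in auto)
      then show "\<exists>h. flat_on L c (fibre y) h" by blast
    qed (use V \<open>\<alpha> \<in> base\<close> in \<open>auto simp: openin_open_Int\<close>)
  qed (use \<beta>0 \<beta> in auto)
  then obtain H where H: "\<And>\<beta>. \<beta> \<in> base \<Longrightarrow> flat_on L c (fibre \<beta>) (H \<beta>)" by metis
  have "flat_on L c root_complement (\<lambda>w. H (snd w) w)"
  proof (rule flat_on_local)
    fix w assume "w \<in> root_complement"
    then have b: "snd w \<in> base" using root_complement_fibre[of "fst w" "snd w"] by simp
    with t obtain V where V: "open V" "snd w \<in> V"
      "\<And>\<beta>1 h1. \<beta>1 \<in> V \<Longrightarrow> flat_on L c (fibre \<beta>1) h1 \<Longrightarrow> \<exists>h. flat_on L c {w \<in> root_complement. snd w \<in> V} h"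
      using local_propagation by blast
    obtain h where h: "flat_on L c {w \<in> root_complement. snd w \<in> V} h" using V(3)[OF V(2) H[OF b]] by blast
    have "flat_on L c (root_complement \<inter> {v. snd v \<in> V}) (\<lambda>w. H (snd w) w)"
    proof (rule flat_on_cong[OF flat_on_mono[OF h]])
      fix v assume v: "v \<in> root_complement \<inter> {v. snd v \<in> V}"
      then have bv: "snd v \<in> base" using root_complement_fibre[of "fst v" "snd v"] by simp
      have "flat_on L c (fibre (snd v)) h" by (rule flat_on_mono[OF h]) (use v in auto)
      from fibre_section_unique[OF H[OF bv] this] show "H (snd v) v = h v" using v t by auto
    qed auto
    moreover have "open (snd -` V :: c3 set)" by (rule open_vimage) (auto simp: V intro!: continuous_intros)
    ultimately show "\<exists>Y. open Y \<and> w \<in> Y \<and> flat_on L c (root_complement \<inter> Y) (\<lambda>w. H (snd w) w)"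
      using V by (intro exI[of _ "snd -` V"]) (auto simp: vimage_def)
  qed auto
  then show ?thesis by blast
qed

end

section \<open>The upper bound\<close>

lemma (in meridional_transport) monodromy_of_nonflat:
  assumes t: "\<And>i. t i \<noteq> 1" and nf: "\<nexists>h. flat_on L c root_complement h"
  shows "(\<Prod>i\<in>UNIV. t i) = 1" "t 1 * t 4 * t 7 = 1" "t 1 * t 3 * t 6 = 1"
proof -
  have "\<nexists>h. flat_on (\<lambda>g. L (to_fibre \<circ> g)) (\<lambda>g. c (to_fibre \<circ> g)) fibre31 h"
  proof
    assume "\<exists>h. flat_on (\<lambda>g. L (to_fibre \<circ> g)) (\<lambda>g. c (to_fibre \<circ> g)) fibre31 h"
    then obtain h where h: "flat_on (\<lambda>g. L (to_fibre \<circ> g)) (\<lambda>g. c (to_fibre \<circ> g)) fibre31 h" ..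
    have "flat_on L c (fibre (3, 1)) (\<lambda>w. h (fst w))"
    proof (rule flat_onI)
      fix g assume g: "path g" "path_image g \<subseteq> fibre (3, 1)"
      have gs: "g s = to_fibre (fst (g s))" "fst (g s) \<in> fibre31" if "s \<in> {0..1}" for s
      proof -
        have "g s \<in> fibre (3, 1)" using g(2) that unfolding path_image_def by blast
        then show "g s = to_fibre (fst (g s))" "fst (g s) \<in> fibre31"
          by (cases "g s"; auto simp: root_complement_iff fibre31_def eq_neg_iff_add_eq_0)+
      qed
      have "homotopic_paths root_complement g (to_fibre \<circ> (fst \<circ> g))"
        by (rule homotopic_paths_eq) (use g gs in auto)
      then have e: "L g = L (to_fibre \<circ> (fst \<circ> g))" "c g = c (to_fibre \<circ> (fst \<circ> g))"
        by (rule L_homotopic, rule c_homotopic)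
      have "path (fst \<circ> g)" using g(1) by (intro path_continuous_image continuous_intros)
      moreover have "path_image (fst \<circ> g) \<subseteq> fibre31" using gs by (auto simp: path_image_def)
      ultimately have "c (to_fibre \<circ> (fst \<circ> g)) = L (to_fibre \<circ> (fst \<circ> g)) * h (pathfinish (fst \<circ> g)) - h (pathstart (fst \<circ> g))"
        using flat_onD[OF h] by blast
      then show "c g = L g * h (fst (pathfinish g)) - h (fst (pathstart g))"
        unfolding e by (simp add: pathfinish_def pathstart_def)
    qed
    moreover have "(3, 1) \<in> base" by (simp add: base_def)
    ultimately show False using propagation t nf by blast
  qed
  then show "(\<Prod>i\<in>UNIV. t i) = 1" "t 1 * t 4 * t 7 = 1" "t 1 * t 3 * t 6 = 1"
    using fibre_section_scaling fibre_section_147[OF t] fibre_section_136[OF t t] by blast+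
qed

text \<open>Nonvanishing of the first cohomology as a property of the character alone, on which
  symmetries of the arrangement can act.\<close>

definition obstructed :: "(8 \<Rightarrow> complex) \<Rightarrow> bool" where
  "obstructed t \<longleftrightarrow> (\<exists>L c. affine_transport root_complement L c \<and> meridional t L \<and>
     (\<nexists>h. flat_on L c root_complement h))"

lemma obstructed_relations:
  assumes "obstructed t" "\<And>i. t i \<noteq> 0" "\<And>i. t i \<noteq> 1"
  shows "(\<Prod>i\<in>UNIV. t i) = 1" "t 1 * t 4 * t 7 = 1" "t 1 * t 3 * t 6 = 1"
proof -
  obtain L c where "affine_transport root_complement L c" "meridional t L"
    and nf: "\<nexists>h. flat_on L c root_complement h"
    using assms(1) unfolding obstructed_def by blast
  then interpret meridional_transport L c t
    using assms(2) by (simp add: meridional_transport_def meridional_transport_axioms_def)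
  show "(\<Prod>i\<in>UNIV. t i) = 1" "t 1 * t 4 * t 7 = 1" "t 1 * t 3 * t 6 = 1"
    using monodromy_of_nonflat[OF assms(3) nf] by auto
qed

text \<open>Everything is pulled back along the involution \<open>A\<close>. Only the zero sets of
  the forms matter, since a meridian is determined by planes and not by their equations.\<close>

lemma obstructed_symmetry:
  assumes obs: "obstructed t"
    and lin: "\<And>p z v. A (p + csmul z v) = A p + csmul z (A v)" and cont: "continuous_on UNIV A"
    and inv: "\<And>w. A (A w) = w" "\<And>i. \<pi> (\<pi> i) = i"
    and forms: "\<And>i w. root_form i (A w) = 0 \<longleftrightarrow> root_form (\<pi> i) w = 0"
  shows "obstructed (t \<circ> \<pi>)"
proof -
  obtain L c where *: "affine_transport root_complement L c" "meridional t L"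
    and nf: "\<nexists>h. flat_on L c root_complement h"
    using obs unfolding obstructed_def by blast
  interpret affine_transport root_complement L c by fact
  have rc: "A w \<in> root_complement \<longleftrightarrow> w \<in> root_complement" for w
    unfolding root_complement_def using forms inv(2) by (auto; metis)
  have cA: "continuous_on S A" for S using cont by (rule continuous_on_subset) auto
  let ?L = "\<lambda>g. L (A \<circ> g)" and ?c = "\<lambda>g. c (A \<circ> g)"
  have aff: "affine_transport root_complement ?L ?c"
    by (rule pullback[OF cA]) (auto simp: rc)
  have mer: "meridional (t \<circ> \<pi>) ?L"
    unfolding meridional_def
  proof (intro allI impI)
    fix i p v
    assume a: "root_form i p = 0 \<and> (\<forall>j. j \<noteq> i \<longrightarrow> root_form j p \<noteq> 0) \<and>
      (\<forall>z. z \<noteq> 0 \<and> norm z \<le> 1 \<longrightarrow> p + csmul z v \<in> root_complement)"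
    have "L (\<lambda>s. A p + csmul (rot s) (A v)) = t (\<pi> i)"
    proof (rule meridionalD[OF *(2)])
      show "root_form (\<pi> i) (A p) = 0" using a by (simp add: forms inv)
      show "root_form j (A p) \<noteq> 0" if "j \<noteq> \<pi> i" for j
        using a that inv(2) by (metis forms)
      show "A p + csmul z (A v) \<in> root_complement" if "z \<noteq> 0" "norm z \<le> 1" for z
        using a that by (simp add: rc flip: lin)
    qed
    then show "?L (\<lambda>s. p + csmul (rot s) v) = (t \<circ> \<pi>) i" by (simp add: o_def lin)
  qed
  have "\<nexists>h. flat_on ?L ?c root_complement h"
  proof
    assume "\<exists>h. flat_on ?L ?c root_complement h"
    then obtain h where h: "flat_on ?L ?c root_complement h" ..
    have "flat_on (\<lambda>g. ?L (A \<circ> g)) (\<lambda>g. ?c (A \<circ> g)) root_complement (h \<circ> A)"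
      by (rule affine_transport.flat_on_pullback[OF aff h cA]) (auto simp: rc)
    moreover have "A \<circ> (A \<circ> g) = g" for g :: "real \<Rightarrow> c3" by (simp add: fun_eq_iff inv)
    ultimately show False using nf by auto
  qed
  with aff mer show ?thesis unfolding obstructed_def by blast
qed

text \<open>The permutations induced by the sign changes of \<open>m\<close> and \<open>e\<close>
  and by the exchange of \<open>m\<close> and \<open>e\<close>.\<close>

lemma obstructed_symmetries:
  assumes "obstructed t"
  shows "obstructed (t \<circ> (\<lambda>i. if i = 2 then 3 else if i = 3 then 2 else if i = 6 then 8 else if i = 8 then 6 else i))"
    and "obstructed (t \<circ> (\<lambda>i. if i = 1 then 4 else if i = 4 then 1 else if i = 6 then 8 else if i = 8 then 6 else i))"
    and "obstructed (t \<circ> (\<lambda>i. if i = 1 then 3 else if i = 3 then 1 else if i = 2 then 4 else if i = 4 then 2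
      else if i = 5 then 7 else if i = 7 then 5 else i))"
proof -
  have neg: "- x - y = 0 \<longleftrightarrow> x + y = 0" "- x + y = 0 \<longleftrightarrow> x - y = 0" "- x = y \<longleftrightarrow> x + y = 0"
 for x y :: complex
    by (auto simp: algebra_simps neg_eq_iff_add_eq_0 add_eq_0_iff2)
  show "obstructed (t \<circ> (\<lambda>i. if i = 2 then 3 else if i = 3 then 2 else if i = 6 then 8 else if i = 8 then 6 else i))"
  proof (rule obstructed_symmetry[OF assms, where A="\<lambda>(a, m, e). (a, - m, e)"])
    let ?\<pi> = "(\<lambda>i. if i = 2 then 3 else if i = 3 then 2 else if i = 6 then 8 else if i = 8 then 6 else i) :: 8 \<Rightarrow> 8"
    have "\<forall>i. root_form i ((\<lambda>(a, m, e). (a, - m, e)) (a, m, e)) = 0 \<longleftrightarrow> root_form (?\<pi> i) (a, m, e) = 0" for a m e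
      unfolding forall_8 by (auto simp: neg add.commute)
    then show "root_form i ((\<lambda>(a, m, e). (a, - m, e)) w) = 0 \<longleftrightarrow> root_form (?\<pi> i) w = 0" for i w
      by (metis prod_cases3)
    have "\<forall>i. ?\<pi> (?\<pi> i) = i" unfolding forall_8 by simp
    then show "?\<pi> (?\<pi> i) = i" for i ..
    show "continuous_on UNIV ((\<lambda>(a, m, e). (a, - m, e)) :: c3 \<Rightarrow> c3)" unfolding case_prod_unfold by (intro continuous_intros)
  qed (auto simp: csmul_conv)
  show "obstructed (t \<circ> (\<lambda>i. if i = 1 then 4 else if i = 4 then 1 else if i = 6 then 8 else if i = 8 then 6 else i))"
  proof (rule obstructed_symmetry[OF assms, where A="\<lambda>(a, m, e). (a, m, - e)"])
    let ?\<pi> = "(\<lambda>i. if i = 1 then 4 else if i = 4 then 1 else if i = 6 then 8 else if i = 8 then 6 else i) :: 8 \<Rightarrow> 8"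
    have "\<forall>i. root_form i ((\<lambda>(a, m, e). (a, m, - e)) (a, m, e)) = 0 \<longleftrightarrow> root_form (?\<pi> i) (a, m, e) = 0" for a m e
      unfolding forall_8 by (auto simp: neg add.commute)
    then show "root_form i ((\<lambda>(a, m, e). (a, m, - e)) w) = 0 \<longleftrightarrow> root_form (?\<pi> i) w = 0" for i w
      by (metis prod_cases3)
    have "\<forall>i. ?\<pi> (?\<pi> i) = i" unfolding forall_8 by simp
    then show "?\<pi> (?\<pi> i) = i" for i ..
    show "continuous_on UNIV ((\<lambda>(a, m, e). (a, m, - e)) :: c3 \<Rightarrow> c3)" unfolding case_prod_unfold by (intro continuous_intros)
  qed (auto simp: csmul_conv)
  show "obstructed (t \<circ> (\<lambda>i. if i = 1 then 3 else if i = 3 then 1 else if i = 2 then 4 else if i = 4 then 2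
      else if i = 5 then 7 else if i = 7 then 5 else i))"
  proof (rule obstructed_symmetry[OF assms, where A="\<lambda>(a, m, e). (a, e, m)"])
    let ?\<pi> = "(\<lambda>i. if i = 1 then 3 else if i = 3 then 1 else if i = 2 then 4 else if i = 4 then 2
      else if i = 5 then 7 else if i = 7 then 5 else i) :: 8 \<Rightarrow> 8"
    have "\<forall>i. root_form i ((\<lambda>(a, m, e). (a, e, m)) (a, m, e)) = 0 \<longleftrightarrow> root_form (?\<pi> i) (a, m, e) = 0" for a m e
      unfolding forall_8 by (auto simp: neg add.commute)
    then show "root_form i ((\<lambda>(a, m, e). (a, e, m)) w) = 0 \<longleftrightarrow> root_form (?\<pi> i) w = 0" for i w
      by (metis prod_cases3)
    have "\<forall>i. ?\<pi> (?\<pi> i) = i" unfolding forall_8 by simp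
    then show "?\<pi> (?\<pi> i) = i" for i ..
    show "continuous_on UNIV ((\<lambda>(a, m, e). (a, e, m)) :: c3 \<Rightarrow> c3)" unfolding case_prod_unfold by (intro continuous_intros)
  qed (auto simp: csmul_conv)
qed

text \<open>The symmetries turn two of the relations into one for each of the six triples of planes
  through a common line that contain two of the planes 1 to 4. The product over all planes, divided
  by those over \<open>{1, 4, 7}\<close> and \<open>{3, 2, 5}\<close>, leaves
  \<open>t 6 * t 8 = 1\<close>. Comparing the other four triples gives
  \<open>(t 6)\<^sup>2 = (t 8)\<^sup>2\<close>.\<close>

lemma obstructed_translated_torus:
  assumes obs: "obstructed t" and t0: "\<And>i. t i \<noteq> 0" and t1: "\<And>i. t i \<noteq> 1" and t6: "(t 6)\<^sup>2 \<noteq> -1"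
  shows "t 2 = - inverse (t 1)" "t 3 = - inverse (t 1)" "t 4 = t 1" "t 5 = (t 1)\<^sup>2" "t 6 = -1"
    "t 7 = inverse ((t 1)\<^sup>2)" "t 8 = -1"
proof -
  note sm = obstructed_symmetries(1) and se = obstructed_symmetries(2) and st = obstructed_symmetries(3)
  have "t 1 * t 4 * t 7 = 1" "t 1 * t 3 * t 6 = 1" and prod: "(\<Prod>i\<in>UNIV. t i) = 1"
    using obstructed_relations[OF obs t0 t1] by auto
  moreover have "t 1 * t 2 * t 8 = 1" using obstructed_relations(3)[OF sm[OF obs]] t0 t1 by simp
  moreover have "t 4 * t 3 * t 8 = 1" using obstructed_relations(3)[OF se[OF obs]] t0 t1 by simp
  moreover have "t 4 * t 2 * t 6 = 1" using obstructed_relations(3)[OF se[OF sm[OF obs]]] t0 t1 by simp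
  moreover have "t 3 * t 2 * t 5 = 1" using obstructed_relations(2)[OF st[OF obs]] t0 t1 by simp
  moreover have "t 1 * t 2 * t 3 * t 4 * t 5 * t 6 * t 7 * t 8 = 1"
    using prod unfolding UNIV_8 by (simp add: mult.assoc)
  ultimately have e: "t 1 * t 4 * t 7 = 1" "t 1 * t 3 * t 6 = 1" "t 1 * t 2 * t 8 = 1"
    "t 4 * t 3 * t 8 = 1" "t 4 * t 2 * t 6 = 1" "t 3 * t 2 * t 5 = 1"
    "t 1 * t 2 * t 3 * t 4 * t 5 * t 6 * t 7 * t 8 = 1" by blast+
  have "(t 1 * t 4 * t 7) * (t 3 * t 2 * t 5) * (t 6 * t 8) = t 1 * t 2 * t 3 * t 4 * t 5 * t 6 * t 7 * t 8"
    by (simp add: mult_ac)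
  then have e68: "t 6 * t 8 = 1" using e by simp
  have "(t 1 * t 3 * t 6) * (t 4 * t 2 * t 6) * (t 8 * t 8) = (t 1 * t 2 * t 8) * (t 4 * t 3 * t 8) * (t 6 * t 6)"
    by (simp add: mult_ac)
  then have "t 8 * t 8 = t 6 * t 6" using e by simp
  then have "(t 6 * t 8) * (t 6 * t 8) = (t 6)\<^sup>2 * (t 6)\<^sup>2" by (simp add: power2_eq_square mult_ac)
  then have "(t 6)\<^sup>2 * (t 6)\<^sup>2 = 1" using e68 by simp
  then have "((t 6)\<^sup>2 - 1) * ((t 6)\<^sup>2 + 1) = 0" by (simp add: algebra_simps)
  then have "(t 6)\<^sup>2 = 1" using t6 by (simp add: eq_neg_iff_add_eq_0)
  then show s6: "t 6 = -1" using t1[of 6] by (simp add: power2_eq_1_iff)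
  then show s8: "t 8 = -1" using e68 by (simp add: minus_equation_iff[of "t 8"])
  have 12: "t 1 * t 2 = -1" using e(3) s8 by (simp add: minus_equation_iff[of "t 1 * t 2"])
  then show s2: "t 2 = - inverse (t 1)" using t0[of 1] by (simp add: field_simps eq_neg_iff_add_eq_0)
  have 13: "t 1 * t 3 = -1" using e(2) s6 by (simp add: minus_equation_iff[of "t 1 * t 3"])
  then show s3: "t 3 = - inverse (t 1)" using t0[of 1] by (simp add: field_simps eq_neg_iff_add_eq_0)
  have "t 4 * t 2 = -1" using e(5) s6 by (simp add: minus_equation_iff[of "t 4 * t 2"])
  then show s4: "t 4 = t 1" using 12 t0[of 2] by (metis mult_right_cancel)
  show "t 7 = inverse ((t 1)\<^sup>2)" using e(1) s4 t0[of 1] by (simp add: field_simps power2_eq_square)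
  show "t 5 = (t 1)\<^sup>2" using e(6) s2 s3 t0[of 1] by (simp add: field_simps power2_eq_square)
qed

subsection \<open>Transfer to the given coordinates\<close>

definition from_roots :: "c3 \<Rightarrow> complex^3" where
  "from_roots w = (\<chi> i. if i = 1 then fst w + fst (snd w) else if i = 2 then fst w - snd (snd w)
     else fst (snd w) - snd (snd w))"

definition to_roots :: "complex^3 \<Rightarrow> c3" where
  "to_roots w = (w $ 1 - (w $ 1 - w $ 2 + w $ 3) / 2, (w $ 1 - w $ 2 + w $ 3) / 2, (w $ 1 - w $ 2 - w $ 3) / 2)"

lemma from_to_roots [simp]: "from_roots (to_roots w) = w"
  by (simp add: from_roots_def to_roots_def vec_eq_iff forall_3 field_simps)

lemma to_from_roots [simp]: "to_roots (from_roots w) = w"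
  by (cases w) (simp add: from_roots_def to_roots_def field_simps)

lemma deleted_B3_forms_from_roots: "deleted_B3_forms (from_roots w) $ i = root_form i w"
proof -
  obtain a m e where w: "w = (a, m, e)" by (metis prod_cases3)
  have "\<forall>i. deleted_B3_forms (from_roots (a, m, e)) $ i = root_form i (a, m, e)"
    unfolding forall_8 by (simp add: deleted_B3_forms_def Let_def from_roots_def)
  then show ?thesis unfolding w ..
qed

lemma root_form_to_roots: "root_form i (to_roots w) = deleted_B3_forms w $ i"
  using deleted_B3_forms_from_roots[of "to_roots w" i] by simp

lemma in_arrangement_complement_iff:
  "w \<in> arrangement_complement deleted_B3 \<longleftrightarrow> to_roots w \<in> root_complement"
  by (simp add: arrangement_complement_def deleted_B3_def root_complement_def root_form_to_roots)

lemma continuous_on_roots: "continuous_on S from_roots" "continuous_on T to_roots"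
proof -
  have "continuous_on S (\<lambda>w :: c3. if i = 1 then fst w + fst (snd w) else if i = 2 then fst w - snd (snd w)
     else fst (snd w) - snd (snd w))" for i :: 3
    by (cases "i = 1"; cases "i = 2") (auto intro!: continuous_intros)
  then show "continuous_on S from_roots" unfolding from_roots_def by (rule continuous_on_vec_lambda)
  show "continuous_on T to_roots" unfolding to_roots_def by (intro continuous_intros) auto
qed

lemma from_roots_linear: "from_roots (p + csmul z v) = from_roots p + z *s from_roots v"
  by (cases p; cases v) (simp add: from_roots_def vec_eq_iff algebra_simps)

lemma to_roots_linear: "to_roots (p + z *s v) = to_roots p + csmul z (to_roots v)"
  using from_roots_linear[of "to_roots p" z "to_roots v"] by (metis from_to_roots to_from_roots)

lemma obstructed_of_characteristic_variety:
  assumes "t \<in> characteristic_variety 1 deleted_B3"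
  shows "obstructed (\<lambda>i. t $ i)"
proof -
  let ?X = "arrangement_complement deleted_B3"
  obtain L where L: "local_system_of_character deleted_B3 t L" "enat 1 \<le> twisted_cohomology_dim 1 ?X L"
    using assms by (auto simp: characteristic_variety_def)
  have r1: "rank_one_local_system ?X L" using L by (simp add: local_system_of_character_def)
  obtain c where c: "affine_transport ?X L c" "\<nexists>h. flat_on L c ?X h"
    using nonflat_transport_of_cohomology[OF r1 L(2)] by blast
  interpret affine_transport ?X L c by fact
  let ?L = "\<lambda>g. L (from_roots \<circ> g)" and ?c = "\<lambda>g. c (from_roots \<circ> g)"
  have aff: "affine_transport root_complement ?L ?c"
    by (rule pullback[OF continuous_on_roots(1)]) (auto simp: in_arrangement_complement_iff)
  have "meridional (\<lambda>i. t $ i) ?L"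
    unfolding meridional_def
  proof (intro allI impI)
    fix i p v
    assume a: "root_form i p = 0 \<and> (\<forall>j. j \<noteq> i \<longrightarrow> root_form j p \<noteq> 0) \<and>
      (\<forall>z. z \<noteq> 0 \<and> norm z \<le> 1 \<longrightarrow> p + csmul z v \<in> root_complement)"
    have "(\<lambda>s. from_roots p + circlepath 0 1 s *s from_roots v) \<in> meridians deleted_B3 i"
      unfolding meridians_def
      by (rule CollectI, rule exI[of _ "from_roots p"], rule exI[of _ "from_roots v"])
        (use a in \<open>auto simp: deleted_B3_def deleted_B3_forms_from_roots in_arrangement_complement_iff to_roots_linear\<close>)
    then have "L (\<lambda>s. from_roots p + circlepath 0 1 s *s from_roots v) = t $ i"
      using L(1) by (auto simp: local_system_of_character_def)
    then show "?L (\<lambda>s. p + csmul (rot s) v) = t $ i"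
      by (simp add: o_def from_roots_linear circlepath_eq_rot)
  qed
  moreover have "\<nexists>h. flat_on ?L ?c root_complement h"
  proof
    assume "\<exists>h. flat_on ?L ?c root_complement h"
    then obtain h where h: "flat_on ?L ?c root_complement h" ..
    have "flat_on (\<lambda>g. ?L (to_roots \<circ> g)) (\<lambda>g. ?c (to_roots \<circ> g)) ?X (h \<circ> to_roots)"
      by (rule affine_transport.flat_on_pullback[OF aff h continuous_on_roots(2)])
        (auto simp: in_arrangement_complement_iff)
    moreover have "from_roots \<circ> (to_roots \<circ> g) = g" for g :: "real \<Rightarrow> complex^3" by (simp add: fun_eq_iff)
    ultimately show False using c(2) by auto
  qed
  ultimately show ?thesis using aff unfolding obstructed_def by blast
qed

lemma local_system_of_character_winding_system:
  fixes t :: "complex^8"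
  assumes "\<And>i. exp (2 * of_real pi * \<i> * \<alpha> i) = t $ i"
  shows "local_system_of_character deleted_B3 t (winding_system (\<lambda>i w. deleted_B3_forms w $ i) \<alpha>)"
  unfolding local_system_of_character_def
proof (intro conjI allI ballI)
  have e: "winding_system (\<lambda>i w. deleted_B3_forms w $ i) \<alpha> g = winding_system root_form \<alpha> (to_roots \<circ> g)" for g
    by (simp add: winding_system_def o_def root_form_to_roots)
  have "continuous_on S (\<lambda>w. root_form i (to_roots w))" for S i
    by (rule continuous_on_compose2[OF continuous_on_root_form[of UNIV] continuous_on_roots(2)]) auto
  then show "rank_one_local_system (arrangement_complement deleted_B3) (winding_system (\<lambda>i w. deleted_B3_forms w $ i) \<alpha>)"
    by (intro winding_system) (auto simp: root_form_to_roots arrangement_complement_def deleted_B3_def)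
  fix i \<mu> assume "\<mu> \<in> meridians deleted_B3 i"
  then obtain p v where \<mu>: "\<mu> = (\<lambda>s. p + circlepath 0 1 s *s v)" and p: "p \<in> deleted_B3 i" "\<And>j. j \<noteq> i \<Longrightarrow> p \<notin> deleted_B3 j"
    and v: "\<And>z. z \<noteq> 0 \<Longrightarrow> norm z \<le> 1 \<Longrightarrow> p + z *s v \<in> arrangement_complement deleted_B3"
    unfolding meridians_def by blast
  have "winding_system root_form \<alpha> (\<lambda>s. to_roots p + csmul (rot s) (to_roots v)) = t $ i"
    by (rule meridionalD[OF meridional_winding_system[of \<alpha> "\<lambda>i. t $ i", OF assms]])
      (use p v in \<open>auto simp: deleted_B3_def root_form_to_roots in_arrangement_complement_iff to_roots_linear\<close>)
  then show "winding_system (\<lambda>i w. deleted_B3_forms w $ i) \<alpha> \<mu> = t $ i"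
    unfolding e by (simp add: \<mu> o_def to_roots_linear circlepath_eq_rot)
qed

section \<open>Crossing a wall\<close>

text \<open>
  The number of times a path in the punctured plane crosses the negative real axis, counted with signs.
\<close>

definition crossing :: "(real \<Rightarrow> complex) \<Rightarrow> complex" where
  "crossing E = (log_change E - (Ln (E 1) - Ln (E 0))) / (2 * of_real pi * \<i>)"

lemma crossing_cong: "(\<And>u. u \<in> {0..1} \<Longrightarrow> E u = E' u) \<Longrightarrow> crossing E = crossing E'"
  unfolding crossing_def log_change_def using winding_number_cong[of E E' 0] by simp

text \<open>Off the slit the principal logarithm is itself a continuous logarithm.\<close>

lemma crossing_eq_0:
  assumes "path E" "\<And>u. u \<in> {0..1} \<Longrightarrow> E u \<notin> \<real>\<^sub>\<le>\<^sub>0"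
  shows "crossing E = 0"
proof -
  have "log_change E = (Ln \<circ> E) 1 - (Ln \<circ> E) 0"
  proof (rule log_change_eq)
    show "path (Ln \<circ> E)"
      using assms by (intro path_continuous_image continuous_on_Ln continuous_on_id) (auto simp: path_image_def)
    show "E u = exp ((Ln \<circ> E) u)" if "u \<in> {0..1}" for u
    proof -
      have "E u \<noteq> 0" using assms(2)[OF that] by auto
      then show ?thesis by simp
    qed
  qed
  then show ?thesis by (simp add: crossing_def)
qed

text \<open>The changes of logarithm add up because \<open>E\<close> extends without zeros over the
  triangle, and the principal values at the vertices telescope.\<close>

lemma crossing_sum_triangle:
  fixes E :: "'b::real_normed_vector \<Rightarrow> complex"
  assumes "convex T" "continuous_on T E" "\<And>x. x \<in> T \<Longrightarrow> E x \<noteq> 0" "a \<in> T" "b \<in> T" "d \<in> T"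
  shows "crossing (E \<circ> linepath a b) + crossing (E \<circ> linepath b d) = crossing (E \<circ> linepath a d)"
proof -
  have seg: "closed_segment x y \<subseteq> T" if "x \<in> T" "y \<in> T" for x y
    using assms(1) that by (simp add: closed_segment_subset)
  have im: "path (E \<circ> linepath x y) \<and> 0 \<notin> path_image (E \<circ> linepath x y)" if "x \<in> T" "y \<in> T" for x y
    using seg[OF that] assms(2,3)
    by (auto intro!: path_continuous_image intro: continuous_on_subset simp: path_image_compose)
  have "homotopic_paths (- {0}) (E \<circ> (linepath a b +++ linepath b d)) (E \<circ> linepath a d)"
    by (rule homotopic_paths_convex_image[OF assms(1,2)])
      (use assms(3-) seg in \<open>auto simp: subset_path_image_join\<close>)
  then have "log_change (E \<circ> (linepath a b +++ linepath b d)) = log_change (E \<circ> linepath a d)"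
    by (simp add: log_change_def winding_number_homotopic_paths)
  moreover have "log_change (E \<circ> (linepath a b +++ linepath b d)) = log_change (E \<circ> linepath a b) + log_change (E \<circ> linepath b d)"
    unfolding path_compose_join log_change_def using im[OF assms(4,5)] im[OF assms(5,6)]
    by (subst winding_number_join) (auto simp: pathfinish_compose pathstart_compose algebra_simps)
  ultimately have "log_change (E \<circ> linepath a b) + log_change (E \<circ> linepath b d) = log_change (E \<circ> linepath a d)" by simp
  then show ?thesis
    by (simp add: crossing_def linepath_0' linepath_1' flip: add_divide_distrib)
qed

text \<open>
  \<open>wall f s v\<close> is the phase of \<open>f\<close> on the part of \<open>f\<close>'s preimage of the slit plane where \<open>s\<close> equals \<open>v\<close>. It tends to \<open>1\<close> at the
  boundary of that part, so it extends continuously by \<open>1\<close>.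
\<close>

definition wall :: "('b \<Rightarrow> complex) \<Rightarrow> ('b \<Rightarrow> complex) \<Rightarrow> complex \<Rightarrow> 'b \<Rightarrow> complex" where
  "wall f s v x = (if f x \<notin> \<real>\<^sub>\<ge>\<^sub>0 \<and> s x = v then sgn (f x) else 1)"

lemma wall_nonzero: "wall f s v x \<noteq> 0"
  by (auto simp: wall_def sgn_zero_iff)

lemma wall_nonpos_iff: "wall f s v x \<in> \<real>\<^sub>\<le>\<^sub>0 \<longleftrightarrow> f x \<in> \<real>\<^sub>\<le>\<^sub>0 \<and> f x \<noteq> 0 \<and> s x = v"
proof -
  have "sgn z \<in> \<real>\<^sub>\<le>\<^sub>0 \<longleftrightarrow> z \<in> \<real>\<^sub>\<le>\<^sub>0" for z :: complex
    by (cases "z = 0") (auto simp: complex_nonpos_Reals_iff sgn_div_norm mult_le_0_iff field_simps divide_le_0_iff)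
  moreover have "z \<notin> \<real>\<^sub>\<ge>\<^sub>0 \<longleftrightarrow> z \<noteq> 0" if "z \<in> \<real>\<^sub>\<le>\<^sub>0" for z :: complex
    using that by (auto simp: complex_nonpos_Reals_iff complex_nonneg_Reals_iff complex_eq_iff)
  moreover have "(1::complex) \<notin> \<real>\<^sub>\<le>\<^sub>0" by (simp add: complex_nonpos_Reals_iff)
  ultimately show ?thesis unfolding wall_def by auto
qed

lemma open_slit: "open (- \<real>\<^sub>\<ge>\<^sub>0 :: complex set)"
  by (simp add: open_Compl closed_nonneg_Reals_complex)

lemma continuous_on_wall:
  fixes f :: "'b::metric_space \<Rightarrow> complex"
  assumes f: "continuous_on T f" "\<And>x. x \<in> T \<Longrightarrow> f x \<noteq> 0"
    and s: "\<And>x. x \<in> T \<Longrightarrow> f x \<notin> \<real>\<^sub>\<ge>\<^sub>0 \<Longrightarrow> \<exists>d>0. \<forall>y\<in>T. dist y x < d \<longrightarrow> f y \<notin> \<real>\<^sub>\<ge>\<^sub>0 \<and> s y = s x"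
  shows "continuous_on T (wall f s v)"
  unfolding continuous_on_eq_continuous_within
proof
  fix x assume x: "x \<in> T"
  have sg: "continuous (at x within T) (\<lambda>x. sgn (f x))"
    using f x by (auto intro!: continuous_intros simp: continuous_on_eq_continuous_within)
  show "continuous (at x within T) (wall f s v)"
  proof (cases "f x \<in> \<real>\<^sub>\<ge>\<^sub>0")
    case True
    then have sx: "sgn (f x) = 1"
      using f(2)[OF x] by (auto elim!: nonneg_Reals_cases simp: sgn_of_real)
    have wx: "wall f s v x = 1" using True by (simp add: wall_def)
    \<comment> \<open>At a point with \<open>f x > 0\<close> the phase tends to 1, so both cases of
      the definition have the limit 1, whatever the labels nearby.\<close>
    have "norm (wall f s v y - 1) \<le> norm (sgn (f y) - 1)" for y by (simp add: wall_def)
    moreover have "((\<lambda>y. norm (sgn (f y) - 1)) \<longlongrightarrow> 0) (at x within T)"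
      using sg sx by (auto simp: continuous_within intro!: tendsto_norm_zero LIM_zero)
    ultimately have "((\<lambda>y. wall f s v y - 1) \<longlongrightarrow> 0) (at x within T)"
      by (intro Lim_null_comparison[of "\<lambda>y. wall f s v y - 1"]) auto
    then show ?thesis unfolding continuous_within wx by (rule LIM_zero_cancel)
  next
    case False
    then obtain d where d: "d > 0" "\<And>y. y \<in> T \<Longrightarrow> dist y x < d \<Longrightarrow> f y \<notin> \<real>\<^sub>\<ge>\<^sub>0 \<and> s y = s x"
      using s[OF x] by blast
    show ?thesis
    proof (cases "s x = v")
      case True
      show ?thesis by (rule continuous_transform_within[OF sg d(1) x]) (use d True in \<open>auto simp: wall_def\<close>)
    next
      case False
      have "continuous (at x within T) (\<lambda>_. 1::complex)" by simp
      then show ?thesis by (rule continuous_transform_within[OF _ d(1) x]) (use d False in \<open>auto simp: wall_def\<close>)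
    qed
  qed
qed

text \<open>The preimage of the nonpositive axis is compact and the label \<open>s\<close> is
  locally constant on it.\<close>

lemma finite_wall_values:
  fixes f :: "'b::metric_space \<Rightarrow> complex"
  assumes T: "compact T" and f: "continuous_on T f" "\<And>x. x \<in> T \<Longrightarrow> f x \<noteq> 0"
    and s: "\<And>x. x \<in> T \<Longrightarrow> f x \<notin> \<real>\<^sub>\<ge>\<^sub>0 \<Longrightarrow> \<exists>d>0. \<forall>y\<in>T. dist y x < d \<longrightarrow> f y \<notin> \<real>\<^sub>\<ge>\<^sub>0 \<and> s y = s x"
  shows "finite (s ` {x \<in> T. f x \<in> \<real>\<^sub>\<le>\<^sub>0})"
proof -
  let ?W = "{x \<in> T. f x \<in> \<real>\<^sub>\<le>\<^sub>0}"
  have "closed ?W"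
    using continuous_closed_preimage[OF f(1) compact_imp_closed[OF T] closed_nonpos_Reals_complex]
    by (simp add: vimage_def Collect_conj_eq)
  then have "compact (T \<inter> ?W)" using T by (rule compact_Int_closed[rotated])
  then have cW: "compact ?W" by (simp add: Int_absorb1)
  have "\<exists>d>0. \<forall>y\<in>T. dist y x < d \<longrightarrow> s y = s x" if "x \<in> ?W" for x
  proof -
    have "f x \<notin> \<real>\<^sub>\<ge>\<^sub>0"
      using that f(2)[of x] by (auto simp: complex_nonpos_Reals_iff complex_nonneg_Reals_iff complex_eq_iff)
    then show ?thesis using s[of x] that by blast
  qed
  then obtain d where d: "\<And>x. x \<in> ?W \<Longrightarrow> d x > 0 \<and> (\<forall>y\<in>T. dist y x < d x \<longrightarrow> s y = s x)" by metis
  have "?W \<subseteq> (\<Union>x\<in>?W. ball x (d x))" using d by force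
  then obtain D where D: "D \<subseteq> ?W" "finite D" "?W \<subseteq> (\<Union>x\<in>D. ball x (d x))"
    using compactE_image[OF cW, of ?W "\<lambda>x. ball x (d x)"] by auto
  have "s ` ?W \<subseteq> s ` D"
  proof clarify
    fix y assume y: "y \<in> T" "f y \<in> \<real>\<^sub>\<le>\<^sub>0"
    then obtain x where x: "x \<in> D" "dist y x < d x" using D(3) by (auto simp: dist_commute)
    then have "s y = s x" using d[of x] D(1) y by blast
    then show "s y \<in> s ` D" using x by blast
  qed
  then show ?thesis using D(2) finite_surj by blast
qed

section \<open>The pencil\<close>

definition pencil :: "c3 \<Rightarrow> complex" where
  "pencil = (\<lambda>(a, m, e). (m\<^sup>2 * (a\<^sup>2 - e\<^sup>2)) / (e\<^sup>2 * (a\<^sup>2 - m\<^sup>2)))"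

text \<open>The exponents of the eight forms in the multivalued function \<open>pencil\<close> to
  the power \<open>\<alpha>\<close>, times the square root of
  \<open>(a - m) * (a + m) / ((m - e) * (m + e))\<close>.\<close>

definition pencil_exponent :: "complex \<Rightarrow> 8 \<Rightarrow> complex" where
  "pencil_exponent \<alpha> i = vector [\<alpha>, 1/2 - \<alpha>, 1/2 - \<alpha>, \<alpha>, 2 * \<alpha>, - 1/2, - 2 * \<alpha>, - 1/2] $ i"

lemma root_complement_squares:
  assumes "(a, m, e) \<in> root_complement"
  shows "a\<^sup>2 - e\<^sup>2 \<noteq> 0" "a\<^sup>2 - m\<^sup>2 \<noteq> 0" "m\<^sup>2 - e\<^sup>2 \<noteq> 0" "m \<noteq> 0" "e \<noteq> 0"
proof -
  have "x\<^sup>2 - y\<^sup>2 = (x + y) * (x - y)" for x y :: complex by (simp add: power2_eq_square algebra_simps)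
  then show "a\<^sup>2 - e\<^sup>2 \<noteq> 0" "a\<^sup>2 - m\<^sup>2 \<noteq> 0" "m\<^sup>2 - e\<^sup>2 \<noteq> 0" "m \<noteq> 0" "e \<noteq> 0"
    using assms by (auto simp: root_complement_iff)
qed

lemma pencil_nonzero: "w \<in> root_complement \<Longrightarrow> pencil w \<noteq> 0"
  using root_complement_squares by (cases w) (auto simp: pencil_def)

lemma continuous_on_pencil: "continuous_on root_complement pencil"
  unfolding pencil_def case_prod_unfold
  by (intro continuous_intros) (use root_complement_squares in \<open>auto simp: prod_eq_iff\<close>)

text \<open>The fibre of the pencil over \<open>1\<close> is a double plane \<open>a = 0\<close>; this is where the translation of order 2 comes from.\<close>

lemma one_minus_pencil:
  assumes "(a, m, e) \<in> root_complement"
  shows "1 - pencil (a, m, e) = (a\<^sup>2 * (e\<^sup>2 - m\<^sup>2)) / (e\<^sup>2 * (a\<^sup>2 - m\<^sup>2))"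
  using root_complement_squares[OF assms] by (simp add: pencil_def field_simps)

definition slit_domain :: "c3 set" where
  "slit_domain = {w \<in> root_complement. pencil w \<notin> \<real>\<^sub>\<ge>\<^sub>0}"

text \<open>A branch, up to a constant, of the multivalued function with exponents
  \<open>pencil_exponent \<alpha>\<close>. The radicand of its square root, multiplied by
  \<open>1 - pencil\<close>, is minus the square of \<open>a / e\<close>; hence the last
  factor.\<close>

definition slit_section :: "complex \<Rightarrow> c3 \<Rightarrow> complex" where
  "slit_section \<alpha> w = exp (\<alpha> * Ln (- pencil w) - Ln (1 - pencil w) / 2) * (fst w / snd (snd w))"

abbreviation pencil_system :: "complex \<Rightarrow> (real \<Rightarrow> c3) \<Rightarrow> complex" where
  "pencil_system \<alpha> \<equiv> winding_system root_form (pencil_exponent \<alpha>)"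

lemma slit_domain_nonzero:
  assumes "(a, m, e) \<in> slit_domain"
  shows "a \<noteq> 0" "- pencil (a, m, e) \<notin> \<real>\<^sub>\<le>\<^sub>0" "1 - pencil (a, m, e) \<notin> \<real>\<^sub>\<le>\<^sub>0"
proof -
  have w: "(a, m, e) \<in> root_complement" "pencil (a, m, e) \<notin> \<real>\<^sub>\<ge>\<^sub>0" using assms by (auto simp: slit_domain_def)
  then have "1 - pencil (a, m, e) \<noteq> 0" by (auto simp: complex_nonneg_Reals_iff)
  then show "a \<noteq> 0" unfolding one_minus_pencil[OF w(1)] by auto
  show "- pencil (a, m, e) \<notin> \<real>\<^sub>\<le>\<^sub>0" "1 - pencil (a, m, e) \<notin> \<real>\<^sub>\<le>\<^sub>0"
    using w(2) by (auto simp: complex_nonneg_Reals_iff complex_nonpos_Reals_iff)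
qed

text \<open>Monodromy is the quotient of the values of a branch at the two ends. In the convention
  of \<open>flat_on\<close> it is \<open>1 / slit_section\<close> that is flat over the slit
  domain.\<close>

lemma pencil_system_slit:
  assumes g: "path g" "path_image g \<subseteq> slit_domain"
  shows "pencil_system \<alpha> g * slit_section \<alpha> (pathstart g) = slit_section \<alpha> (pathfinish g)"
    and "slit_section \<alpha> (pathstart g) \<noteq> 0"
proof -
  have cg: "continuous_on {0..1} g" using g by (simp add: path_def)
  have gs: "g s \<in> slit_domain" "g s \<in> root_complement" if "s \<in> {0..1}" for s
  proof -
    show "g s \<in> slit_domain" using g(2) that unfolding path_image_def by blast
    then show "g s \<in> root_complement" by (simp add: slit_domain_def)
  qed
  have logs: "\<exists>q. path q \<and> (\<forall>s\<in>{0..1}. f s = exp (q s))" if "continuous_on {0..1} f" "\<And>s. s \<in> {0..1} \<Longrightarrow> f s \<noteq> 0" for f :: "real \<Rightarrow> complex"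
  proof -
    have "path f" "0 \<notin> path_image f" using that by (auto simp: path_def path_image_def)
    from winding_number_as_continuous_log[OF this] obtain q where "path q" "\<And>t. t \<in> {0..1} \<Longrightarrow> f t = 0 + exp (q t)" by metis
    then show ?thesis by auto
  qed
  have "\<exists>q. path q \<and> (\<forall>s\<in>{0..1}. root_form i (g s) = exp (q s))" for i
    by (rule logs) (use gs(2) cg in \<open>auto simp: root_complement_def intro!: continuous_on_compose2[OF continuous_on_root_form[of UNIV]]\<close>)
  then obtain q where q: "\<And>i. path (q i)" "\<And>i s. s \<in> {0..1} \<Longrightarrow> root_form i (g s) = exp (q i s)" by metis
  have anz: "fst (g s) \<noteq> 0" "snd (snd (g s)) \<noteq> 0" if "s \<in> {0..1}" for s
    using slit_domain_nonzero(1)[of "fst (g s)" "fst (snd (g s))" "snd (snd (g s))"]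
      root_complement_squares(5)[of "fst (g s)" "fst (snd (g s))" "snd (snd (g s))"] gs[OF that] by auto
  have "\<exists>q. path q \<and> (\<forall>s\<in>{0..1}. fst (g s) / snd (snd (g s)) = exp (q s))"
    by (rule logs) (use anz cg in \<open>auto intro!: continuous_intros\<close>)
  then obtain r where r: "path r" "\<And>s. s \<in> {0..1} \<Longrightarrow> fst (g s) / snd (snd (g s)) = exp (r s)" by metis
  have qc: "continuous_on {0..1} (q i)" "continuous_on {0..1} r" for i using q r by (auto simp: path_def)
  have Pc: "continuous_on {0..1} (\<lambda>s. pencil (g s))"
    by (rule continuous_on_compose2[OF continuous_on_pencil cg]) (use gs in auto)
  have slit: "- pencil (g s) \<notin> \<real>\<^sub>\<le>\<^sub>0" "1 - pencil (g s) \<notin> \<real>\<^sub>\<le>\<^sub>0" if "s \<in> {0..1}" for s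
    using slit_domain_nonzero(2,3)[of "fst (g s)" "fst (snd (g s))" "snd (snd (g s))"] gs[OF that] by auto
  \<comment> \<open>Continuous logarithms along the path: \<open>\<phi>\<close> of
    \<open>pencil\<close>, and \<open>\<psi>\<close> of the radicand. The exponents combine them as
    \<open>\<alpha> * \<phi> + \<psi> / 2\<close>.\<close>
  define \<phi> where "\<phi> s = q 1 s + q 4 s + 2 * q 5 s - q 2 s - q 3 s - 2 * q 7 s" for s
  define \<psi> where "\<psi> s = q 2 s + q 3 s - q 6 s - q 8 s" for s
  have d2: "exp (2 * z) = (exp z)\<^sup>2" for z :: complex by (simp add: exp_double)
  have \<phi>: "exp (\<phi> s) = pencil (g s)" and \<psi>: "exp (\<psi> s) * (1 - pencil (g s)) = - (fst (g s) / snd (snd (g s)))\<^sup>2" if s: "s \<in> {0..1}" for s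
  proof -
    obtain a m e where w: "g s = (a, m, e)" by (metis prod_cases3)
    have rc: "(a, m, e) \<in> root_complement" using gs(2)[OF s] w by simp
    note nz = root_complement_squares[OF rc]
    have f: "exp (q i s) = root_form i (a, m, e)" for i using q(2)[OF s] w by simp
    have sq: "a\<^sup>2 - e\<^sup>2 = (a + e) * (a - e)" "a\<^sup>2 - m\<^sup>2 = (a - m) * (a + m)" "e\<^sup>2 - m\<^sup>2 = - ((m - e) * (m + e))"
      by (simp_all add: power2_eq_square algebra_simps)
    have "exp (\<phi> s) = (a + e) * (a - e) * (2 * m)\<^sup>2 / ((a - m) * (a + m) * (2 * e)\<^sup>2)"
      unfolding \<phi>_def by (simp add: exp_add exp_diff d2 f mult_ac)
    then show "exp (\<phi> s) = pencil (g s)" using nz unfolding w pencil_def by (simp add: sq power_mult_distrib mult_ac)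
    have "exp (\<psi> s) = (a - m) * (a + m) / ((m - e) * (m + e))"
      unfolding \<psi>_def by (simp add: exp_add exp_diff f)
    then have "exp (\<psi> s) * (1 - pencil (g s)) = (a\<^sup>2 - m\<^sup>2) / (- (e\<^sup>2 - m\<^sup>2)) * ((a\<^sup>2 * (e\<^sup>2 - m\<^sup>2)) / (e\<^sup>2 * (a\<^sup>2 - m\<^sup>2)))"
      unfolding w one_minus_pencil[OF rc] sq by simp
    also have "\<dots> = - (a / e)\<^sup>2"
    proof -
      have "X / (- Y) * ((A * Y) / (B * X)) = - (A / B)" if "X \<noteq> 0" "Y \<noteq> 0" "B \<noteq> 0" for X Y A B :: complex
        using that by (simp add: field_simps)
      from this[of "a\<^sup>2 - m\<^sup>2" "e\<^sup>2 - m\<^sup>2" "e\<^sup>2" "a\<^sup>2"] show ?thesis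
        using nz by (simp add: power_divide)
    qed
    finally show "exp (\<psi> s) * (1 - pencil (g s)) = - (fst (g s) / snd (snd (g s)))\<^sup>2" by (simp add: w)
  qed
  have c1: "\<phi> 1 - Ln (- pencil (g 1)) = \<phi> 0 - Ln (- pencil (g 0))"
  proof (rule constant_on_of_exp[where S="{0..1}" and k="-1" and f="\<lambda>s. \<phi> s - Ln (- pencil (g s))"])
    show "continuous_on {0..1} (\<lambda>s. \<phi> s - Ln (- pencil (g s)))"
      unfolding \<phi>_def using slit by (intro continuous_intros qc Pc) auto
    show "exp (\<phi> s - Ln (- pencil (g s))) = -1" if "s \<in> {0..1}" for s
      using slit(1)[OF that] \<phi>[OF that] pencil_nonzero[OF gs(2)[OF that]] by (simp add: exp_diff)
  qed auto
  have c2: "\<psi> 1 + Ln (1 - pencil (g 1)) - 2 * r 1 = \<psi> 0 + Ln (1 - pencil (g 0)) - 2 * r 0"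
  proof (rule constant_on_of_exp[where S="{0..1}" and k="-1" and f="\<lambda>s. \<psi> s + Ln (1 - pencil (g s)) - 2 * r s"])
    show "continuous_on {0..1} (\<lambda>s. \<psi> s + Ln (1 - pencil (g s)) - 2 * r s)"
      unfolding \<psi>_def using slit by (intro continuous_intros qc Pc) auto
    show "exp (\<psi> s + Ln (1 - pencil (g s)) - 2 * r s) = -1" if s: "s \<in> {0..1}" for s
    proof -
      have "1 - pencil (g s) \<noteq> 0" using slit(2)[OF s] by auto
      then show ?thesis using \<psi>[OF s] r(2)[OF s] anz[OF s]
        by (simp add: exp_diff exp_add d2 power2_eq_square)
    qed
  qed auto
  have "log_change (root_form i \<circ> g) = q i 1 - q i 0" for i
    by (rule log_change_eq) (use q in auto)
  then have "pencil_system \<alpha> g = exp (\<Sum>i\<in>UNIV. pencil_exponent \<alpha> i * (q i 1 - q i 0))"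
    by (simp add: winding_system_def)
  also have "(\<Sum>i\<in>UNIV. pencil_exponent \<alpha> i * (q i 1 - q i 0)) = \<alpha> * (\<phi> 1 - \<phi> 0) + (\<psi> 1 - \<psi> 0) / 2"
    unfolding UNIV_8 by (simp add: pencil_exponent_def \<phi>_def \<psi>_def field_simps)
  also have "\<dots> = (\<alpha> * Ln (- pencil (g 1)) - Ln (1 - pencil (g 1)) / 2 + r 1)
      - (\<alpha> * Ln (- pencil (g 0)) - Ln (1 - pencil (g 0)) / 2 + r 0)"
  proof -
    have A: "\<phi> 1 - \<phi> 0 = Ln (- pencil (g 1)) - Ln (- pencil (g 0))" using c1 by (simp add: algebra_simps)
    have B: "\<psi> 1 - \<psi> 0 = 2 * (r 1 - r 0) - (Ln (1 - pencil (g 1)) - Ln (1 - pencil (g 0)))"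
      using c2 by (simp add: algebra_simps)
    show ?thesis unfolding A B by (simp add: algebra_simps diff_divide_distrib add_divide_distrib)
  qed
  finally have L: "pencil_system \<alpha> g = exp ((\<alpha> * Ln (- pencil (g 1)) - Ln (1 - pencil (g 1)) / 2 + r 1)
      - (\<alpha> * Ln (- pencil (g 0)) - Ln (1 - pencil (g 0)) / 2 + r 0))" .
  have S: "slit_section \<alpha> (g s) = exp (\<alpha> * Ln (- pencil (g s)) - Ln (1 - pencil (g s)) / 2 + r s)" if "s \<in> {0..1}" for s
    using r(2)[OF that] by (simp add: slit_section_def exp_add)
  show "pencil_system \<alpha> g * slit_section \<alpha> (pathstart g) = slit_section \<alpha> (pathfinish g)"
    "slit_section \<alpha> (pathstart g) \<noteq> 0"
    unfolding L pathstart_def pathfinish_def using S[of 0] S[of 1] by (simp_all flip: exp_add)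
qed

section \<open>The cocycle dual to the wall\<close>

lemma pencil_system: "rank_one_local_system root_complement (pencil_system \<alpha>)"
  by (rule winding_system_root_form)

lemma rank_one_triangle:
  fixes G :: "'b::real_normed_vector \<Rightarrow> 'a::topological_space"
  assumes L: "rank_one_local_system S L" and T: "convex T" "continuous_on T G" "G ` T \<subseteq> S" "a \<in> T" "b \<in> T" "d \<in> T"
  shows "L (G \<circ> linepath a b) * L (G \<circ> linepath b d) = L (G \<circ> linepath a d)" "L (G \<circ> linepath a b) \<noteq> 0"
proof -
  have seg: "closed_segment x y \<subseteq> T" if "x \<in> T" "y \<in> T" for x y
    using T(1) that by (simp add: closed_segment_subset)
  have im: "path (G \<circ> linepath x y) \<and> path_image (G \<circ> linepath x y) \<subseteq> S" if "x \<in> T" "y \<in> T" for x y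
    using seg[OF that] T(2,3)
    by (auto intro!: path_continuous_image intro: continuous_on_subset simp: path_image_compose)
  show "L (G \<circ> linepath a b) \<noteq> 0" using L im[OF T(4,5)] by (simp add: rank_one_local_system_def)
  have "homotopic_paths S (G \<circ> (linepath a b +++ linepath b d)) (G \<circ> linepath a d)"
    by (rule homotopic_paths_convex_image[OF T(1-3)])
      (use T(4-) seg in \<open>auto simp: subset_path_image_join\<close>)
  then have "L (G \<circ> (linepath a b +++ linepath b d)) = L (G \<circ> linepath a d)"
    using L by (simp add: rank_one_local_system_def)
  moreover have "L (G \<circ> (linepath a b +++ linepath b d)) = L (G \<circ> linepath a b) * L (G \<circ> linepath b d)"
    unfolding path_compose_join using L im[OF T(4,5)] im[OF T(5,6)]
    by (simp add: rank_one_local_system_def pathfinish_compose pathstart_compose)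
  ultimately show "L (G \<circ> linepath a b) * L (G \<circ> linepath b d) = L (G \<circ> linepath a d)" by simp
qed

text \<open>The ratio of the two local trivialisations, which distinguishes the sheets of the wall \<open>pencil < 0\<close>.\<close>

definition sheet :: "complex \<Rightarrow> ('b::real_normed_vector \<Rightarrow> c3) \<Rightarrow> 'b \<Rightarrow> 'b \<Rightarrow> complex" where
  "sheet \<alpha> G a x = pencil_system \<alpha> (G \<circ> linepath a x) / slit_section \<alpha> (G x)"

definition pencil_wall :: "complex \<Rightarrow> ('b::real_normed_vector \<Rightarrow> c3) \<Rightarrow> 'b \<Rightarrow> complex \<Rightarrow> 'b \<Rightarrow> complex" where
  "pencil_wall \<alpha> G a v = wall (pencil \<circ> G) (sheet \<alpha> G a) v"

text \<open>The label is the flat section \<open>1 / slit_section\<close> carried back to the base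
  point \<open>a\<close>; along short segments inside the slit domain this does not change.\<close>

lemma sheet_locally_constant:
  assumes T: "convex T" "continuous_on T G" "G ` T \<subseteq> root_complement" "a \<in> T" "x \<in> T" "(pencil \<circ> G) x \<notin> \<real>\<^sub>\<ge>\<^sub>0"
  shows "\<exists>d>0. \<forall>y\<in>T. dist y x < d \<longrightarrow> (pencil \<circ> G) y \<notin> \<real>\<^sub>\<ge>\<^sub>0 \<and> sheet \<alpha> G a y = sheet \<alpha> G a x"
proof -
  have "continuous_on T (pencil \<circ> G)"
    using T(2) continuous_on_subset[OF continuous_on_pencil T(3)] by (rule continuous_on_compose)
  moreover obtain e where e: "e > 0" "ball ((pencil \<circ> G) x) e \<subseteq> - \<real>\<^sub>\<ge>\<^sub>0"
    using open_slit T(6) unfolding open_contains_ball by blast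
  ultimately obtain d where d: "d > 0" "\<And>y. y \<in> T \<Longrightarrow> dist y x < d \<Longrightarrow> dist ((pencil \<circ> G) y) ((pencil \<circ> G) x) < e"
    using T(5) unfolding continuous_on_iff by meson
  have slit: "(pencil \<circ> G) y \<notin> \<real>\<^sub>\<ge>\<^sub>0" if "y \<in> T" "dist y x < d" for y
  proof -
    have "(pencil \<circ> G) y \<in> ball ((pencil \<circ> G) x) e" using d(2)[OF that] by (simp add: dist_commute)
    then show ?thesis using e(2) by blast
  qed
  have "sheet \<alpha> G a y = sheet \<alpha> G a x" if y: "y \<in> T" "dist y x < d" for y
  proof -
    have "closed_segment x y \<subseteq> T \<inter> ball x d"
      using T(1,5) y d(1) by (intro closed_segment_subset convex_Int) (auto simp: dist_commute)
    then have seg: "z \<in> T" "dist z x < d" if "z \<in> closed_segment x y" for z using that by (auto simp: dist_commute)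
    have p: "path (G \<circ> linepath x y)"
      by (rule path_continuous_image[OF path_linepath continuous_on_subset[OF T(2)]]) (use seg in auto)
    have pi: "path_image (G \<circ> linepath x y) \<subseteq> slit_domain"
      using seg slit T(3) by (force simp: path_image_compose slit_domain_def)
    note P = pencil_system_slit[OF p pi, of \<alpha>]
    note tri = rank_one_triangle[OF pencil_system T(1-4) T(5) y(1), of \<alpha>]
    have 1: "pencil_system \<alpha> (G \<circ> linepath x y) * slit_section \<alpha> (G x) = slit_section \<alpha> (G y)"
      using P(1) by (simp add: pathstart_compose pathfinish_compose)
    have n0: "slit_section \<alpha> (G x) \<noteq> 0" using P(2) by (simp add: pathstart_compose)
    have "pencil_system \<alpha> (G \<circ> linepath x y) \<noteq> 0" by (simp add: winding_system_def)
    then show ?thesis unfolding sheet_def tri(1)[symmetric] 1[symmetric] using n0 by (simp add: field_simps)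
  qed
  then show ?thesis using d(1) slit by blast
qed

lemma continuous_on_pencil_wall:
  assumes T: "convex T" "continuous_on T G" "G ` T \<subseteq> root_complement" "a \<in> T"
  shows "continuous_on T (pencil_wall \<alpha> G a v)"
  unfolding pencil_wall_def
proof (rule continuous_on_wall)
  show "continuous_on T (pencil \<circ> G)"
    using T(2) continuous_on_subset[OF continuous_on_pencil T(3)] by (rule continuous_on_compose)
  show "(pencil \<circ> G) x \<noteq> 0" if "x \<in> T" for x
    using pencil_nonzero[of "G x"] T(3) that by auto
qed (use T sheet_locally_constant[OF T] in auto)

lemma finite_sheets:
  assumes T: "convex T" "continuous_on T G" "G ` T \<subseteq> root_complement" "a \<in> T" "compact T"
  shows "finite (sheet \<alpha> G a ` {x \<in> T. (pencil \<circ> G) x \<in> \<real>\<^sub>\<le>\<^sub>0})"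
proof (rule finite_wall_values)
  show "continuous_on T (pencil \<circ> G)"
    using T(2) continuous_on_subset[OF continuous_on_pencil T(3)] by (rule continuous_on_compose)
  show "(pencil \<circ> G) x \<noteq> 0" if "x \<in> T" for x
    using pencil_nonzero[of "G x"] T(3) that by auto
qed (use T sheet_locally_constant[OF T(1-4)] in auto)

text \<open>The weight \<open>v\<close> is the flat section on the crossed sheet, carried back to
  the fibre over \<open>g 0\<close>, where the value of a cochain has to lie. For paths in the
  complement only finitely many labels contribute, by \<open>finite_sheets\<close>.\<close>

definition pencil_cochain :: "complex \<Rightarrow> (real \<Rightarrow> c3) \<Rightarrow> complex" where
  "pencil_cochain \<alpha> g = (\<Sum>v | crossing (pencil_wall \<alpha> g 0 v) \<noteq> 0. v * crossing (pencil_wall \<alpha> g 0 v))"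

text \<open>Moving the base point from \<open>x\<close> to \<open>a\<close> multiplies all labels by
  the monodromy from \<open>a\<close> to \<open>x\<close>, which is the factor on the left. All
  edges of a simplex thus become sums over one finite set of labels.\<close>

lemma pencil_cochain_edge:
  assumes T: "convex T" "continuous_on T G" "G ` T \<subseteq> root_complement" "a \<in> T" "compact T"
    and xy: "x \<in> T" "y \<in> T" and p: "\<And>u. u \<in> {0..1} \<Longrightarrow> p u = G (linepath x y u)"
  shows "pencil_system \<alpha> (G \<circ> linepath a x) * pencil_cochain \<alpha> p =
    (\<Sum>w\<in>sheet \<alpha> G a ` {x \<in> T. (pencil \<circ> G) x \<in> \<real>\<^sub>\<le>\<^sub>0}. w * crossing (pencil_wall \<alpha> G a w \<circ> linepath x y))"
proof -
  let ?F = "sheet \<alpha> G a ` {x \<in> T. (pencil \<circ> G) x \<in> \<real>\<^sub>\<le>\<^sub>0}"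
  let ?l = "pencil_system \<alpha> (G \<circ> linepath a x)"
  have l: "?l \<noteq> 0" by (simp add: winding_system_def)
  have segT: "linepath x y u \<in> T" if "u \<in> {0..1}" for u
    using linepath_in_path[OF that, of x y] closed_segment_subset[OF xy T(1)] by blast
  have sh: "sheet \<alpha> p 0 u = sheet \<alpha> G a (linepath x y u) / ?l" if u: "u \<in> {0..1}" for u
  proof -
    let ?z = "linepath x y u"
    have lin: "linepath x y (linepath 0 u s) = linepath x ?z s" for s
      by (simp add: linepath_def algebra_simps)
    have in01: "linepath 0 u s \<in> {0..1}" if "s \<in> {0..1}" for s
      using u that by (auto simp: linepath_def mult_le_one)
    have "pencil_system \<alpha> (G \<circ> linepath x ?z) = pencil_system \<alpha> (p \<circ> linepath 0 u)"
    proof (rule rank_one_cong[OF pencil_system])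
      have seg: "closed_segment x ?z \<subseteq> T" using xy(1) segT[OF u] T(1) by (simp add: closed_segment_subset)
      show "path (G \<circ> linepath x ?z)"
        by (rule path_continuous_image[OF path_linepath continuous_on_subset[OF T(2)]]) (use seg in auto)
      show "path_image (G \<circ> linepath x ?z) \<subseteq> root_complement" using seg T(3) by (auto simp: path_image_compose)
      show "(G \<circ> linepath x ?z) s = (p \<circ> linepath 0 u) s" if "s \<in> {0..1}" for s
        using p[OF in01[OF that]] by (simp only: o_apply lin)
    qed
    then have "?l * pencil_system \<alpha> (p \<circ> linepath 0 u) = pencil_system \<alpha> (G \<circ> linepath a ?z)"
      using rank_one_triangle(1)[OF pencil_system T(1-4) xy(1) segT[OF u], of \<alpha>] by simp
    then have "pencil_system \<alpha> (p \<circ> linepath 0 u) = pencil_system \<alpha> (G \<circ> linepath a ?z) / ?l"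
      using l by (metis nonzero_mult_div_cancel_left)
    then show ?thesis unfolding sheet_def p[OF u] by simp
  qed
  have wall: "pencil_wall \<alpha> p 0 v u = (pencil_wall \<alpha> G a (v * ?l) \<circ> linepath x y) u" if "u \<in> {0..1}" for u v
    using l by (simp add: pencil_wall_def wall_def sh[OF that] p[OF that] divide_eq_eq)
  have cr: "crossing (pencil_wall \<alpha> p 0 v) = crossing (pencil_wall \<alpha> G a (v * ?l) \<circ> linepath x y)" for v
    by (rule crossing_cong) (rule wall)
  \<comment> \<open>If no point of the wall carries the label \<open>w\<close>, the phase function
    never meets the negative axis and the crossing number is 0.\<close>
  have supp: "w \<in> ?F" if "crossing (pencil_wall \<alpha> G a w \<circ> linepath x y) \<noteq> 0" for w
  proof (rule ccontr)
    assume w: "w \<notin> ?F"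
    have "crossing (pencil_wall \<alpha> G a w \<circ> linepath x y) = 0"
    proof (rule crossing_eq_0)
      show "path (pencil_wall \<alpha> G a w \<circ> linepath x y)"
        by (rule path_continuous_image[OF path_linepath continuous_on_subset[OF continuous_on_pencil_wall[OF T(1-4)]]])
          (use closed_segment_subset[OF xy T(1)] in auto)
      show "(pencil_wall \<alpha> G a w \<circ> linepath x y) u \<notin> \<real>\<^sub>\<le>\<^sub>0" if "u \<in> {0..1}" for u
        using w segT[OF that] by (auto simp: pencil_wall_def wall_nonpos_iff)
    qed
    with that show False by simp
  qed
  have fin: "finite ?F" by (rule finite_sheets[OF T])
  let ?A = "(\<lambda>w. w / ?l) ` ?F"
  have "pencil_cochain \<alpha> p = (\<Sum>v\<in>?A. v * crossing (pencil_wall \<alpha> p 0 v))"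
    unfolding pencil_cochain_def
  proof (rule sum.mono_neutral_left)
    show "{v. crossing (pencil_wall \<alpha> p 0 v) \<noteq> 0} \<subseteq> ?A"
    proof
      fix v assume "v \<in> {v. crossing (pencil_wall \<alpha> p 0 v) \<noteq> 0}"
      then have "v * ?l \<in> ?F" using supp cr by simp
      then show "v \<in> ?A" by (rule rev_image_eqI) (use l in simp)
    qed
  qed (use fin in auto)
  also have "\<dots> = (\<Sum>w\<in>?F. w / ?l * crossing (pencil_wall \<alpha> G a w \<circ> linepath x y))"
  proof (subst sum.reindex)
    show "inj_on (\<lambda>w. w / ?l) ?F" using l by (auto simp: inj_on_def)
  qed (use l in \<open>simp add: cr\<close>)
  finally show ?thesis using l by (simp add: sum_distrib_left)
qed

lemma unit_triangle: "convex unit_triangle" "compact unit_triangle" "(0,0) \<in> unit_triangle" "(1,0) \<in> unit_triangle" "(0,1) \<in> unit_triangle"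
proof -
  have e: "unit_triangle = {z. 0 \<le> fst z} \<inter> {z. 0 \<le> snd z} \<inter> {z. fst z + snd z \<le> 1}"
    by (auto simp: unit_triangle_def)
  show "convex unit_triangle"
  proof (rule convexI)
    fix x y :: "real \<times> real" and u v :: real
    assume *: "x \<in> unit_triangle" "y \<in> unit_triangle" "0 \<le> u" "0 \<le> v" "u + v = 1"
    have "u * (fst x + snd x) + v * (fst y + snd y) \<le> u * 1 + v * 1"
      by (intro add_mono mult_left_mono) (use * in \<open>auto simp: e\<close>)
    then show "u *\<^sub>R x + v *\<^sub>R y \<in> unit_triangle"
      using * by (auto simp: e algebra_simps)
  qed
  have "closed unit_triangle"
    unfolding e by (intro closed_Int closed_Collect_le continuous_intros)
  moreover have "unit_triangle \<subseteq> {0..1} \<times> {0..1}" by (auto simp: unit_triangle_def)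
  then have "bounded unit_triangle" by (rule bounded_subset[rotated]) (intro bounded_Times bounded_closed_interval)
  ultimately show "compact unit_triangle" by (simp add: compact_eq_bounded_closed)
qed (auto simp: unit_triangle_def)

text \<open>With all labels taken from vertex 0 the cocycle rule holds label by label: each phase
  function is continuous and nonzero on the triangle, so its crossings along the edges add
  up.\<close>

lemma triangle_cocycle_pencil: "triangle_cocycle root_complement (pencil_system \<alpha>) (pencil_cochain \<alpha>)"
  unfolding triangle_cocycle_def
proof clarify
  fix G p q r
  assume G: "continuous_on unit_triangle G" "G ` unit_triangle \<subseteq> root_complement"
    and e: "\<forall>u\<in>{0..1}. p u = G (u, 0)" "\<forall>u\<in>{0..1}. q u = G (1 - u, u)" "\<forall>u\<in>{0..1}. r u = G (0, u)"
  note T = unit_triangle(1) G unit_triangle(3,2)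
  have lin: "linepath (0,0) (1,0) u = (u,0)" "linepath (1,0) (0,1) u = (1 - u, u)" "linepath (0,0) (0,1) u = (0, u)" for u :: real
    by (simp_all add: linepath_def)
  let ?F = "sheet \<alpha> G (0,0) ` {x \<in> unit_triangle. (pencil \<circ> G) x \<in> \<real>\<^sub>\<le>\<^sub>0}"
  let ?cr = "\<lambda>w x y. crossing (pencil_wall \<alpha> G (0,0) w \<circ> linepath x y)"
  have one: "pencil_system \<alpha> (G \<circ> linepath (0,0) (0,0)) = 1"
    using rank_one_triangle[OF pencil_system T(1-4) T(4) T(4), of \<alpha>] by simp
  have "pencil_system \<alpha> (\<lambda>u. G (u, 0)) = pencil_system \<alpha> p"
    by (rule rank_one_cong[OF pencil_system triangle_edges(1,2)[OF G]]) (use e in auto)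
  then have Lp: "pencil_system \<alpha> (G \<circ> linepath (0,0) (1,0)) = pencil_system \<alpha> p" by (simp add: o_def lin)
  have cp: "pencil_cochain \<alpha> p = (\<Sum>w\<in>?F. w * ?cr w (0,0) (1,0))"
    using pencil_cochain_edge[OF T T(4) unit_triangle(4), of p \<alpha>] e one by (simp add: lin)
  have cr: "pencil_cochain \<alpha> r = (\<Sum>w\<in>?F. w * ?cr w (0,0) (0,1))"
    using pencil_cochain_edge[OF T T(4) unit_triangle(5), of r \<alpha>] e one by (simp add: lin)
  have cq: "pencil_system \<alpha> p * pencil_cochain \<alpha> q = (\<Sum>w\<in>?F. w * ?cr w (1,0) (0,1))"
    using pencil_cochain_edge[OF T unit_triangle(4,5), of q \<alpha>] e Lp by (simp add: lin)
  have "?cr w (0,0) (1,0) + ?cr w (1,0) (0,1) = ?cr w (0,0) (0,1)" for w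
    by (rule crossing_sum_triangle[OF T(1) continuous_on_pencil_wall[OF T(1-4)] _ unit_triangle(3-5)])
      (simp add: pencil_wall_def wall_nonzero)
  then show "pencil_cochain \<alpha> p + pencil_system \<alpha> p * pencil_cochain \<alpha> q = pencil_cochain \<alpha> r"
    unfolding cp cq cr by (simp flip: sum.distrib distrib_left)
qed

lemma pencil_cochain_eq_0:
  assumes g: "path g" "path_image g \<subseteq> root_complement" and np: "\<And>u. u \<in> {0..1} \<Longrightarrow> pencil (g u) \<notin> \<real>\<^sub>\<le>\<^sub>0"
  shows "pencil_cochain \<alpha> g = 0"
proof -
  have "crossing (pencil_wall \<alpha> g 0 v) = 0" for v
  proof (rule crossing_eq_0)
    show "path (pencil_wall \<alpha> g 0 v)"
      unfolding path_def by (rule continuous_on_pencil_wall) (use g in \<open>auto simp: path_def path_image_def\<close>)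
    show "pencil_wall \<alpha> g 0 v u \<notin> \<real>\<^sub>\<le>\<^sub>0" if "u \<in> {0..1}" for u
      using np[OF that] by (simp add: pencil_wall_def wall_nonpos_iff)
  qed
  then show ?thesis by (simp add: pencil_cochain_def)
qed

text \<open>A path in the slit domain meets a single sheet. Between values of \<open>pencil\<close>
  in the upper and in the lower half plane it crosses this sheet once in total.\<close>

lemma pencil_cochain_nonzero:
  assumes g: "path g" "path_image g \<subseteq> slit_domain" and Im: "0 < Im (pencil (g 0))" "Im (pencil (g 1)) < 0"
  shows "pencil_cochain \<alpha> g \<noteq> 0"
proof -
  let ?v = "1 / slit_section \<alpha> (g 0)"
  have gs: "g u \<in> slit_domain" if "u \<in> {0..1}" for u using g(2) that unfolding path_image_def by blast
  have S0: "slit_section \<alpha> (g 0) \<noteq> 0" using pencil_system_slit(2)[OF g] by (simp add: pathstart_def)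
  have sh: "sheet \<alpha> g 0 u = ?v" if u: "u \<in> {0..1}" for u
  proof -
    have eq: "g \<circ> linepath 0 u = subpath 0 u g" by (auto simp: linepath_def subpath_def mult.commute)
    have "path (subpath 0 u g)" "path_image (subpath 0 u g) \<subseteq> slit_domain"
      using path_subpath[OF g(1)] path_image_subpath_subset[of 0 u g] g(2) u by auto
    note P = pencil_system_slit(1)[OF this, of \<alpha>]
    have "pencil_system \<alpha> (subpath 0 u g) \<noteq> 0" by (simp add: winding_system_def)
    moreover have "pencil_system \<alpha> (subpath 0 u g) * slit_section \<alpha> (g 0) = slit_section \<alpha> (g u)" using P by simp
    ultimately show ?thesis unfolding sheet_def eq using S0 by (metis divide_divide_eq_left divide_self mult_eq_0_iff)
  qed
  have wall: "pencil_wall \<alpha> g 0 v u = (if v = ?v then sgn (pencil (g u)) else 1)" if "u \<in> {0..1}" for u v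
    using gs[OF that] by (auto simp: pencil_wall_def wall_def sh[OF that] slit_domain_def)
  have other: "crossing (pencil_wall \<alpha> g 0 v) = 0" if "v \<noteq> ?v" for v
  proof -
    have "crossing (pencil_wall \<alpha> g 0 v) = crossing (\<lambda>_. 1)" by (rule crossing_cong) (use wall that in auto)
    also have "\<dots> = 0" by (rule crossing_eq_0) (auto simp: path_def complex_nonpos_Reals_iff)
    finally show ?thesis .
  qed
  have "crossing (pencil_wall \<alpha> g 0 ?v) = 1"
  proof -
    define E where "E = pencil_wall \<alpha> g 0 ?v"
    have Ev: "E u = sgn (pencil (g u))" if "u \<in> {0..1}" for u using wall[OF that] by (simp add: E_def)
    have rc: "path_image g \<subseteq> root_complement" using g(2) by (auto simp: slit_domain_def)
    have cE: "continuous_on {0..1} E"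
      unfolding E_def by (rule continuous_on_pencil_wall) (use g rc in \<open>auto simp: path_def path_image_def\<close>)
    have nE: "- E u \<notin> \<real>\<^sub>\<le>\<^sub>0" if u: "u \<in> {0..1}" for u
    proof -
      have "pencil (g u) \<notin> \<real>\<^sub>\<ge>\<^sub>0" using gs[OF u] by (simp add: slit_domain_def)
      moreover have "z \<in> \<real>\<^sub>\<ge>\<^sub>0" if "- sgn z \<in> \<real>\<^sub>\<le>\<^sub>0" for z :: complex
        using that by (cases "z = 0") (auto simp: complex_nonpos_Reals_iff complex_nonneg_Reals_iff sgn_div_norm field_simps zero_le_divide_iff)
      ultimately show ?thesis unfolding Ev[OF u] by blast
    qed
    \<comment> \<open>Since \<open>E\<close> avoids the nonnegative axis, this logarithm is
      continuous along the path. It equals \<open>Ln\<close> where \<open>Im E > 0\<close> and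
      exceeds it by \<open>2 * pi * \<i>\<close> where \<open>Im E < 0\<close>.\<close>
    have "log_change E = (\<lambda>u. Ln (- E u) + of_real pi * \<i>) 1 - (\<lambda>u. Ln (- E u) + of_real pi * \<i>) 0"
    proof (rule log_change_eq)
      show "path (\<lambda>u. Ln (- E u) + of_real pi * \<i>)"
        unfolding path_def using nE by (intro continuous_intros cE) auto
      show "E u = exp (Ln (- E u) + of_real pi * \<i>)" if "u \<in> {0..1}" for u
      proof -
        have "E u \<noteq> 0" using nE[OF that] by auto
        then show ?thesis by (simp add: exp_add)
      qed
    qed
    moreover have "Im (E 0) > 0" "Im (E 1) < 0"
    proof -
      have "pencil (g 0) \<noteq> 0" "pencil (g 1) \<noteq> 0" using Im by auto
      then show "Im (E 0) > 0" "Im (E 1) < 0" using Im by (simp_all add: Ev Im_sgn divide_neg_pos)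
    qed
    then have "Ln (- E 0) = Ln (E 0) - \<i> * of_real pi" "Ln (- E 1) = Ln (E 1) + \<i> * of_real pi"
      by (subst Ln_minus; force)+
    ultimately show ?thesis unfolding crossing_def E_def[symmetric] by (simp add: field_simps)
  qed
  then have "{v. crossing (pencil_wall \<alpha> g 0 v) \<noteq> 0} = {?v}" using other by auto
  then show ?thesis unfolding pencil_cochain_def using S0 \<open>crossing (pencil_wall \<alpha> g 0 ?v) = 1\<close> by simp
qed

section \<open>The cocycle is not a coboundary\<close>

lemma root_complement_iff_squares:
  "(a, m, e) \<in> root_complement \<longleftrightarrow> a\<^sup>2 \<noteq> e\<^sup>2 \<and> a\<^sup>2 \<noteq> m\<^sup>2 \<and> m\<^sup>2 \<noteq> e\<^sup>2 \<and> m \<noteq> 0 \<and> e \<noteq> 0"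
  by (auto simp: root_complement_iff power2_eq_iff eq_neg_iff_add_eq_0)

lemma real_ratio:
  assumes "z / w = of_real x" "w \<noteq> (0::complex)"
  shows "z = of_real x * w"
  using assms by (simp add: field_simps)

text \<open>On this conic the wall \<open>pencil < 0\<close> is the segment between \<open>-3\<close> and \<open>0\<close> in the coordinate \<open>\<omega>\<close>.\<close>

lemma pencil_conic:
  assumes "a\<^sup>2 = 1 - \<omega>"
  shows "pencil (a, 2, 1) = 4 * \<omega> / (3 + \<omega>)"
    and "(a, 2, 1) \<in> root_complement \<longleftrightarrow> \<omega> \<noteq> 0 \<and> \<omega> \<noteq> -3"
proof -
  have "pencil (a, 2, 1) = (4 * (- \<omega>)) / (- (3 + \<omega>))" by (simp add: pencil_def assms)
  then show "pencil (a, 2, 1) = 4 * \<omega> / (3 + \<omega>)" by (simp only: mult_minus_right minus_divide_divide)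
  show "(a, 2, 1) \<in> root_complement \<longleftrightarrow> \<omega> \<noteq> 0 \<and> \<omega> \<noteq> -3"
    by (auto simp: root_complement_iff_squares assms algebra_simps eq_neg_iff_add_eq_0)
qed

lemma conic_real:
  assumes "4 * \<omega> / (3 + \<omega>) = of_real x" "3 + \<omega> \<noteq> (0::complex)"
  shows "Re \<omega> * (4 - x) = 3 * x" "Im \<omega> * (4 - x) = 0"
proof -
  have "4 * \<omega> = of_real x * (3 + \<omega>)" using real_ratio[OF assms] .
  then have "Re (4 * \<omega>) = Re (of_real x * (3 + \<omega>))" "Im (4 * \<omega>) = Im (of_real x * (3 + \<omega>))" by auto
  then show "Re \<omega> * (4 - x) = 3 * x" "Im \<omega> * (4 - x) = 0" by (simp_all add: algebra_simps)
qed

text \<open>\<open>Re \<omega> < 1\<close> keeps \<open>1 - \<omega>\<close> off the cut of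
  \<open>csqrt\<close>, so the path stays on one branch.\<close>

lemma conic_path:
  assumes "continuous_on {0..1} \<omega>" "\<And>s. s \<in> {0..1} \<Longrightarrow> Re (\<omega> s) < 1 \<and> Re (\<omega> s) > -3 \<and> \<omega> s \<noteq> 0"
  shows "path (\<lambda>s. (csqrt (1 - \<omega> s), 2, 1))" "path_image (\<lambda>s. (csqrt (1 - \<omega> s), 2, 1)) \<subseteq> root_complement"
proof -
  have "continuous_on {0..1} (\<lambda>s. csqrt (1 - \<omega> s))"
  proof (rule continuous_on_compose2[OF continuous_on_csqrt])
    show "continuous_on {0..1} (\<lambda>s. 1 - \<omega> s)" by (intro continuous_intros assms)
    show "(\<lambda>s. 1 - \<omega> s) ` {0..1} \<subseteq> - \<real>\<^sub>\<le>\<^sub>0"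
      using assms(2) by (fastforce simp: complex_nonpos_Reals_iff)
  qed
  then show "path (\<lambda>s. (csqrt (1 - \<omega> s), 2, 1))"
    unfolding path_def by (intro continuous_intros)
  have "\<omega> s \<noteq> -3" if "s \<in> {0..1}" for s using assms(2)[OF that] by auto
  then show "path_image (\<lambda>s. (csqrt (1 - \<omega> s), 2, 1)) \<subseteq> root_complement"
    using assms(2) by (auto simp: path_image_def pencil_conic(2)[OF power2_csqrt])
qed

text \<open>With \<open>e = 1\<close> the pencil becomes
  \<open>m\<^sup>2 / (2 * m\<^sup>2 - 1)\<close>, which is real and nonpositive only for
  \<open>0 \<le> m\<^sup>2 < 1/2\<close>; the bound \<open>3/4\<close> has square
  \<open>9/16\<close>, above \<open>1/2\<close>.\<close>

lemma pencil_line: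
  assumes a: "a\<^sup>2 = 1/2" and m: "3/4 \<le> norm m"
  shows "pencil (a, m, 1) \<notin> \<real>\<^sub>\<le>\<^sub>0" "m\<^sup>2 \<noteq> a\<^sup>2"
proof -
  have "(3/4)\<^sup>2 \<le> (norm m)\<^sup>2" using m by (intro power_mono) auto
  then have n: "9/16 \<le> norm (m\<^sup>2)" by (simp add: norm_mult power2_eq_square)
  show ma: "m\<^sup>2 \<noteq> a\<^sup>2"
  proof
    assume "m\<^sup>2 = a\<^sup>2"
    then have "norm (m\<^sup>2) = norm (1/2 :: complex)" by (simp only: a)
    then show False using n by simp
  qed
  have nz: "2 * m\<^sup>2 - 1 \<noteq> 0"
  proof
    assume "2 * m\<^sup>2 - 1 = 0"
    then have "m\<^sup>2 = 1/2" by (simp add: field_simps)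
    then show False using ma a by simp
  qed
  have e: "pencil (a, m, 1) = m\<^sup>2 / (2 * m\<^sup>2 - 1)"
    using nz by (simp add: pencil_def a field_simps)
  show "pencil (a, m, 1) \<notin> \<real>\<^sub>\<le>\<^sub>0"
  proof
    assume "pencil (a, m, 1) \<in> \<real>\<^sub>\<le>\<^sub>0"
    then obtain x where x: "pencil (a, m, 1) = of_real x" "x \<le> 0" by (elim nonpos_Reals_cases)
    have "m\<^sup>2 = of_real x * (2 * m\<^sup>2 - 1)" using real_ratio[OF x(1)[unfolded e] nz] .
    then have "m\<^sup>2 * of_real (1 - 2 * x) = of_real (- x)" by (simp add: algebra_simps)
    then have "norm (m\<^sup>2 * of_real (1 - 2 * x)) = norm (of_real (- x) :: complex)" by simp
    then have "norm (m\<^sup>2) * \<bar>1 - 2 * x\<bar> = \<bar>- x\<bar>" unfolding norm_mult norm_of_real .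
    then have "norm (m\<^sup>2) * (1 - 2 * x) = - x" using x(2) by simp
    moreover have "9/16 * (1 - 2 * x) \<le> norm (m\<^sup>2) * (1 - 2 * x)" using n x(2) by (intro mult_right_mono) auto
    ultimately show False using x(2) by simp
  qed
qed

text \<open>A meridian of plane 6 has monodromy \<open>-1\<close> and can be placed off the wall, so
  a flat section vanishes at its base point. The zero spreads along paths that miss the wall to both
  of its sides. A path that crosses there once would then have value 0.\<close>

theorem pencil_cochain_not_flat: "\<nexists>h. flat_on (pencil_system \<alpha>) (pencil_cochain \<alpha>) root_complement h"
proof
  assume "\<exists>h. flat_on (pencil_system \<alpha>) (pencil_cochain \<alpha>) root_complement h"
  then obtain h where h: "flat_on (pencil_system \<alpha>) (pencil_cochain \<alpha>) root_complement h" ..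
  have zero: "h (pathfinish g) = 0 \<longleftrightarrow> h (pathstart g) = 0"
    if "path g" "path_image g \<subseteq> root_complement" "\<And>u. u \<in> {0..1} \<Longrightarrow> pencil (g u) \<notin> \<real>\<^sub>\<le>\<^sub>0" for g
  proof -
    have "0 = pencil_system \<alpha> g * h (pathfinish g) - h (pathstart g)"
      using flat_onD[OF h that(1,2)] pencil_cochain_eq_0[OF that] by simp
    moreover have "pencil_system \<alpha> g \<noteq> 0" by (simp add: winding_system_def)
    ultimately show ?thesis by auto
  qed
  \<comment> \<open>The line with this \<open>a\<close> and \<open>e = 1\<close> meets the conic at
    \<open>m = 2\<close>, where \<open>\<omega> = 1/2\<close>.\<close>
  define a where "a = csqrt (1/2)"
  have a2: "a\<^sup>2 = 1/2" unfolding a_def by (rule power2_csqrt)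
  have line_rc: "(a, m, 1) \<in> root_complement" if "3/4 \<le> norm m" "m\<^sup>2 \<noteq> 1" for m
    using that pencil_line(2)[OF a2 that(1)] by (auto simp: root_complement_iff_squares a2)
  have near1: "3/4 \<le> norm (1 + z / 4)" if "norm z \<le> 1" for z :: complex
    using norm_triangle_ineq2[of 1 "- z / 4"] that by (simp add: norm_divide)
  have sq1: "(1 + z / 4)\<^sup>2 \<noteq> 1" if "z \<noteq> 0" "norm z \<le> 1" for z :: complex
  proof
    assume "(1 + z / 4)\<^sup>2 = 1"
    then have "1 + z / 4 = 1 \<or> 1 + z / 4 = -1" by (simp add: power2_eq_1_iff)
    then have "1 + z / 4 = -1" using that(1) by simp
    then have "z / 4 = -1 - 1" by (metis add_diff_cancel_left')
    then have "norm (z / 4) = 2" by simp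
    then show False using that(2) by (simp add: norm_divide)
  qed
  \<comment> \<open>Around \<open>m = e = 1\<close>, with radius \<open>1/4\<close>, so that
    \<open>norm m\<close> stays at least \<open>3/4\<close> and the wall is avoided.\<close>
  let ?loop = "\<lambda>s. (a, 1 + rot s / 4, 1)"
  have "pencil_system \<alpha> (\<lambda>s. (a, 1, 1) + csmul (rot s) (0, 1/4, 0)) = exp (2 * of_real pi * \<i> * pencil_exponent \<alpha> 6)"
  proof (rule meridionalD[OF meridional_winding_system[OF refl], of 6])
    have "a + 1 \<noteq> 0" "a - 1 \<noteq> 0"
      using a2 by (auto simp: eq_neg_iff_add_eq_0[symmetric])
    then have "\<forall>j. j \<noteq> 6 \<longrightarrow> root_form j (a, 1, 1) \<noteq> 0" unfolding forall_8 by auto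
    then show "root_form j (a, 1, 1) \<noteq> 0" if "j \<noteq> 6" for j using that by blast
    show "(a, 1, 1) + csmul z (0, 1/4, 0) \<in> root_complement" if "z \<noteq> 0" "norm z \<le> 1" for z
      using line_rc[OF near1 sq1] that by simp
  qed auto
  then have L: "pencil_system \<alpha> ?loop = -1"
    by (simp add: pencil_exponent_def exp_minus exp_pi_i')
  have "path ?loop" unfolding path_def by (intro continuous_intros) auto
  moreover have "path_image ?loop \<subseteq> root_complement"
    using line_rc[OF near1 sq1] by (auto simp: path_image_def)
  moreover have "pencil (?loop u) \<notin> \<real>\<^sub>\<le>\<^sub>0" for u using pencil_line(1)[OF a2 near1] by simp
  ultimately have "0 = pencil_system \<alpha> ?loop * h (pathfinish ?loop) - h (pathstart ?loop)"
    using flat_onD[OF h, of ?loop] pencil_cochain_eq_0[of ?loop \<alpha>] by simp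
  then have h54: "h (a, 5/4, 1) = 0" unfolding L by (simp add: pathstart_def pathfinish_def)
  have h2: "h (a, 2, 1) = 0"
  proof -
    let ?g = "\<lambda>s. (a, complex_of_real (5/4 + 3/4 * s), 1 :: complex)"
    have n: "3/4 \<le> norm (complex_of_real (5/4 + 3/4 * s))" "(complex_of_real (5/4 + 3/4 * s))\<^sup>2 \<noteq> 1" if "s \<in> {0..1}" for s
    proof -
      have "0 \<le> s" using that by simp
      then show "3/4 \<le> norm (complex_of_real (5/4 + 3/4 * s))" by (simp only: norm_of_real)
      have "5/4 + 3/4 * s \<noteq> 1" "5/4 + 3/4 * s \<noteq> -1" using \<open>0 \<le> s\<close> by auto
      then show "(complex_of_real (5/4 + 3/4 * s))\<^sup>2 \<noteq> 1"
        unfolding power2_eq_1_iff by (metis of_real_1 of_real_eq_iff of_real_minus)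
    qed
    have "h (pathfinish ?g) = 0 \<longleftrightarrow> h (pathstart ?g) = 0"
    proof (rule zero)
      show "path ?g" unfolding path_def by (intro continuous_intros)
      show "path_image ?g \<subseteq> root_complement" using line_rc n by (auto simp: path_image_def simp del: of_real_add)
      show "pencil (?g u) \<notin> \<real>\<^sub>\<le>\<^sub>0" if "u \<in> {0..1}" for u using pencil_line(1)[OF a2 n(1)[OF that]] .
    qed
    then show ?thesis using h54 by (simp add: pathstart_def pathfinish_def)
  qed
  have hend: "h (csqrt (1 - (-1 + of_real \<epsilon> * \<i>) / 2), 2, 1) = 0" if \<epsilon>: "\<epsilon> = 1 \<or> \<epsilon> = -1" for \<epsilon> :: real
  proof -
    \<comment> \<open>Straight from \<open>1/2\<close> to
      \<open>(-1 + \<epsilon> * \<i>) / 2\<close>; only the start is real, and it lies outside the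
      wall segment from \<open>-3\<close> to \<open>0\<close>.\<close>
    let ?\<omega> = "\<lambda>s. 1/2 + of_real s * (-1 + of_real \<epsilon> * \<i> / 2)"
    let ?g = "\<lambda>s. (csqrt (1 - ?\<omega> s), 2 :: complex, 1 :: complex)"
    have Re: "Re (?\<omega> s) = 1/2 - s" and Im: "Im (?\<omega> s) = s * \<epsilon> / 2" for s by simp_all
    have \<omega>: "Re (?\<omega> s) < 1 \<and> Re (?\<omega> s) > -3 \<and> ?\<omega> s \<noteq> 0" if "s \<in> {0..1}" for s
    proof -
      have "?\<omega> s \<noteq> 0"
      proof
        assume "?\<omega> s = 0"
        then have "Re (?\<omega> s) = 0" "Im (?\<omega> s) = 0" by simp_all
        then show False using \<epsilon> unfolding Re Im by auto
      qed
      then show ?thesis using that unfolding Re by auto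
    qed
    have c: "continuous_on {0..1} ?\<omega>" by (intro continuous_intros) auto
    have "h (pathfinish ?g) = 0 \<longleftrightarrow> h (pathstart ?g) = 0"
    proof (rule zero[OF conic_path[OF c \<omega>]])
      fix s :: real assume s: "s \<in> {0..1}"
      show "pencil (?g s) \<notin> \<real>\<^sub>\<le>\<^sub>0"
      proof
        assume "pencil (?g s) \<in> \<real>\<^sub>\<le>\<^sub>0"
        then obtain x where x: "pencil (?g s) = of_real x" "x \<le> 0" by (elim nonpos_Reals_cases)
        have nz: "3 + ?\<omega> s \<noteq> 0"
        proof
          assume "3 + ?\<omega> s = 0"
          then have "Re (3 + ?\<omega> s) = 0" by (simp only: zero_complex.simps)
          then show False using \<omega>[OF s] by simp
        qed
        have r: "(1/2 - s) * (4 - x) = 3 * x" "(s * \<epsilon> / 2) * (4 - x) = 0"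
          using conic_real[OF x(1)[unfolded pencil_conic(1)[OF power2_csqrt]] nz] unfolding Re Im by auto
        have "s = 0" using r(2) \<epsilon> x(2) by auto
        then show False using r(1) x(2) by simp
      qed
    qed auto
    moreover have "pathstart ?g = (a, 2, 1)" by (simp add: pathstart_def a_def)
    moreover have "pathfinish ?g = (csqrt (1 - (-1 + of_real \<epsilon> * \<i>) / 2), 2, 1)"
      by (simp add: pathfinish_def field_simps)
    ultimately show ?thesis using h2 by simp
  qed
  \<comment> \<open>Straight down from \<open>(-1 + \<i>) / 2\<close> to
    \<open>(-1 - \<i>) / 2\<close>, through the wall at \<open>-1/2\<close>.\<close>
  let ?\<omega> = "\<lambda>s. -1/2 + of_real (1/2 - s) * \<i>"
  let ?g = "\<lambda>s. (csqrt (1 - ?\<omega> s), 2 :: complex, 1 :: complex)"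
  have Re: "Re (?\<omega> s) = -1/2" and Im: "Im (?\<omega> s) = 1/2 - s" for s by simp_all
  have \<omega>: "Re (?\<omega> s) < 1 \<and> Re (?\<omega> s) > -3 \<and> ?\<omega> s \<noteq> 0" for s
  proof -
    have "?\<omega> s \<noteq> 0"
    proof
      assume "?\<omega> s = 0"
      then have "Re (?\<omega> s) = 0" by (simp only: zero_complex.simps)
      then show False unfolding Re by simp
    qed
    then show ?thesis unfolding Re by auto
  qed
  have nz: "3 + ?\<omega> s \<noteq> 0" for s
  proof
    assume "3 + ?\<omega> s = 0"
    then have "Re (3 + ?\<omega> s) = 0" by (simp only: zero_complex.simps)
    then show False using \<omega>[of s] by simp
  qed
  have c: "continuous_on {0..1} ?\<omega>" by (intro continuous_intros) auto
  note gp = conic_path[OF c \<omega>]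
  have "pencil (?g s) \<notin> \<real>\<^sub>\<ge>\<^sub>0" for s
  proof
    assume "pencil (?g s) \<in> \<real>\<^sub>\<ge>\<^sub>0"
    then obtain x where x: "pencil (?g s) = of_real x" "0 \<le> x" by (elim nonneg_Reals_cases)
    have "(-1/2) * (4 - x) = 3 * x"
      using conic_real(1)[OF x(1)[unfolded pencil_conic(1)[OF power2_csqrt]] nz] unfolding Re .
    then have "- (4 - x) = 6 * x" by (simp add: field_simps)
    then show False using x(2) by linarith
  qed
  then have slit: "path_image ?g \<subseteq> slit_domain" using gp(2) by (auto simp: slit_domain_def path_image_def)
  have Im_pencil: "Im (pencil (?g s)) = 12 * (1/2 - s) / (norm (3 + ?\<omega> s))\<^sup>2" for s
  proof -
    have "Im (4 * z / (3 + z)) = 12 * Im z / (norm (3 + z))\<^sup>2" for z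
    proof -
      have eq: "Im (4 * z) * Re (3 + z) - Re (4 * z) * Im (3 + z) = 12 * Im z" by (simp add: algebra_simps)
      show ?thesis unfolding Im_divide cmod_power2 eq ..
    qed
    then have "Im (pencil (?g s)) = 12 * Im (?\<omega> s) / (norm (3 + ?\<omega> s))\<^sup>2"
      unfolding pencil_conic(1)[OF power2_csqrt] by blast
    then show ?thesis unfolding Im .
  qed
  have pos: "(norm (3 + ?\<omega> s))\<^sup>2 > 0" for s using nz[of s] by simp
  have "pencil_cochain \<alpha> ?g \<noteq> 0"
  proof (rule pencil_cochain_nonzero[OF gp(1) slit])
    show "0 < Im (pencil (?g 0))" unfolding Im_pencil using pos[of 0] by (intro divide_pos_pos) simp_all
    show "Im (pencil (?g 1)) < 0" unfolding Im_pencil using pos[of 1] by (intro divide_neg_pos) simp_all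
  qed
  moreover have "pencil_cochain \<alpha> ?g = pencil_system \<alpha> ?g * h (pathfinish ?g) - h (pathstart ?g)"
    by (rule flat_onD[OF h gp])
  moreover have "pathstart ?g = (csqrt (1 - (-1 + of_real 1 * \<i>) / 2), 2, 1)"
    "pathfinish ?g = (csqrt (1 - (-1 + of_real (-1) * \<i>) / 2), 2, 1)"
  proof -
    have e: "?\<omega> 0 = (-1 + of_real 1 * \<i>) / 2" "?\<omega> 1 = (-1 + of_real (-1) * \<i>) / 2" by (simp_all add: complex_eq_iff)
    show "pathstart ?g = (csqrt (1 - (-1 + of_real 1 * \<i>) / 2), 2, 1)"
      "pathfinish ?g = (csqrt (1 - (-1 + of_real (-1) * \<i>) / 2), 2, 1)"
      unfolding pathstart_def pathfinish_def e by (rule refl)+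
  qed
  ultimately show False using hend[of 1] hend[of "-1"] by simp
qed

lemma exp_pencil_exponent:
  assumes "exp (2 * of_real pi * \<i> * \<alpha>) = t"
  shows "exp (2 * of_real pi * \<i> * pencil_exponent \<alpha> i) =
    (vector [t, - inverse t, - inverse t, t, t ^ 2, - 1, inverse (t ^ 2), - 1] :: complex^8) $ i"
proof -
  have t: "t \<noteq> 0" using assms by auto
  have h: "exp (2 * of_real pi * \<i> * (1/2 - \<alpha>)) = - inverse t"
  proof -
    have "2 * of_real pi * \<i> * (1/2 - \<alpha>) = \<i> * of_real pi - 2 * of_real pi * \<i> * \<alpha>" by (simp add: algebra_simps)
    then show ?thesis using assms by (simp only: exp_diff exp_pi_i') (simp add: inverse_eq_divide)
  qed
  have d: "exp (2 * of_real pi * \<i> * (2 * \<alpha>)) = t\<^sup>2"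
    using assms by (metis exp_double mult.left_commute)
  have m: "exp (2 * of_real pi * \<i> * (- 2 * \<alpha>)) = inverse (t\<^sup>2)"
    using d by (metis exp_minus mult_minus_left mult_minus_right)
  have n: "exp (2 * of_real pi * \<i> * (- 1/2)) = -1"
    by (simp add: exp_minus mult.commute exp_pi_i')
  have "\<forall>i. exp (2 * of_real pi * \<i> * pencil_exponent \<alpha> i) =
    (vector [t, - inverse t, - inverse t, t, t ^ 2, - 1, inverse (t ^ 2), - 1] :: complex^8) $ i"
    unfolding forall_8 pencil_exponent_def vector_8 using h d m n assms by auto
  then show ?thesis ..
qed

lemma translated_torus_subset_characteristic_variety:
  assumes "t \<noteq> 0"
  shows "vector [t, - inverse t, - inverse t, t, t ^ 2, - 1, inverse (t ^ 2), - 1] \<in> characteristic_variety 1 deleted_B3"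
    (is "?v \<in> _")
proof -
  let ?X = "arrangement_complement deleted_B3"
  define \<alpha> where "\<alpha> = Ln t / (2 * of_real pi * \<i>)"
  have "exp (2 * of_real pi * \<i> * \<alpha>) = t" using assms by (simp add: \<alpha>_def)
  note ex = exp_pencil_exponent[OF this]
  let ?L = "winding_system (\<lambda>i w. deleted_B3_forms w $ i) (pencil_exponent \<alpha>)"
  have loc: "local_system_of_character deleted_B3 ?v ?L"
    by (rule local_system_of_character_winding_system) (rule ex)
  have L: "?L g = pencil_system \<alpha> (to_roots \<circ> g)" for g
    by (simp add: winding_system_def o_def root_form_to_roots)
  let ?c = "\<lambda>g. pencil_cochain \<alpha> (to_roots \<circ> g)"
  have r1: "rank_one_local_system ?X ?L" using loc by (simp add: local_system_of_character_def)
  have "triangle_cocycle ?X ?L ?c"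
    unfolding triangle_cocycle_def
  proof clarify
    fix G p q r
    assume G: "continuous_on unit_triangle G" "G ` unit_triangle \<subseteq> ?X"
      and e: "\<forall>u\<in>{0..1}. p u = G (u, 0)" "\<forall>u\<in>{0..1}. q u = G (1 - u, u)" "\<forall>u\<in>{0..1}. r u = G (0, u)"
    show "?c p + ?L p * ?c q = ?c r"
      unfolding L
      by (rule triangle_cocycleD[OF triangle_cocycle_pencil continuous_on_compose[OF G(1) continuous_on_roots(2)]])
        (use G(2) e in \<open>auto simp: in_arrangement_complement_iff image_subset_iff\<close>)
  qed
  moreover have "\<nexists>h. flat_on ?L ?c ?X h"
  proof
    assume "\<exists>h. flat_on ?L ?c ?X h"
    then obtain h where h: "flat_on ?L ?c ?X h" ..
    interpret affine_transport ?X ?L ?c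
      using r1 \<open>triangle_cocycle ?X ?L ?c\<close> by (rule affine_transport_of_triangle_cocycle)
    have "flat_on (\<lambda>g. ?L (from_roots \<circ> g)) (\<lambda>g. ?c (from_roots \<circ> g)) root_complement (h \<circ> from_roots)"
      by (rule flat_on_pullback[OF h continuous_on_roots(1)]) (auto simp: in_arrangement_complement_iff)
    moreover have "to_roots \<circ> (from_roots \<circ> g) = g" for g :: "real \<Rightarrow> c3" by (simp add: fun_eq_iff)
    ultimately show False using pencil_cochain_not_flat unfolding L by auto
  qed
  ultimately have dim: "enat 1 \<le> twisted_cohomology_dim 1 ?X ?L"
    by (rule cohomology_of_nonflat_triangle_cocycle[OF r1])
  have "\<forall>i. ?v $ i \<noteq> 0" unfolding forall_8 vector_8 using assms by auto
  then have "?v \<in> torus" by (simp add: torus_def)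
  then show ?thesis using loc dim unfolding characteristic_variety_def by blast
qed

section \<open>Zariski closed subsets of the torus\<close>

lemma closedin_zariski_zeros:
  assumes "laurent_polynomial f"
  shows "closedin zariski_torus {t \<in> torus. f t = 0}"
proof -
  have "openin zariski_torus {t \<in> torus. f t \<noteq> 0}"
    unfolding zariski_torus_def by (rule topology_generated_by_Basis) (use assms in blast)
  moreover have "torus - {t \<in> torus. f t = 0} = {t \<in> torus. f t \<noteq> 0}" by auto
  ultimately show ?thesis by (simp add: closedin_def topspace_zariski_torus)
qed

text \<open>Products of Laurent polynomials make the generating sets closed under intersection, so
  they already form a basis.\<close>

lemma zariski_basic_nbhd:
  assumes "openin zariski_torus U" "x \<in> U"
  obtains f where "laurent_polynomial f" "f x \<noteq> 0" "{t \<in> torus. f t \<noteq> 0} \<subseteq> U"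
proof -
  have "generate_topology_on {{t \<in> torus. f t \<noteq> 0} | f :: complex^'a \<Rightarrow> complex. laurent_polynomial f} U"
    using assms(1) by (simp add: zariski_torus_def openin_topology_generated_by_iff)
  then have "\<forall>x\<in>U. \<exists>f. laurent_polynomial f \<and> f x \<noteq> 0 \<and> {t \<in> torus. f t \<noteq> 0} \<subseteq> U"
  proof induction
    case Empty
    then show ?case by simp
  next
    case (Int a b)
    show ?case
    proof
      fix x assume "x \<in> a \<inter> b"
      then obtain f g where "laurent_polynomial f" "f x \<noteq> 0" "{t \<in> torus. f t \<noteq> 0} \<subseteq> a"
        "laurent_polynomial g" "g x \<noteq> 0" "{t \<in> torus. g t \<noteq> 0} \<subseteq> b" using Int by blast
      then show "\<exists>f. laurent_polynomial f \<and> f x \<noteq> 0 \<and> {t \<in> torus. f t \<noteq> 0} \<subseteq> a \<inter> b"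
        by (intro exI[of _ "\<lambda>t. f t * g t"]) (auto intro: laurent_polynomial.mult)
    qed
  next
    case (UN K)
    then show ?case by blast
  next
    case (Basis s)
    then show ?case by blast
  qed
  then show thesis using that assms(2) by blast
qed

text \<open>
  Along a monomial curve a Laurent polynomial becomes, up to a power of the parameter, a polynomial in
  one variable, so it vanishes identically or only at finitely many points.
\<close>

lemma laurent_polynomial_on_curve:
  fixes \<phi> :: "complex \<Rightarrow> complex^'n"
  assumes f: "laurent_polynomial f"
    and \<phi>: "\<And>i. \<exists>p n. \<forall>s. s \<noteq> 0 \<longrightarrow> \<phi> s $ i * s ^ n = poly p s"
      "\<And>i. \<exists>p n. \<forall>s. s \<noteq> 0 \<longrightarrow> inverse (\<phi> s $ i) * s ^ n = poly p s"
  shows "\<exists>p n. \<forall>s. s \<noteq> 0 \<longrightarrow> f (\<phi> s) * s ^ n = poly p s"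
  using f
proof induction
  case (const c)
  show ?case by (intro exI[of _ "[:c:]"] exI[of _ 0]) simp
next
  case (coord i)
  show ?case by (rule \<phi>(1))
next
  case (coord_inverse i)
  show ?case by (rule \<phi>(2))
next
  case (add f g)
  then obtain p n q m where *: "\<And>s. s \<noteq> 0 \<Longrightarrow> f (\<phi> s) * s ^ n = poly p s" "\<And>s. s \<noteq> 0 \<Longrightarrow> g (\<phi> s) * s ^ m = poly q s"
    by blast
  have "(f (\<phi> s) + g (\<phi> s)) * s ^ (n + m) = poly (p * monom 1 m + q * monom 1 n) s" if "s \<noteq> 0" for s
  proof -
    have "(f (\<phi> s) + g (\<phi> s)) * s ^ (n + m) = (f (\<phi> s) * s ^ n) * s ^ m + (g (\<phi> s) * s ^ m) * s ^ n"
      by (simp add: power_add algebra_simps)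
    then show ?thesis unfolding *(1)[OF that] *(2)[OF that] by (simp add: poly_monom)
  qed
  then show ?case by blast
next
  case (mult f g)
  then obtain p n q m where *: "\<And>s. s \<noteq> 0 \<Longrightarrow> f (\<phi> s) * s ^ n = poly p s" "\<And>s. s \<noteq> 0 \<Longrightarrow> g (\<phi> s) * s ^ m = poly q s"
    by blast
  have "(f (\<phi> s) * g (\<phi> s)) * s ^ (n + m) = poly (p * q) s" if "s \<noteq> 0" for s
  proof -
    have "(f (\<phi> s) * g (\<phi> s)) * s ^ (n + m) = (f (\<phi> s) * s ^ n) * (g (\<phi> s) * s ^ m)"
      by (simp add: power_add algebra_simps)
    then show ?thesis unfolding *(1)[OF that] *(2)[OF that] by simp
  qed
  then show ?case by blast
qed

text \<open>A closed set that does not contain the curve misses some set \<open>f \<noteq> 0\<close>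
  that meets the curve, and \<open>f\<close> vanishes at only finitely many parameters. For two such
  sets infinitely many parameters remain that avoid both.\<close>

lemma irreducible_in_curve:
  fixes \<phi> :: "complex \<Rightarrow> complex^'n"
  assumes \<phi>: "\<And>i. \<exists>p n. \<forall>s. s \<noteq> 0 \<longrightarrow> \<phi> s $ i * s ^ n = poly p s"
      "\<And>i. \<exists>p n. \<forall>s. s \<noteq> 0 \<longrightarrow> inverse (\<phi> s $ i) * s ^ n = poly p s"
    and torus: "\<And>s. s \<noteq> 0 \<Longrightarrow> \<phi> s \<in> torus"
  shows "irreducible_in zariski_torus (\<phi> ` (- {0}))"
  unfolding irreducible_in_def topspace_zariski_torus
proof (intro conjI allI impI)
  show "\<phi> ` (- {0}) \<noteq> {}" by auto
  show "\<phi> ` (- {0}) \<subseteq> torus" using torus by auto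
  fix A B assume *: "closedin zariski_torus A \<and> closedin zariski_torus B \<and> \<phi> ` (- {0}) \<subseteq> A \<union> B"
  have fin: "finite {s. s \<noteq> 0 \<and> f (\<phi> s) = 0}" if f: "laurent_polynomial f" and x: "x \<noteq> 0" "f (\<phi> x) \<noteq> 0" for f x
  proof -
    obtain p n where p: "\<And>s. s \<noteq> 0 \<Longrightarrow> f (\<phi> s) * s ^ n = poly p s"
      using laurent_polynomial_on_curve[OF f \<phi>] by blast
    have "poly p x \<noteq> 0" unfolding p[OF x(1), symmetric] using x by simp
    then have "p \<noteq> 0" by auto
    then have "finite {s. poly p s = 0}" by (rule poly_roots_finite)
    then show ?thesis by (rule finite_subset[rotated]) (auto simp flip: p)
  qed
  have sep: "\<exists>f x. laurent_polynomial f \<and> x \<noteq> 0 \<and> f (\<phi> x) \<noteq> 0 \<and> {t \<in> torus. f t \<noteq> 0} \<inter> D = {}"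
    if D: "closedin zariski_torus D" "\<not> \<phi> ` (- {0}) \<subseteq> D" for D
  proof -
    obtain x where x: "x \<noteq> 0" "\<phi> x \<notin> D" using D(2) by auto
    have "openin zariski_torus (torus - D)" using D(1) by (simp add: closedin_def topspace_zariski_torus)
    moreover have "\<phi> x \<in> torus - D" using x torus by auto
    ultimately obtain f where "laurent_polynomial f" "f (\<phi> x) \<noteq> 0" "{t \<in> torus. f t \<noteq> 0} \<subseteq> torus - D"
      by (rule zariski_basic_nbhd)
    then show ?thesis using x by blast
  qed
  show "\<phi> ` (- {0}) \<subseteq> A \<or> \<phi> ` (- {0}) \<subseteq> B"
  proof (rule ccontr)
    assume "\<not> ?thesis"
    then obtain f x g y where f: "laurent_polynomial f" "x \<noteq> 0" "f (\<phi> x) \<noteq> 0" "{t \<in> torus. f t \<noteq> 0} \<inter> A = {}"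
      and g: "laurent_polynomial g" "y \<noteq> 0" "g (\<phi> y) \<noteq> 0" "{t \<in> torus. g t \<noteq> 0} \<inter> B = {}"
      using sep[of A] sep[of B] * by blast
    have "finite ({s. s \<noteq> 0 \<and> f (\<phi> s) = 0} \<union> {s. s \<noteq> 0 \<and> g (\<phi> s) = 0} \<union> {0})"
      using fin[OF f(1-3)] fin[OF g(1-3)] by simp
    then obtain s where "s \<notin> {s. s \<noteq> 0 \<and> f (\<phi> s) = 0} \<union> {s. s \<noteq> 0 \<and> g (\<phi> s) = 0} \<union> {0}"
      using infinite_UNIV_char_0[where 'a=complex] finite_subset[of UNIV] by blast
    then have s: "s \<noteq> 0" "f (\<phi> s) \<noteq> 0" "g (\<phi> s) \<noteq> 0" by auto
    then have "\<phi> s \<in> A \<union> B" "\<phi> s \<in> torus" using * torus by auto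
    then show False using s f(4) g(4) by auto
  qed
qed

text \<open>Treats the subtorus, \<open>c = 1\<close>, and its translate,
  \<open>c = translation\<close>, at once. The first entry carries no coefficient and recovers the
  parameter.\<close>

definition translated_curve :: "complex^8 \<Rightarrow> complex \<Rightarrow> complex^8" where
  "translated_curve c t = vector [t, c $ 2 * inverse t, c $ 3 * inverse t, t, t\<^sup>2, c $ 6, (inverse t)\<^sup>2, c $ 8]"

lemma monomial_laurent:
  fixes t :: complex
  shows "\<exists>p n. \<forall>s. s \<noteq> 0 \<longrightarrow> c * s * s ^ n = poly p s"
    and "\<exists>p n. \<forall>s. s \<noteq> 0 \<longrightarrow> c * inverse s * s ^ n = poly p s"
    and "\<exists>p n. \<forall>s. s \<noteq> 0 \<longrightarrow> c * s\<^sup>2 * s ^ n = poly p s"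
    and "\<exists>p n. \<forall>s. s \<noteq> 0 \<longrightarrow> c * inverse (s\<^sup>2) * s ^ n = poly p s"
    and "\<exists>p n. \<forall>s. s \<noteq> 0 \<longrightarrow> c * s ^ n = poly p (s :: complex)"
proof -
  show "\<exists>p n. \<forall>s. s \<noteq> 0 \<longrightarrow> c * s * s ^ n = poly p s" by (intro exI[of _ "[:0, c:]"] exI[of _ 0]) simp
  show "\<exists>p n. \<forall>s. s \<noteq> 0 \<longrightarrow> c * inverse s * s ^ n = poly p s" by (intro exI[of _ "[:c:]"] exI[of _ 1]) simp
  show "\<exists>p n. \<forall>s. s \<noteq> 0 \<longrightarrow> c * s\<^sup>2 * s ^ n = poly p s" by (intro exI[of _ "[:0, 0, c:]"] exI[of _ 0]) (simp add: power2_eq_square)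
  show "\<exists>p n. \<forall>s. s \<noteq> 0 \<longrightarrow> c * inverse (s\<^sup>2) * s ^ n = poly p s" by (intro exI[of _ "[:c:]"] exI[of _ 2]) simp
  show "\<exists>p n. \<forall>s. s \<noteq> 0 \<longrightarrow> c * s ^ n = poly p (s :: complex)" by (intro exI[of _ "[:c:]"] exI[of _ 0]) simp
qed

lemma translated_curve_in_torus: "c \<in> torus \<Longrightarrow> t \<noteq> 0 \<Longrightarrow> translated_curve c t \<in> torus"
proof -
  assume "c \<in> torus" "t \<noteq> 0"
  then have "\<forall>i. translated_curve c t $ i \<noteq> 0"
    unfolding forall_8 translated_curve_def vector_8 by (auto simp: torus_def)
  then show ?thesis by (simp add: torus_def)
qed

lemma irreducible_translated_curve:
  assumes "c \<in> torus"
  shows "irreducible_in zariski_torus (translated_curve c ` (- {0}))"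
proof (rule irreducible_in_curve)
  have "\<forall>i. \<exists>p n. \<forall>s. s \<noteq> 0 \<longrightarrow> translated_curve c s $ i * s ^ n = poly p s"
    unfolding forall_8 translated_curve_def vector_8
    using monomial_laurent[of 1] monomial_laurent(2,5) by (simp add: power_inverse)
  then show "\<exists>p n. \<forall>s. s \<noteq> 0 \<longrightarrow> translated_curve c s $ i * s ^ n = poly p s" for i ..
  have "\<forall>i. \<exists>p n. \<forall>s. s \<noteq> 0 \<longrightarrow> inverse (translated_curve c s $ i) * s ^ n = poly p s"
    unfolding forall_8 translated_curve_def vector_8
    using monomial_laurent[of 1] monomial_laurent(1,5) by (simp add: power_inverse)
  then show "\<exists>p n. \<forall>s. s \<noteq> 0 \<longrightarrow> inverse (translated_curve c s $ i) * s ^ n = poly p s" for i ..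
qed (use assms translated_curve_in_torus in auto)

lemma laurent_polynomial_diff:
  "laurent_polynomial f \<Longrightarrow> laurent_polynomial g \<Longrightarrow> laurent_polynomial (\<lambda>t. f t - g t)"
  using laurent_polynomial.add[OF _ laurent_polynomial.mult[OF laurent_polynomial.const], of f g "- 1"] by simp

lemma laurent_polynomial_power: "laurent_polynomial f \<Longrightarrow> laurent_polynomial (\<lambda>t. f t ^ n)"
  by (induction n) (auto intro: laurent_polynomial.const laurent_polynomial.mult)

lemma laurent_polynomial_prod:
  "(\<And>i. i \<in> I \<Longrightarrow> laurent_polynomial (f i)) \<Longrightarrow> laurent_polynomial (\<lambda>t. \<Prod>i\<in>I. f i t)"
  by (induction I rule: infinite_finite_induct) (auto intro: laurent_polynomial.const laurent_polynomial.mult)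

lemmas laurent_intros = laurent_polynomial.intros laurent_polynomial_diff laurent_polynomial_power laurent_polynomial_prod

lemma closedin_zariski_equations:
  assumes "finite I" "I \<noteq> {}" "\<And>i. i \<in> I \<Longrightarrow> laurent_polynomial (f i)"
  shows "closedin zariski_torus {t \<in> torus. \<forall>i\<in>I. f i t = 0}"
proof -
  have "{t \<in> torus. \<forall>i\<in>I. f i t = 0} = (\<Inter>i\<in>I. {t \<in> torus. f i t = 0})" using assms(2) by auto
  then show ?thesis using assms by (auto intro!: closedin_INT closedin_zariski_zeros)
qed

text \<open>The curve is a graph over its first coordinate: each of the other seven entries gives
  one Laurent equation.\<close>

lemma closedin_translated_curve:
  assumes c: "c \<in> torus"
  shows "closedin zariski_torus (translated_curve c ` (- {0}))"
proof -
  let ?I = "{\<lambda>w. vec_nth w 2 - vec_nth c 2 * inverse (vec_nth w 1), \<lambda>w. vec_nth w 3 - vec_nth c 3 * inverse (vec_nth w 1),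
       \<lambda>w. vec_nth w 4 - vec_nth w 1, \<lambda>w. vec_nth w 5 - (vec_nth w 1)\<^sup>2, \<lambda>w. vec_nth w 6 - vec_nth c 6,
       \<lambda>w. vec_nth w 7 - (inverse (vec_nth w 1))\<^sup>2, \<lambda>w. vec_nth w 8 - vec_nth c 8}
       :: (complex^8 \<Rightarrow> complex) set"
  have "laurent_polynomial f" if "f \<in> ?I" for f
    using that by (elim insertE emptyE) (simp_all only:, (intro laurent_intros)+)
  then have "closedin zariski_torus {w \<in> torus. \<forall>f\<in>?I. f w = 0}"
    by (intro closedin_zariski_equations[where f="\<lambda>f. f"]) simp_all
  moreover have "{w \<in> torus. \<forall>f\<in>?I. f w = 0} = translated_curve c ` (- {0})"
  proof (intro equalityI subsetI)
    fix w :: "complex^8" assume w: "w \<in> {w \<in> torus. \<forall>f\<in>?I. f w = 0}"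
    then have "w = translated_curve c (vec_nth w 1)"
      unfolding vec_eq_iff forall_8 translated_curve_def vector_8 by simp
    moreover have "vec_nth w 1 \<noteq> 0" using w by (simp add: torus_def)
    ultimately show "w \<in> translated_curve c ` (- {0})" by blast
  next
    fix w assume "w \<in> translated_curve c ` (- {0})"
    then obtain t where t: "t \<noteq> 0" "w = translated_curve c t" by blast
    then show "w \<in> {w \<in> torus. \<forall>f\<in>?I. f w = 0}"
      using translated_curve_in_torus[OF c t(1)] by (simp add: translated_curve_def)
  qed
  ultimately show ?thesis by simp
qed

lemma translated_curve_mult:
  fixes a :: "complex^8"
  assumes "vec_nth a 1 = 1" "vec_nth a 4 = 1" "vec_nth a 5 = 1" "vec_nth a 7 = 1"
  shows "a * translated_curve 1 t = translated_curve a t"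
  using assms unfolding vec_eq_iff forall_8 translated_curve_def vector_mult_component vector_8 by simp

lemma subtorus_curve: "subtorus TYPE(1) (translated_curve 1 ` (- {0}))"
  unfolding subtorus_def
proof (intro conjI exI)
  let ?\<phi> = "\<lambda>s :: complex^1. translated_curve 1 (s $ 1)" and ?\<psi> = "\<lambda>w :: complex^8. (\<chi> i. w $ 1) :: complex^1"
  have t1: "(1 :: complex^8) \<in> torus" by (simp add: torus_def)
  show "closedin zariski_torus (translated_curve 1 ` (- {0}))"
    by (rule closedin_translated_curve[OF t1])
  have "\<forall>i. laurent_polynomial (\<lambda>s. ?\<phi> s $ i)"
    unfolding forall_8 translated_curve_def vector_8 by (intro conjI laurent_intros)
  then show "\<forall>i. laurent_polynomial (\<lambda>s. ?\<phi> s $ i)" .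
  show "\<forall>j. laurent_polynomial (\<lambda>t. ?\<psi> t $ j)" by (simp add: laurent_intros)
  have nz: "s $ 1 \<noteq> 0" if "s \<in> torus" for s :: "complex^1" using that by (simp add: torus_def)
  show hom: "?\<phi> \<in> hom torus_group torus_group"
  proof (rule homI)
    show "?\<phi> s \<in> carrier torus_group" if "s \<in> carrier torus_group" for s
      using that translated_curve_in_torus[OF t1 nz] by (simp add: torus_group_def)
    show "?\<phi> (s \<otimes>\<^bsub>torus_group\<^esub> u) = ?\<phi> s \<otimes>\<^bsub>torus_group\<^esub> ?\<phi> u" for s u
      unfolding torus_group_def vec_eq_iff forall_8 by (simp add: translated_curve_def power_mult_distrib)
  qed
  show im: "?\<phi> ` torus = translated_curve 1 ` (- {0})"
  proof (intro equalityI subsetI)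
    fix w assume "w \<in> ?\<phi> ` torus"
    then show "w \<in> translated_curve 1 ` (- {0})" using nz by blast
  next
    fix w assume "w \<in> translated_curve 1 ` (- {0})"
    then obtain t where t: "t \<noteq> 0" "w = translated_curve 1 t" by blast
    then have "(\<chi> i. t) \<in> (torus :: (complex^1) set)" "w = ?\<phi> (\<chi> i. t)" by (simp_all add: torus_def)
    then show "w \<in> ?\<phi> ` torus" by blast
  qed
  show "\<forall>s\<in>torus. ?\<psi> (?\<phi> s) = s"
    by (simp add: vec_eq_iff translated_curve_def forall_1)
  have "group_hom torus_group torus_group ?\<phi>"
    by (intro group_hom.intro group_hom_axioms.intro hom comm_group.axioms(2) comm_group_torus_group)
  from group_hom.img_is_subgroup[OF this]
  show "subgroup (translated_curve 1 ` (- {0})) torus_group"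
    using im by (simp add: torus_group_def)
qed

section \<open>The component\<close>

definition translation :: "complex^8" where
  "translation = vector [1, - 1, - 1, 1, 1, - 1, 1, - 1]"

lemma translated_curve_translation:
  "translated_curve translation t = vector [t, - inverse t, - inverse t, t, t ^ 2, - 1, inverse (t ^ 2), - 1]"
  unfolding vec_eq_iff forall_8 translated_curve_def translation_def vector_8 by (simp add: power_inverse)

lemma translation_in_torus: "translation \<in> torus"
proof -
  have "\<forall>i. translation $ i \<noteq> 0" unfolding forall_8 translation_def vector_8 by simp
  then show ?thesis by (simp add: torus_def)
qed

lemma ord_translation: "group.ord torus_group translation = 2"
proof -
  interpret comm_group "torus_group :: (complex^8) monoid" by (rule comm_group_torus_group)
  have car: "translation \<in> carrier torus_group" using translation_in_torus by (simp add: torus_group_def)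
  have "translation * translation = 1"
    unfolding vec_eq_iff forall_8 vector_mult_component translation_def vector_8 by simp
  then have "translation [^]\<^bsub>torus_group\<^esub> (2::nat) = \<one>\<^bsub>torus_group\<^esub>"
    using car by (simp add: numeral_2_eq_2 torus_group_def)
  then have "ord translation dvd 2" using pow_eq_id[OF car] by blast
  moreover have "translation $ 2 \<noteq> 1" by (simp add: translation_def)
  then have "translation \<noteq> \<one>\<^bsub>torus_group\<^esub>" by (auto simp: torus_group_def)
  then have "ord translation \<noteq> 1" using ord_eq_1[OF car] by blast
  ultimately show ?thesis by (metis prime_nat_iff two_is_prime_nat)
qed

text \<open>The hypersurface that contains the part of the characteristic variety away from the translated curve.\<close>

definition exceptional_locus :: "(complex^8) set" where
  "exceptional_locus = {w \<in> torus. (\<Prod>i\<in>UNIV. w $ i - 1) * ((w $ 6)\<^sup>2 + 1) = 0}"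

lemma closedin_exceptional_locus: "closedin zariski_torus exceptional_locus"
  unfolding exceptional_locus_def by (intro closedin_zariski_zeros laurent_intros)

lemma characteristic_variety_subset:
  "characteristic_variety 1 deleted_B3 \<subseteq> translated_curve translation ` (- {0}) \<union> exceptional_locus"
proof
  fix w assume w: "w \<in> characteristic_variety 1 deleted_B3"
  have wt: "w \<in> torus" using w by (simp add: characteristic_variety_def)
  then have w0: "w $ i \<noteq> 0" for i by (simp add: torus_def)
  show "w \<in> translated_curve translation ` (- {0}) \<union> exceptional_locus"
  proof (cases "w \<in> exceptional_locus")
    case False
    then have "(\<Prod>i\<in>UNIV. w $ i - 1) * ((w $ 6)\<^sup>2 + 1) \<noteq> 0" using wt by (simp add: exceptional_locus_def)
    then have w1: "w $ i \<noteq> 1" and w6: "(w $ 6)\<^sup>2 \<noteq> -1" for i by (auto simp: eq_neg_iff_add_eq_0)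
    have "w = translated_curve translation (w $ 1)"
      using obstructed_translated_torus[OF obstructed_of_characteristic_variety[OF w] w0 w1 w6]
      unfolding translated_curve_translation vec_eq_iff forall_8 vector_8 by simp
    then show ?thesis using w0[of 1] by blast
  qed simp
qed

theorem mainTheorem2:
  fixes C :: "(complex^8) set"
  assumes "C = {vector [t, - inverse t, - inverse t, t, t ^ 2, - 1, inverse (t ^ 2), - 1] | t. t \<noteq> 0}"
  shows "irreducible_component_of zariski_torus (characteristic_variety 1 deleted_B3) C \<and>
    (\<exists>\<rho> T. \<rho> \<in> carrier torus_group \<and> group.ord torus_group \<rho> = 2 \<and>
           subtorus TYPE(1) T \<and> C = \<rho> <#\<^bsub>torus_group\<^esub> T) \<and>
    1 \<notin> C"
proof (intro conjI)
  have C: "C = translated_curve translation ` (- {0})"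
    unfolding assms translated_curve_translation[symmetric] by blast
  show "irreducible_component_of zariski_torus (characteristic_variety 1 deleted_B3) C"
    unfolding irreducible_component_of_def
  proof (intro conjI allI impI)
    show "C \<subseteq> characteristic_variety 1 deleted_B3"
      unfolding assms using translated_torus_subset_characteristic_variety by blast
    show "irreducible_in zariski_torus C"
      unfolding C by (rule irreducible_translated_curve[OF translation_in_torus])
    fix D assume D: "irreducible_in zariski_torus D \<and> C \<subseteq> D \<and> D \<subseteq> characteristic_variety 1 deleted_B3"
    then have "D \<subseteq> C \<union> exceptional_locus" using characteristic_variety_subset C by blast
    \<comment> \<open>Both sets are closed and \<open>D\<close> is irreducible.\<close>
    then have "D \<subseteq> C \<or> D \<subseteq> exceptional_locus"
      using D closedin_exceptional_locus closedin_translated_curve[OF translation_in_torus]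
      unfolding irreducible_in_def C by blast
    moreover have "\<not> D \<subseteq> exceptional_locus"
    proof
      assume sub: "D \<subseteq> exceptional_locus"
      \<comment> \<open>At the parameter \<open>2\<close> no entry is \<open>1\<close> and the sixth
        has square \<open>1\<close>, so this point of \<open>C\<close> is not exceptional.\<close>
      have "translated_curve translation 2 \<in> D" using D C by auto
      then have "(\<Prod>i\<in>UNIV. translated_curve translation 2 $ i - 1) * ((translated_curve translation 2 $ 6)\<^sup>2 + 1) = 0"
        using sub by (auto simp: exceptional_locus_def)
      then show False unfolding translated_curve_translation UNIV_8 by simp
    qed
    ultimately show "D = C" using D by blast
  qed
  show "\<exists>\<rho> T. \<rho> \<in> carrier torus_group \<and> group.ord torus_group \<rho> = 2 \<and>
           subtorus TYPE(1) T \<and> C = \<rho> <#\<^bsub>torus_group\<^esub> T"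
  proof (intro exI conjI)
    show "translation \<in> carrier torus_group" using translation_in_torus by (simp add: torus_group_def)
    show "group.ord torus_group translation = 2" by (rule ord_translation)
    show "subtorus TYPE(1) (translated_curve 1 ` (- {0}))" by (rule subtorus_curve)
    have "translation * translated_curve 1 t = translated_curve translation t" for t
      by (rule translated_curve_mult) (simp_all add: translation_def)
    then show "C = translation <#\<^bsub>torus_group\<^esub> translated_curve 1 ` (- {0})"
      unfolding C by (auto simp: l_coset_def torus_group_def)
  qed
  show "1 \<notin> C"
  proof
    assume "1 \<in> C"
    then obtain t where "(1 :: complex^8) = translated_curve translation t" unfolding C by blast
    then have "(1 :: complex^8) $ 6 = translated_curve translation t $ 6" by simp
    then show False by (simp add: translated_curve_def translation_def)
  qed
qed

end
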